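(* Let $M>1$. There is a dense subset of $\mathrm{LP}^+_M$ such that for every $a$ in it, $\sigma(J_a)$ is a Cantor set of zero lower box-counting dimension, and the spectral type of $J_a$ is purely singular continuous.
   Context: For a bounded sequence $a=(a_n)_{n\in\mathbb{Z}}$ with $a_n>0$, $J_a$ is the off-diagonal Jacobi matrix on $\ell^2(\mathbb{Z})$, $[J_a u]_n = a_{n-1}u_{n-1} + a_n u_{n+1}$. A sequence is limit-periodic if it is a uniform (sup-norm) limit of periodic sequences. For $M>1$, $\mathrm{LP}^+_M$ is the set of positive limit-periodic sequences $a$ with $M^{-1}\le a_n\le M$ for all $n$, with the metric $\|a-a'\|_\infty$. A Cantor set is a compact subset of $\mathbb{R}$ with empty interior and no isolated points. The spectral type is purely singular continuous if every spectral measure $\mu_\psi$, $\psi\in\ell^2(\mathbb{Z})$, is supported on a Lebesgue-null set and has no atoms. *)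

theory Defs
  imports "HOL-Analysis.Analysis"
begin

definition periodic_seq :: "(int \<Rightarrow> real) \<Rightarrow> bool" where
  "periodic_seq b \<longleftrightarrow> (\<exists>p::int. p > 0 \<and> (\<forall>n. b (n + p) = b n))"

definition limit_periodic :: "(int \<Rightarrow> real) \<Rightarrow> bool" where
  "limit_periodic a \<longleftrightarrow>
     (\<forall>\<epsilon>>0. \<exists>b. periodic_seq b \<and> (\<forall>n. \<bar>a n - b n\<bar> \<le> \<epsilon>))"

definition LP_plus :: "real \<Rightarrow> (int \<Rightarrow> real) set" where
  "LP_plus M = {a. limit_periodic a \<and> (\<forall>n. inverse M \<le> a n \<and> a n \<le> M)}"

definition sup_dense_in :: "(int \<Rightarrow> real) set \<Rightarrow> (int \<Rightarrow> real) set \<Rightarrow> bool" where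
  "sup_dense_in D A \<longleftrightarrow> D \<subseteq> A \<and>
     (\<forall>a\<in>A. \<forall>\<epsilon>>0. \<exists>b\<in>D. \<forall>n. \<bar>a n - b n\<bar> \<le> \<epsilon>)"

definition ell2 :: "(int \<Rightarrow> complex) set" where
  "ell2 = {u. (\<lambda>n. (norm (u n))\<^sup>2) summable_on UNIV}"

definition l2_inner :: "(int \<Rightarrow> complex) \<Rightarrow> (int \<Rightarrow> complex) \<Rightarrow> complex" where
  "l2_inner u v = (\<Sum>\<^sub>\<infinity>n. cnj (u n) * v n)"

definition jacobi :: "(int \<Rightarrow> real) \<Rightarrow> (int \<Rightarrow> complex) \<Rightarrow> (int \<Rightarrow> complex)" where
  "jacobi a u = (\<lambda>n. complex_of_real (a (n - 1)) * u (n - 1) + complex_of_real (a n) * u (n + 1))"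

text \<open>Spectrum of the (bounded, self-adjoint) operator J_a on l^2(Z): the real E for which
  J_a - E is not a bijection of l^2(Z) onto itself (by the bounded inverse theorem this is
  equivalent to non-existence of a bounded inverse; non-real points are always in the resolvent set).\<close>
definition jacobi_spectrum :: "(int \<Rightarrow> real) \<Rightarrow> real set" where
  "jacobi_spectrum a =
     {E. \<not> bij_betw (\<lambda>u n. jacobi a u n - complex_of_real E * u n) ell2 ell2}"

text \<open>Spectral measure of psi: a finite Borel measure on R whose moments are
  <psi, J^k psi>. Since J_a is bounded, such a measure is unique (determinate moment problem).\<close>
definition is_spectral_measure ::
    "(int \<Rightarrow> real) \<Rightarrow> (int \<Rightarrow> complex) \<Rightarrow> real measure \<Rightarrow> bool" where
  "is_spectral_measure a \<psi> \<mu> \<longleftrightarrow>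
     sets \<mu> = sets borel \<and> finite_measure \<mu> \<and>
     (\<forall>k::nat. integrable \<mu> (\<lambda>x. x ^ k) \<and>
        complex_of_real (integral\<^sup>L \<mu> (\<lambda>x. x ^ k)) = l2_inner \<psi> ((jacobi a ^^ k) \<psi>))"

definition purely_singular_continuous_spectrum :: "(int \<Rightarrow> real) \<Rightarrow> bool" where
  "purely_singular_continuous_spectrum a \<longleftrightarrow>
     (\<forall>\<psi>\<in>ell2. \<exists>\<mu>. is_spectral_measure a \<psi> \<mu> \<and>
        (\<exists>N\<in>sets borel. emeasure lborel N = 0 \<and> emeasure \<mu> (UNIV - N) = 0) \<and>
        (\<forall>x. emeasure \<mu> {x} = 0))"

definition cantor_set :: "real set \<Rightarrow> bool" where
  "cantor_set S \<longleftrightarrow> compact S \<and> interior S = {} \<and> (\<forall>x\<in>S. x islimpt S)"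

definition cover_number :: "real set \<Rightarrow> real \<Rightarrow> nat" where
  "cover_number S \<epsilon> = (LEAST n. \<exists>c::nat \<Rightarrow> real. S \<subseteq> (\<Union>i<n. {c i .. c i + \<epsilon>}))"

definition lower_box_dim :: "real set \<Rightarrow> ereal" where
  "lower_box_dim S =
     Liminf (at_right 0) (\<lambda>\<epsilon>. ereal (ln (real (cover_number S \<epsilon>)) / ln (1 / \<epsilon>)))"

end

theory Submission
  imports Defs "HOL-Probability.Probability" "HOL-Real_Asymp.Real_Asymp" "HOL-Computational_Algebra.Polynomial"
begin

text \<open>
  An off-diagonal periodic Jacobi matrix can be perturbed, for each single energy \<open>E\<close>, so that its
  monodromy matrix becomes hyperbolic and \<open>E\<close> leaves the spectrum. By compactness finitely many
  perturbations have no common point in their spectra. A periodic sequence that follows each of these for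
  a long stretch of length \<open>L\<close> has thin spectrum: an approximate eigenvector is exponentially small in the
  middle of one of the stretches, so it may be cut there, and every energy of the spectrum is
  exponentially close to one of \<open>O(L)\<close> energies. The limit-periodic sequences that are very well
  approximated by such sequences are dense. Their spectra are covered by \<open>O(L)\<close> intervals of length
  \<open>exp (- c L)\<close>, which gives measure zero and lower box dimension zero, and a Gordon-type argument
  excludes eigenvalues, hence atoms of spectral measures and isolated points of the spectrum.
\<close>
section \<open>Moment problem on the unit interval\<close>

text \<open>No sequence expels all energies at once, since the spectrum of a bounded self-adjoint
  operator is never empty. Hence there is one stretch per perturbation, and an energy is treated
  only in a stretch whose sequence has a gap there. Polynomially many intervals against
  exponentially small width is what makes \<open>N ^ K * s\<close> small for every exponent
  \<open>K\<close>, and this single condition yields both conclusions about size. Neither band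
  structure nor Floquet theory enters: the gaps and the absence of eigenvalues both come from one
  inequality, \<open>periodic_shift_bound\<close>. The conditions on the approximants are
  inequalities with slack, so they persist in a small ball, and nested balls produce a limit that
  satisfies them for all \<open>K\<close>. The spectrum is handled as the set of energies where
  \<open>J a - E\<close> is not bounded below, because lower bounds are stable under small
  perturbations; only at the end is it identified with the failure of bijectivity. Spectral measures
  are built from their moments, after an affine change of variable that moves the spectrum into
  [0,1].\<close>

lemma binomial_times_falling:
  fixes n k j :: nat
  assumes "j \<le> k" "k \<le> n"
  shows "real (n choose k) * (\<Prod>i<j. real k - real i) = real ((n - j) choose (k - j)) * (\<Prod>i<j. real n - real i)"
  using assms(1)
proof (induction j)
  case 0
  then show ?case by simp
next
  case (Suc j)
  have e: "n - j = Suc (n - Suc j)" "k - j = Suc (k - Suc j)" using Suc.prems assms by auto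
  have *: "real (k - j) * real ((n - j) choose (k - j)) = real (n - j) * real ((n - Suc j) choose (k - Suc j))"
    unfolding e using Suc_times_binomial_eq[of "n - Suc j" "k - Suc j"]
    by (metis of_nat_mult mult.commute)
  have "real (n choose k) * (\<Prod>i<Suc j. real k - real i)
      = (real (n choose k) * (\<Prod>i<j. real k - real i)) * real (k - j)"
    using Suc.prems by (simp add: of_nat_diff)
  also have "\<dots> = (\<Prod>i<j. real n - real i) * (real (k - j) * real ((n - j) choose (k - j)))"
    using Suc by (simp)
  also have "\<dots> = real ((n - Suc j) choose (k - Suc j)) * (\<Prod>i<Suc j. real n - real i)"
    unfolding * using Suc.prems assms by (simp add: of_nat_diff)
  finally show ?case .
qed

text \<open>Both quantities are products of \<open>j\<close> factors of absolute value at most 1, so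
  they differ by at most the sum of the \<open>j\<close> differences of factors. For
  \<open>k < j\<close> the second product contains the factor 0, whence the \<open>else\<close>
  branch; \<open>2 * j < n\<close> bounds its negative factors below by -1.\<close>

lemma falling_ratio_approx:
  fixes n k j :: nat
  assumes "2 * j < n" "k \<le> n"
  shows "\<bar>(real k / real n) ^ j - (if j \<le> k then real ((n - j) choose (k - j)) / real (n choose k) else 0)\<bar>
     \<le> real j * real j / (real n - real j)"
proof -
  have pos: "(\<Prod>i<j. real n - real i) \<noteq> 0" using assms by auto
  have e: "(if j \<le> k then real ((n - j) choose (k - j)) / real (n choose k) else 0)
      = (\<Prod>i<j. (real k - real i) / (real n - real i))"
  proof (cases "j \<le> k")
    case True
    have "real (n choose k) \<noteq> 0" using assms by simp
    with binomial_times_falling[OF True assms(2)] pos show ?thesis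
      using True by (simp add: prod_dividef field_simps)
  next
    case False
    then have "(\<Prod>i<j. (real k - real i) / (real n - real i)) = 0" by auto
    with False show ?thesis by simp
  qed
  have "\<bar>(real k / real n) ^ j - (if j \<le> k then real ((n - j) choose (k - j)) / real (n choose k) else 0)\<bar>
      = norm ((\<Prod>i<j. real k / real n) - (\<Prod>i<j. (real k - real i) / (real n - real i)))"
    unfolding e by simp
  also have "\<dots> \<le> (\<Sum>i<j. norm (real k / real n - (real k - real i) / (real n - real i)))"
  proof (rule norm_prod_diff)
    fix i assume "i \<in> {..<j}"
    then have i: "i < j" by simp
    show "norm (real k / real n) \<le> 1" using assms by (simp add: divide_simps)
    have "- (real n - real i) \<le> real k - real i" "real k - real i \<le> real n - real i" "real n - real i > 0"
      using i assms by auto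
    then have "\<bar>real k - real i\<bar> \<le> real n - real i" by linarith
    then show "norm ((real k - real i) / (real n - real i)) \<le> 1" 
      using \<open>real n - real i > 0\<close> by (simp add: abs_divide)
  qed
  also have "\<dots> \<le> (\<Sum>i<j. real j / (real n - real j))"
  proof (rule sum_mono)
    fix i assume "i \<in> {..<j}"
    then have i: "i < j" by simp
    have n: "real n > 0" "real n - real i > 0" "real n - real j > 0" using i assms by auto
    have "real k / real n - (real k - real i) / (real n - real i) = real i * (1 - real k / real n) / (real n - real i)"
      using n by (simp add: field_simps)
    also have "norm \<dots> \<le> real j * 1 / (real n - real j)"
      unfolding norm_divide norm_mult
    proof (rule frac_le)
      have "0 \<le> real k / real n" "real k / real n \<le> 1" using assms n by (auto simp: divide_simps)
      then have b: "norm (1 - real k / real n) \<le> 1" by simp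
      show "norm (real i) * norm (1 - real k / real n) \<le> real j * 1"
        by (rule mult_mono) (use i b in auto)
    qed (use n i in auto)
    finally show "norm (real k / real n - (real k - real i) / (real n - real i)) \<le> real j / (real n - real j)"
      by simp
  qed
  finally show ?thesis by simp
qed

text \<open>Discretising with the Bernstein weights \<open>w n k\<close> reproduces the falling-factorial moments
  exactly, so the moments of any weak limit are the prescribed ones.\<close>

lemma hausdorff_moment:
  fixes L :: "real poly \<Rightarrow> real"
  assumes add: "\<And>p q. L (p + q) = L p + L q" and smult: "\<And>c p. L (smult c p) = c * L p"
    and one: "L 1 = 1"
    and pos: "\<And>k m. 0 \<le> L ([:0,1:] ^ k * [:1,-1:] ^ m)"
  shows "\<exists>M. real_distribution M \<and> (AE x in M. x \<in> {0..1}) \<and> (\<forall>j::nat. (LINT x|M. x ^ j) = L ([:0,1:] ^ j))"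
proof -
  define X :: "real poly" where "X = [:0,1:]"
  define Y :: "real poly" where "Y = [:1,-1:]"
  have XY: "X + Y = 1" by (simp add: X_def Y_def one_pCons)
  have L0: "L 0 = 0" using smult[of 0 0] by simp
  have L_sum: "L (\<Sum>i\<in>I. f i) = (\<Sum>i\<in>I. L (f i))" for I :: "nat set" and f
    by (induction I rule: infinite_finite_induct) (auto simp: L0 add)
  define w where "w n k = (if k \<le> n then real (n choose k) * L (X ^ k * Y ^ (n - k)) else 0)" for n k
  have w_nonneg: "0 \<le> w n k" for n k
    using pos[of k "n - k"] by (auto simp: w_def X_def Y_def)
  \<comment> \<open>After the substitution \<open>k = i + j\<close> the sum is \<open>L\<close>
    applied to \<open>X ^ j * (X + Y) ^ (n - j)\<close>, and \<open>X + Y = 1\<close>.\<close>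
  have falling: "(\<Sum>k\<le>n. (if j \<le> k then real ((n - j) choose (k - j)) else 0) * L (X ^ k * Y ^ (n - k))) = L (X ^ j)"
    if "j \<le> n" for n j
  proof -
    have "(\<Sum>k\<le>n. (if j \<le> k then real ((n - j) choose (k - j)) else 0) * L (X ^ k * Y ^ (n - k)))
       = (\<Sum>k\<in>{j..n}. real ((n - j) choose (k - j)) * L (X ^ k * Y ^ (n - k)))"
      by (rule sum.mono_neutral_cong_right) auto
    also have "\<dots> = (\<Sum>i\<in>{..n - j}. real ((n - j) choose i) * L (X ^ (i + j) * Y ^ (n - j - i)))"
      by (rule sum.reindex_bij_witness[where i="\<lambda>i. i + j" and j="\<lambda>k. k - j"]) (use that in auto)
    also have "\<dots> = L (\<Sum>i\<in>{..n - j}. smult (real ((n - j) choose i)) (X ^ (i + j) * Y ^ (n - j - i)))"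
      by (simp add: L_sum smult)
    also have "(\<Sum>i\<in>{..n - j}. smult (real ((n - j) choose i)) (X ^ (i + j) * Y ^ (n - j - i))) 
        = X ^ j * (\<Sum>i\<in>{..n - j}. of_nat ((n - j) choose i) * X ^ i * Y ^ (n - j - i))"
      by (simp add: sum_distrib_left power_add of_nat_poly mult_ac)
    also have "\<dots> = X ^ j" using binomial_ring[of X Y "n - j"] XY by simp
    finally show ?thesis .
  qed
  have w_sum: "(\<Sum>k\<le>n. w n k) = 1" for n
    using falling[of 0 n] one by (simp add: w_def)
  define P where "P n = embed_pmf (w n)" for n
  have nn: "(\<integral>\<^sup>+ k. ennreal (w n k) \<partial>count_space UNIV) = 1" for n
  proof -
    have "(\<integral>\<^sup>+ k. ennreal (w n k) \<partial>count_space UNIV) = (\<Sum>k\<in>{..n}. ennreal (w n k))"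
      by (rule nn_integral_count_space') (auto simp: w_def)
    also have "\<dots> = ennreal (\<Sum>k\<le>n. w n k)" using w_nonneg by (simp add: sum_ennreal)
    finally show ?thesis by (simp add: w_sum)
  qed
  have pmf_P: "pmf (P n) k = w n k" for n k
    unfolding P_def by (rule pmf_embed_pmf) (use w_nonneg nn in auto)
  have set_P: "set_pmf (P n) \<subseteq> {..n}" for n
    by (auto simp: set_pmf_eq pmf_P w_def split: if_splits)
  define \<mu> where "\<mu> n = distr (measure_pmf (P n)) borel (\<lambda>k. real k / real n)" for n
  have rd: "real_distribution (\<mu> n)" for n
    unfolding \<mu>_def by (rule prob_space.real_distribution_distr) (auto intro: prob_space_measure_pmf)
  have int_\<mu>: "(LINT x|\<mu> n. f x) = (\<Sum>k\<le>n. f (real k / real n) * w n k)" if "f \<in> borel_measurable borel" for f :: "real \<Rightarrow> real" and n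
    unfolding \<mu>_def using that set_P[of n]
    by (subst integral_distr) (auto simp: integral_measure_pmf_real[OF finite_atMost[of n], of "P n"] subset_iff pmf_P)
  have AE\<mu>: "AE x in \<mu> n. x \<in> {0..1}" for n
    unfolding \<mu>_def using set_P[of n]
    by (subst AE_distr_iff) (auto simp: AE_measure_pmf_iff divide_simps)
  have tight: "tight \<mu>"
    unfolding tight_def
  proof (intro conjI allI impI)
    fix \<epsilon> :: real assume "0 < \<epsilon>"
    have "1 - \<epsilon> < measure (\<mu> n) {-1<..1}" for n
    proof -
      interpret real_distribution "\<mu> n" by (rule rd)
      have "prob {-1<..1::real} = 1"
        using AE\<mu>[of n] by (subst prob_eq_1) (auto elim!: eventually_mono)
      then show ?thesis using \<open>0 < \<epsilon>\<close> by simp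
    qed
    then have "-1 < (1::real) \<and> (\<forall>n. 1 - \<epsilon> < measure (\<mu> n) {-1<..1})" by simp
    then show "\<exists>a b. a < b \<and> (\<forall>n. 1 - \<epsilon> < measure (\<mu> n) {a<..b})"
      by blast
  qed (rule rd)
  obtain r M where r: "strict_mono r" and M: "real_distribution M" and wc: "weak_conv_m (\<mu> \<circ> id \<circ> r) M"
    using tight_imp_convergent_subsubsequence[OF tight strict_mono_id] by blast
  interpret M: real_distribution M by (rule M)
  have conv: "(\<lambda>n. LINT x|\<mu> (r n). f x) \<longlonglongrightarrow> (LINT x|M. f x)"
    if "\<And>x. isCont f x" "\<And>x. \<bar>f x\<bar> \<le> B" for f :: "real \<Rightarrow> real" and B
    using weak_conv_imp_integral_bdd_continuous_conv[of "\<mu> \<circ> id \<circ> r" M f B] rd M wc that by (simp add: o_def)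
  \<comment> \<open>Weak convergence only tests bounded continuous functions. So \<open>cl\<close>
    truncates the monomials, and \<open>d\<close>, which vanishes exactly on [0,1], shows that the
    limit has no mass outside, where the truncation would matter.\<close>
  define cl where "cl x = max 0 (min 1 (x::real))" for x
  have cl_bd: "0 \<le> cl x" "cl x \<le> 1" for x by (auto simp: cl_def)
  have cl_cont: "continuous_on UNIV cl" unfolding cl_def by (intro continuous_intros)
  have cl_id: "x \<in> {0..1} \<Longrightarrow> cl x = x" for x by (auto simp: cl_def)
  define d where "d x = min 1 \<bar>x - cl x\<bar>" for x
  have d_cont: "continuous_on UNIV d" unfolding d_def by (intro continuous_intros cl_cont)
  have d_bd: "\<bar>d x\<bar> \<le> 1" for x by (auto simp: d_def)
  have d_meas: "d \<in> borel_measurable borel" using d_cont by (rule borel_measurable_continuous_onI)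
  have "AE x in \<mu> n. d x = 0" for n
    using AE\<mu>[of n] by (rule eventually_mono) (simp add: d_def cl_id)
  then have "(LINT x|\<mu> n. d x) = 0" for n
    by (rule integral_eq_zero_AE)
  then have "(LINT x|M. d x) = 0"
    using conv[of d 1] d_cont d_bd by (auto simp: continuous_on_eq_continuous_at LIMSEQ_const_iff)
  moreover have "integrable M d"
    by (rule M.integrable_const_bound[of _ 1]) (use d_meas in \<open>auto simp: d_def\<close>)
  ultimately have "AE x in M. d x = 0"
    by (subst (asm) integral_nonneg_eq_0_iff_AE) (auto simp: d_def)
  then have AEM: "AE x in M. x \<in> {0..1}"
    by (rule eventually_mono) (auto simp: d_def cl_def min_def max_def split: if_splits)
  have "(LINT x|M. x ^ j) = L (X ^ j)" for j
  proof -
    have cont: "continuous_on UNIV (\<lambda>x. cl x ^ j)" by (intro continuous_intros cl_cont)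
    have meas: "(\<lambda>x. cl x ^ j) \<in> borel_measurable borel" using cont by (rule borel_measurable_continuous_onI)
    have lim1: "(\<lambda>n. LINT x|\<mu> (r n). cl x ^ j) \<longlonglongrightarrow> (LINT x|M. cl x ^ j)"
      by (rule conv[of _ 1]) (use cont cl_bd in \<open>auto simp: continuous_on_eq_continuous_at power_le_one\<close>)
    have bd: "\<bar>(LINT x|\<mu> n. cl x ^ j) - L (X ^ j)\<bar> \<le> real j * real j / (real n - real j)" if n: "n > 2 * j" for n
    proof -
      let ?\<phi> = "\<lambda>k. if j \<le> k then real ((n - j) choose (k - j)) / real (n choose k) else 0"
      have e1: "L (X ^ j) = (\<Sum>k\<le>n. ?\<phi> k * w n k)"
        unfolding falling[of j n, symmetric, OF less_imp_le, OF le_less_trans[OF _ n], simplified]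
        by (rule sum.cong) (auto simp: w_def)
      have e2: "(LINT x|\<mu> n. cl x ^ j) = (\<Sum>k\<le>n. (real k / real n) ^ j * w n k)"
        unfolding int_\<mu>[OF meas] using n by (intro sum.cong) (auto simp: cl_id divide_simps)
      have "\<bar>(LINT x|\<mu> n. cl x ^ j) - L (X ^ j)\<bar> = \<bar>\<Sum>k\<le>n. ((real k / real n) ^ j - ?\<phi> k) * w n k\<bar>"
        unfolding e1 e2 by (simp add: sum_subtractf left_diff_distrib)
      also have "\<dots> \<le> (\<Sum>k\<le>n. \<bar>(real k / real n) ^ j - ?\<phi> k\<bar> * w n k)"
        by (rule order_trans[OF sum_abs]) (simp add: abs_mult w_nonneg)
      also have "\<dots> \<le> (\<Sum>k\<le>n. (real j * real j / (real n - real j)) * w n k)"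
        by (intro sum_mono mult_right_mono falling_ratio_approx w_nonneg) (use n in auto)
      also have "\<dots> = real j * real j / (real n - real j)"
        by (simp only: sum_distrib_left[symmetric] w_sum mult_1_right)
      finally show ?thesis .
    qed
    have "(\<lambda>n. (LINT x|\<mu> n. cl x ^ j) - L (X ^ j)) \<longlonglongrightarrow> 0"
    proof (rule Lim_null_comparison)
      show "\<forall>\<^sub>F n in sequentially. norm ((LINT x|\<mu> n. cl x ^ j) - L (X ^ j)) \<le> real j * real j / (real n - real j)"
        using eventually_gt_at_top[of "2 * j"] by (rule eventually_mono) (use bd in auto)
      show "(\<lambda>n. real j * real j / (real n - real j)) \<longlonglongrightarrow> 0" 
        by real_asymp
    qed
    then have "(\<lambda>n. LINT x|\<mu> n. cl x ^ j) \<longlonglongrightarrow> L (X ^ j)"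
      by (simp add: LIM_zero_iff)
    then have "(\<lambda>n. LINT x|\<mu> (r n). cl x ^ j) \<longlonglongrightarrow> L (X ^ j)"
      using LIMSEQ_subseq_LIMSEQ[OF _ r] by (simp add: o_def)
    with lim1 have "(LINT x|M. cl x ^ j) = L (X ^ j)" using LIMSEQ_unique by blast
    moreover have "(LINT x|M. cl x ^ j) = (LINT x|M. x ^ j)"
    proof (rule integral_cong_AE)
      show "AE x in M. cl x ^ j = x ^ j"
        using AEM by (rule eventually_mono) (simp add: cl_id)
    qed (use meas in auto)
    ultimately show ?thesis by simp
  qed
  then show ?thesis using M AEM unfolding X_def by blast
qed

section \<open>Spectral measures of bounded self-adjoint operators\<close>

lemma borel_measurable_poly [measurable]: "poly (p :: real poly) \<in> borel_measurable borel"
  by (intro borel_measurable_continuous_onI continuous_intros)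

text \<open>Real scalars suffice: a complex Hilbert space is also a real one, and bounds from below
  and eigenvectors for real energies are the same in both. The complex inner products of the moments
  are recovered in \<open>l2_inner_moment\<close>.\<close>

locale self_adjoint =
  fixes T :: "'a::{real_inner,banach} \<Rightarrow> 'a"
  assumes bounded_linear: "bounded_linear T"
    and symmetric: "inner (T x) y = inner x (T y)"
begin

sublocale bounded_linear T by (rule bounded_linear)

definition poly_op :: "real poly \<Rightarrow> 'a \<Rightarrow> 'a" where
  "poly_op p = fold_coeffs (\<lambda>a f x. a *\<^sub>R x + T (f x)) p (\<lambda>x. 0)"

lemma poly_op_0 [simp]: "poly_op 0 x = 0"
  by (simp add: poly_op_def)

lemma poly_op_pCons [simp]: "poly_op (pCons a p) x = a *\<^sub>R x + T (poly_op p x)"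
  by (cases "p = 0 \<and> a = 0") (auto simp: poly_op_def zero)

lemma poly_op_1 [simp]: "poly_op 1 x = x"
  by (simp add: one_pCons zero)

lemma poly_op_add: "poly_op (p + q) x = poly_op p x + poly_op q x"
  by (induction p q rule: poly_induct2) (simp_all add: add scaleR_add_left)

lemma poly_op_smult: "poly_op (smult c p) x = c *\<^sub>R poly_op p x"
  by (induction p) (simp_all add: scaleR scaleR_add_right)

lemma poly_op_minus: "poly_op (- p) x = - poly_op p x"
  using poly_op_smult[of "-1" p x] by simp

lemma poly_op_diff: "poly_op (p - q) x = poly_op p x - poly_op q x"
  using poly_op_add[of p "-q" x] by (simp add: poly_op_minus)

lemma poly_op_mult: "poly_op (p * q) x = poly_op p (poly_op q x)"
  by (induction p) (simp_all add: poly_op_add poly_op_smult)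

lemma poly_op_symmetric: "inner (poly_op p x) y = inner x (poly_op p y)"
proof (induction p arbitrary: x y)
  case (pCons a p)
  have "poly_op p (T y) = T (poly_op p y)" 
    using poly_op_mult[of p "[:0,1:]" y] poly_op_mult[of "[:0,1:]" p y] by (simp add: mult.commute zero)
  then show ?case by (simp add: pCons inner_add_left inner_add_right symmetric)
qed simp

lemma poly_op_X_power: "poly_op ([:0,1:] ^ k) x = (T ^^ k) x"
  by (induction k) (simp_all add: poly_op_mult zero del: mult_pCons_left)

lemma poly_op_mult_self: "inner x (poly_op (p * p) x) = (norm (poly_op p x))\<^sup>2"
  by (simp add: poly_op_mult poly_op_symmetric[symmetric] power2_norm_eq_inner)

text \<open>The bounded support makes every polynomial integrable, so that the moment equations
  cannot hold merely through the convention that the integral of a non-integrable function is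
  0.\<close>

definition spectral_measure :: "'a \<Rightarrow> real measure \<Rightarrow> bool" where
  "spectral_measure \<psi> \<mu> \<longleftrightarrow> finite_measure \<mu> \<and> sets \<mu> = sets borel \<and>
     (\<exists>K. AE x in \<mu>. \<bar>x\<bar> \<le> K) \<and> (\<forall>p. (LINT x|\<mu>. poly p x) = inner \<psi> (poly_op p \<psi>))"

text \<open>The energies that admit approximate eigenvectors. For a self-adjoint operator this is
  the whole spectrum, see \<open>approx_spectrum_iff_not_bij\<close>.\<close>

definition approx_spectrum :: "real set" where
  "approx_spectrum = {E. \<not> (\<exists>c>0. \<forall>x. c * norm x \<le> norm (T x - E *\<^sub>R x))}"

section \<open>Existence of spectral measures\<close>

text \<open>Polynomials in \<open>T\<close> commute, so the even parts of the exponents can be moved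
  symmetrically to both sides as \<open>q\<close>, and only 1, \<open>s\<close>, \<open>t\<close>
  and \<open>s * t\<close> remain in the middle. The last is nonnegative because
  \<open>s + t = 1\<close> turns it into \<open>s * t * s + t * s * t\<close>.\<close>

lemma bernstein_nonneg:
  assumes s: "\<And>x. 0 \<le> inner x (poly_op s x)" and t: "\<And>x. 0 \<le> inner x (poly_op t x)" and st: "s + t = 1"
  shows "0 \<le> inner \<psi> (poly_op (s ^ k * t ^ m) \<psi>)"
proof -
  have sq: "0 \<le> inner x (poly_op (q * r * q) x)" if "\<And>x. 0 \<le> inner x (poly_op r x)" for q r x
    using that[of "poly_op q x"] by (simp add: poly_op_mult poly_op_symmetric)
  have st0: "0 \<le> inner x (poly_op (s * t) x)" for x
  proof -
    have "s * t = s * t * s + t * s * t"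
    proof -
      have "s * t * s + t * s * t = s * t * (s + t)" by (simp add: algebra_simps)
      then show ?thesis by (simp add: st)
    qed
    then have "inner x (poly_op (s * t) x) = inner x (poly_op (s * t * s) x) + inner x (poly_op (t * s * t) x)"
      by (metis poly_op_add inner_add_right)
    with sq[OF t, of x s] sq[OF s, of x t] show ?thesis by simp
  qed
  define q where "q = s ^ (k div 2) * t ^ (m div 2)"
  define r where "r = s ^ (k mod 2) * t ^ (m mod 2)"
  have "s ^ k = s ^ (k div 2) * s ^ (k mod 2) * s ^ (k div 2)" "t ^ m = t ^ (m div 2) * t ^ (m mod 2) * t ^ (m div 2)"
    by (simp_all only: power_add[symmetric]) (rule arg_cong[of _ _ "power _"], presburger)+
  then have e: "s ^ k * t ^ m = q * r * q" by (simp add: q_def r_def algebra_simps)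
  have "k mod 2 = 0 \<or> k mod 2 = 1" "m mod 2 = 0 \<or> m mod 2 = 1" by auto
  then have "0 \<le> inner x (poly_op r x)" for x
    using s[of x] t[of x] st0[of x] by (auto simp: r_def)
  then show ?thesis unfolding e by (rule sq)
qed

lemma ex_bound: "\<exists>K>0. \<forall>x. norm (T x) \<le> K * norm x"
  using pos_bounded by (auto simp: mult.commute)

lemma inner_poly_op_affine_nonneg:
  assumes K: "K > 0" "\<And>x. norm (T x) \<le> K * norm x" and "\<bar>c\<bar> \<le> 1 / (2 * K)"
  shows "0 \<le> inner x (poly_op [:1 / 2, c:] x)"
proof -
  have "\<bar>c * inner x (T x)\<bar> \<le> (1 / (2 * K)) * (norm x * (K * norm x))"
    unfolding abs_mult
  proof (rule mult_mono)
    show "\<bar>inner x (T x)\<bar> \<le> norm x * (K * norm x)"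
      using Cauchy_Schwarz_ineq2[of x "T x"] K(2)[of x]
      by (meson mult_left_mono norm_ge_zero order_trans)
  qed (use assms in auto)
  also have "\<dots> = (1 / 2) * inner x x"
    using K by (simp add: power2_norm_eq_inner[symmetric] power2_eq_square)
  finally have "\<bar>c * inner x (T x)\<bar> \<le> (1 / 2) * inner x x" .
  then show ?thesis by (simp add: inner_add_right scaleR zero)
qed

text \<open>With a norm bound \<open>K\<close>, both \<open>S = 1/2 + T / (2 K)\<close> and
  \<open>1 - S\<close> are nonnegative, so the normalised functional \<open>L\<close> satisfies the
  hypotheses of \<open>hausdorff_moment\<close>. The measure on [0,1] is carried back by
  \<open>g\<close>, the inverse of the affine map \<open>S\<close>, and multiplied by the squared
  norm of \<open>\<psi>\<close>.\<close>

lemma spectral_measure_exists: "\<exists>\<mu>. spectral_measure \<psi> \<mu>"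
proof (cases "\<psi> = 0")
  case True
  then show ?thesis unfolding spectral_measure_def
    by (intro exI[of _ "null_measure borel"])
       (auto intro!: finite_measureI simp: integral_null_measure AE_iff_null null_sets_def)
next
  case False
  obtain K where K: "K > 0" "\<And>x. norm (T x) \<le> K * norm x" using ex_bound by auto
  define c where "c = (norm \<psi>)\<^sup>2"
  have c: "c > 0" using False by (simp add: c_def)
  define S where "S = [:1 / 2, 1 / (2 * K):]"
  define L where "L p = inner \<psi> (poly_op (p \<circ>\<^sub>p S) \<psi>) / c" for p
  have "\<exists>M. real_distribution M \<and> (AE x in M. x \<in> {0..1}) \<and> (\<forall>j::nat. (LINT x|M. x ^ j) = L ([:0,1:] ^ j))"
  proof (rule hausdorff_moment)
    show "L (p + q) = L p + L q" for p q
      by (simp add: L_def pcompose_add poly_op_add inner_add_right add_divide_distrib)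
    show "L (smult a p) = a * L p" for a p
      by (simp add: L_def pcompose_smult poly_op_smult)
    show "L 1 = 1" using c by (simp add: L_def pcompose_1 c_def power2_norm_eq_inner)
    show "0 \<le> L ([:0, 1:] ^ k * [:1, - 1:] ^ m)" for k m
    proof -
      have pw: "(p ^ j) \<circ>\<^sub>p S = (p \<circ>\<^sub>p S) ^ j" for p :: "real poly" and j
        by (induction j) (simp_all add: pcompose_1 pcompose_mult)
      have e: "[:0, 1:] \<circ>\<^sub>p S = S" "[:1, - 1:] \<circ>\<^sub>p S = [:1 / 2, - 1 / (2 * K):]"
        by (simp_all add: pcompose_pCons S_def)
      have "0 \<le> inner \<psi> (poly_op (S ^ k * [:1 / 2, - 1 / (2 * K):] ^ m) \<psi>)"
      proof (rule bernstein_nonneg)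
        show "0 \<le> inner x (poly_op S x)" for x
          unfolding S_def by (rule inner_poly_op_affine_nonneg[OF K]) (use K in simp)
        show "0 \<le> inner x (poly_op [:1 / 2, - 1 / (2 * K):] x)" for x
          by (rule inner_poly_op_affine_nonneg[OF K]) (use K in simp)
      qed (simp add: S_def one_pCons)
      then show ?thesis using c by (simp add: L_def pcompose_mult pw e)
    qed
  qed
  then obtain M where M: "real_distribution M" and AEM: "AE x in M. x \<in> {0..1}"
    and mom: "\<And>j. (LINT x|M. x ^ j) = L ([:0,1:] ^ j)" by auto
  interpret M: real_distribution M by (rule M)
  have int: "integrable M (\<lambda>x. poly p x)" for p
  proof -
    have "compact (poly p ` {0..1})"
      by (intro compact_continuous_image continuous_intros) auto
    then obtain B where B: "\<And>x. x \<in> {0..1} \<Longrightarrow> norm (poly p x) \<le> B"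
      by (meson bounded_iff compact_imp_bounded imageI)
    show ?thesis
    proof (rule M.integrable_const_bound[of _ B])
      show "AE x in M. norm (poly p x) \<le> B" using AEM by (rule eventually_mono) (use B in auto)
    qed measurable
  qed
  have L0: "L 0 = 0" by (simp add: L_def)
  \<comment> \<open>The factor \<open>x ^ k\<close> makes the induction on \<open>p\<close> close:
    passing to \<open>pCons a p\<close> raises its exponent by one.\<close>
  have "(LINT x|M. x ^ k * poly p x) = L ([:0,1:] ^ k * p)" for k p
  proof (induction p arbitrary: k)
    case (pCons a p)
    have i1: "integrable M (\<lambda>x. a * x ^ k)" using int[of "smult a ([:0,1:] ^ k)"] by simp
    have i2: "integrable M (\<lambda>x. x ^ Suc k * poly p x)" using int[of "[:0,1:] ^ Suc k * p"] by (simp add: mult.assoc)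
    have "(LINT x|M. x ^ k * poly (pCons a p) x) = (LINT x|M. a * x ^ k + x ^ Suc k * poly p x)"
      by (rule Bochner_Integration.integral_cong) (auto simp: algebra_simps)
    also have "\<dots> = a * L ([:0,1:] ^ k) + L ([:0,1:] ^ Suc k * p)"
      using i1 i2 by (simp add: mom pCons.IH[of "Suc k", simplified])
    also have "\<dots> = L (smult a ([:0,1:] ^ k) + [:0,1:] ^ Suc k * p)"
      by (simp add: L_def pcompose_add poly_op_add inner_add_right add_divide_distrib pcompose_smult poly_op_smult
            del: mult_pCons_left)
    also have "smult a ([:0,1:] ^ k) + [:0,1:] ^ Suc k * p = [:0,1:] ^ k * pCons a p"
    proof -
      have "smult a (X ^ k) + X ^ Suc k * p = X ^ k * (smult a 1 + X * p)" for X :: "real poly"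
        by (simp add: algebra_simps)
      from this[of "[:0,1:]"] show ?thesis by simp
    qed
    finally show ?case .
  qed (simp add: L0)
  from this[of 0] have Lp: "(LINT x|M. poly p x) = L p" for p by simp
  define g where "g x = 2 * K * x - K" for x :: real
  have [measurable]: "g \<in> borel_measurable borel" unfolding g_def by simp
  define \<mu> where "\<mu> = density (distr M borel g) (\<lambda>_. ennreal c)"
  have "spectral_measure \<psi> \<mu>"
    unfolding spectral_measure_def
  proof (intro conjI allI exI)
    interpret D: prob_space "distr M borel g" by (rule M.prob_space_distr) simp
    show "finite_measure \<mu>" unfolding \<mu>_def
      by (rule finite_measureI) (simp add: emeasure_density_const D.emeasure_space_1 ennreal_mult_less_top less_top[symmetric] ennreal_mult_eq_top_iff)
    show "sets \<mu> = sets borel" by (simp add: \<mu>_def)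
    have "AE x in M. \<bar>g x\<bar> \<le> K"
      using AEM
    proof (rule eventually_mono)
      fix x :: real assume x: "x \<in> {0..1}"
      then have "0 \<le> K * x" "K * x \<le> K * 1" using K by (auto intro!: mult_left_mono)
      then show "\<bar>g x\<bar> \<le> K" by (auto simp: g_def abs_le_iff algebra_simps)
    qed
    then show "AE x in \<mu>. \<bar>x\<bar> \<le> K" unfolding \<mu>_def
      by (subst AE_density) (auto simp: AE_distr_iff)
    fix p
    have e: "poly p (g x) = poly (p \<circ>\<^sub>p [:-K, 2 * K:]) x" for x
      by (simp add: g_def poly_pcompose algebra_simps)
    have "(LINT x|\<mu>. poly p x) = c * (LINT x|M. poly p (g x))"
      unfolding \<mu>_def using c by (subst integral_density) (auto simp: integral_distr)
    also have "\<dots> = c * L (p \<circ>\<^sub>p [:-K, 2 * K:])" by (simp add: e Lp)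
    also have "\<dots> = inner \<psi> (poly_op (p \<circ>\<^sub>p ([:-K, 2 * K:] \<circ>\<^sub>p S)) \<psi>)"
      using c by (simp add: L_def pcompose_assoc)
    also have "[:-K, 2 * K:] \<circ>\<^sub>p S = [:0, 1:]" using K by (simp add: S_def pcompose_pCons)
    finally show "(LINT x|\<mu>. poly p x) = inner \<psi> (poly_op p \<psi>)" by simp
  qed
  then show ?thesis by blast
qed

lemma spectral_measure_integrable:
  assumes "spectral_measure \<psi> \<mu>"
  shows "integrable \<mu> (poly p)"
proof -
  interpret finite_measure \<mu> using assms by (simp add: spectral_measure_def)
  have [measurable_cong]: "sets \<mu> = sets borel" using assms by (simp add: spectral_measure_def)
  obtain K where K: "AE x in \<mu>. \<bar>x\<bar> \<le> K" using assms by (auto simp: spectral_measure_def)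
  have "compact (poly p ` {-K..K})"
    by (intro compact_continuous_image continuous_intros) auto
  then obtain B where B: "\<And>x. x \<in> {-K..K} \<Longrightarrow> norm (poly p x) \<le> B"
    by (meson bounded_iff compact_imp_bounded imageI)
  show ?thesis
  proof (rule integrable_const_bound[of _ B])
    show "AE x in \<mu>. norm (poly p x) \<le> B" using K
    proof (rule eventually_mono)
      fix x :: real assume "\<bar>x\<bar> \<le> K"
      then have "x \<in> {-K..K}" by auto
      then show "norm (poly p x) \<le> B" by (rule B)
    qed
  qed measurable
qed

lemma spectral_measure_integrable_sq:
  assumes "spectral_measure \<psi> \<mu>"
  shows "integrable \<mu> (\<lambda>x. (poly p x)\<^sup>2)"
proof -
  have "(\<lambda>x. (poly p x)\<^sup>2) = poly (p * p)" by (auto simp: power2_eq_square)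
  then show ?thesis using spectral_measure_integrable[OF assms] by simp
qed

lemma spectral_measure_norm_sq:
  assumes "spectral_measure \<psi> \<mu>"
  shows "(LINT x|\<mu>. (poly p x)\<^sup>2) = (norm (poly_op p \<psi>))\<^sup>2"
proof -
  have "(LINT x|\<mu>. poly (p * p) x) = inner \<psi> (poly_op (p * p) \<psi>)"
    using assms unfolding spectral_measure_def by blast
  then show ?thesis by (simp add: poly_op_mult_self power2_eq_square)
qed

lemma approx_spectrum_dist:
  assumes "c > 0" "\<And>x. c * norm x \<le> norm (T x - E *\<^sub>R x)" "\<bar>F - E\<bar> < c"
  shows "F \<notin> approx_spectrum"
proof -
  have "(c - \<bar>F - E\<bar>) * norm x \<le> norm (T x - F *\<^sub>R x)" for x
  proof -
    have "norm (T x - E *\<^sub>R x) \<le> norm (T x - F *\<^sub>R x) + norm ((F - E) *\<^sub>R x)"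
      using norm_triangle_ineq[of "T x - F *\<^sub>R x" "(F - E) *\<^sub>R x"] by (simp add: scaleR_left_diff_distrib)
    with assms(2)[of x] show ?thesis by (simp add: left_diff_distrib)
  qed
  moreover have "c - \<bar>F - E\<bar> > 0" using assms by simp
  ultimately show ?thesis unfolding approx_spectrum_def by blast
qed

lemma closed_approx_spectrum: "closed approx_spectrum"
proof -
  have "open (- approx_spectrum)"
    unfolding open_dist
  proof
    fix E assume "E \<in> - approx_spectrum"
    then obtain c where c: "c > 0" "\<And>x. c * norm x \<le> norm (T x - E *\<^sub>R x)"
      by (auto simp: approx_spectrum_def)
    show "\<exists>e>0. \<forall>F. dist F E < e \<longrightarrow> F \<in> - approx_spectrum"
      using approx_spectrum_dist[OF c] c(1) by (auto simp: dist_real_def)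
  qed
  then show ?thesis by (simp add: closed_def)
qed

lemma approx_spectrum_le:
  assumes "\<And>x. norm (T x) \<le> K * norm x" "E \<in> approx_spectrum"
  shows "\<bar>E\<bar> \<le> K"
proof (rule ccontr)
  assume "\<not> \<bar>E\<bar> \<le> K"
  moreover have "(\<bar>E\<bar> - K) * norm x \<le> norm (T x - E *\<^sub>R x)" for x
    using assms(1)[of x] norm_triangle_ineq2[of "E *\<^sub>R x" "T x"] by (simp add: norm_minus_commute algebra_simps)
  ultimately have "E \<notin> approx_spectrum" unfolding approx_spectrum_def
    by (auto intro!: exI[of _ "\<bar>E\<bar> - K"])
  with assms show False by simp
qed

lemma compact_approx_spectrum: "compact approx_spectrum"
proof -
  obtain K where K: "K > 0" "\<And>x. norm (T x) \<le> K * norm x" using ex_bound by auto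
  have "bounded approx_spectrum" unfolding bounded_iff
    using approx_spectrum_le[OF K(2)] by auto
  with closed_approx_spectrum show ?thesis by (simp add: compact_eq_bounded_closed)
qed

section \<open>Support and atoms of spectral measures\<close>

text \<open>The polynomials \<open>q n\<close> peak at \<open>E\<close> and act as a cutoff. The
  lower bound applied to \<open>q n\<close> of \<open>T\<close> at \<open>\<psi>\<close> says that
  \<open>((x - E)^2 - c^2) * (q n)^2\<close> has nonnegative integral. Near \<open>E\<close> this
  function is at most a negative multiple of \<open>r ^ (2 * n)\<close>, and its positive part, at
  distance at least \<open>c\<close>, is at most of order \<open>\<rho> ^ (2 * n)\<close> with
  \<open>\<rho> < r\<close>.\<close>

lemma spectral_measure_near_resolvent:
  assumes sm: "spectral_measure \<psi> \<mu>" and c: "c > 0" "\<And>x. c * norm x \<le> norm (T x - E *\<^sub>R x)"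
  shows "emeasure \<mu> {E - c / 2 .. E + c / 2} = 0"
proof -
  interpret finite_measure \<mu> using sm by (simp add: spectral_measure_def)
  have [measurable_cong]: "sets \<mu> = sets borel" using sm by (simp add: spectral_measure_def)
  have sp: "space \<mu> = UNIV" using sets_eq_imp_space_eq[of \<mu> borel] sm by (simp add: spectral_measure_def)
  obtain K where K: "AE x in \<mu>. \<bar>x\<bar> \<le> K" using sm by (auto simp: spectral_measure_def)
  \<comment> \<open>\<open>B\<close> dominates \<open>c\<close> and, on the support,
    \<open>|x - E|\<close>; then \<open>s\<close> keeps the base of the power \<open>q n\<close> at
    least 1/2 there, so that powers preserve inequalities. \<open>\<rho>\<close> and
    \<open>r\<close> are the values of this base at distance \<open>c\<close> and
    \<open>c / 2\<close> from \<open>E\<close>.\<close>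
  define B where "B = \<bar>K\<bar> + \<bar>E\<bar> + c"
  define s where "s = 1 / (2 * B\<^sup>2)"
  define \<rho> where "\<rho> = 1 - s * c\<^sup>2"
  define r where "r = 1 - s * c\<^sup>2 / 4"
  define A where "A = {E - c / 2 .. E + c / 2}"
  have [measurable]: "A \<in> sets borel" by (simp add: A_def)
  have B: "B > 0" "c \<le> B" using c by (auto simp: B_def)
  have s: "s > 0" using B by (simp add: s_def)
  have sB: "s * y \<le> 1 / 2" if "y \<le> B\<^sup>2" for y
  proof -
    have "s * y \<le> s * B\<^sup>2" using s that by simp
    also have "\<dots> = 1 / 2" using B by (simp add: s_def)
    finally show ?thesis .
  qed
  have "s * c\<^sup>2 \<le> 1 / 2" using sB[of "c\<^sup>2"] B c by (simp add: power_mono)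
  moreover have "s * c\<^sup>2 > 0" using s c by simp
  ultimately have \<rho>: "0 < \<rho>" "\<rho> < r" "0 < r" by (auto simp: \<rho>_def r_def)
  define q where "q n = ([:1 - s * E\<^sup>2, 2 * s * E, - s:]) ^ n" for n
  have q: "poly (q n) x = (1 - s * (x - E)\<^sup>2) ^ n" for n x
    by (simp add: q_def power2_eq_square algebra_simps)
  have main: "(3 * c\<^sup>2 / 4) * measure \<mu> A \<le> B\<^sup>2 * measure \<mu> UNIV * (\<rho> / r) ^ (2 * n)" for n
  proof -
    have "(c * norm (poly_op (q n) \<psi>))\<^sup>2 \<le> (norm (poly_op ([:-E, 1:] * q n) \<psi>))\<^sup>2"
      unfolding poly_op_mult using c(2)[of "poly_op (q n) \<psi>"] c(1)
      by (intro power_mono) (auto simp: zero)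
    then have "c\<^sup>2 * (LINT x|\<mu>. (poly (q n) x)\<^sup>2) \<le> (LINT x|\<mu>. (poly ([:-E, 1:] * q n) x)\<^sup>2)"
      by (simp only: spectral_measure_norm_sq[OF sm] power_mult_distrib)
    moreover have i1: "integrable \<mu> (\<lambda>x. (poly (q n) x)\<^sup>2)" 
      by (rule spectral_measure_integrable_sq[OF sm])
    moreover have i2: "integrable \<mu> (\<lambda>x. (poly ([:-E, 1:] * q n) x)\<^sup>2)"
      by (rule spectral_measure_integrable_sq[OF sm])
    ultimately have "0 \<le> (LINT x|\<mu>. (poly ([:-E, 1:] * q n) x)\<^sup>2 - c\<^sup>2 * (poly (q n) x)\<^sup>2)"
      by simp
    also have "\<dots> \<le> (LINT x|\<mu>. B\<^sup>2 * \<rho> ^ (2 * n) - (3 * c\<^sup>2 / 4 * r ^ (2 * n)) * indicator A x)"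
    proof (rule integral_mono_AE)
      show "AE x in \<mu>. (poly ([:-E, 1:] * q n) x)\<^sup>2 - c\<^sup>2 * (poly (q n) x)\<^sup>2
               \<le> B\<^sup>2 * \<rho> ^ (2 * n) - (3 * c\<^sup>2 / 4 * r ^ (2 * n)) * indicator A x"
        using K
      proof (rule eventually_mono)
        fix x assume "\<bar>x\<bar> \<le> K"
        then have "\<bar>x - E\<bar> \<le> B" using c by (auto simp: B_def)
        then have xB: "(x - E)\<^sup>2 \<le> B\<^sup>2" using B abs_le_square_iff[of "x - E" B] by simp
        define z where "z = 1 - s * (x - E)\<^sup>2"
        have z: "z \<ge> 1 / 2" using sB[OF xB] by (simp add: z_def)
        have e: "(poly ([:-E, 1:] * q n) x)\<^sup>2 - c\<^sup>2 * (poly (q n) x)\<^sup>2 = ((x - E)\<^sup>2 - c\<^sup>2) * z ^ (2 * n)"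
        proof -
          have "poly (q n) x = z ^ n" "poly ([:-E, 1:] * q n) x = (x - E) * z ^ n"
            by (simp_all only: poly_mult q z_def) simp
          then show ?thesis by (simp only: power_mult_distrib power_even_eq left_diff_distrib[of "(x - E)\<^sup>2"])
        qed
        consider "x \<in> A" | "x \<notin> A" "\<bar>x - E\<bar> < c" | "x \<notin> A" "c \<le> \<bar>x - E\<bar>" by linarith
        then have "((x - E)\<^sup>2 - c\<^sup>2) * z ^ (2 * n) \<le> B\<^sup>2 * \<rho> ^ (2 * n) - (3 * c\<^sup>2 / 4 * r ^ (2 * n)) * indicator A x"
        proof cases
          case 1
          then have "E - c / 2 \<le> x" "x \<le> E + c / 2" by (auto simp: A_def)
          then have "\<bar>x - E\<bar> \<le> \<bar>c / 2\<bar>" using c(1) by linarith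
          then have le: "(x - E)\<^sup>2 \<le> c\<^sup>2 / 4" using abs_le_square_iff[of "x - E" "c / 2"] by (simp add: power_divide)
          then have "(x - E)\<^sup>2 \<le> c\<^sup>2" "3 * c\<^sup>2 / 4 \<le> c\<^sup>2 - (x - E)\<^sup>2" using zero_le_power2[of c] by linarith+
          note le2 = this
          have "s * (x - E)\<^sup>2 \<le> s * (c\<^sup>2 / 4)" using s le by (intro mult_left_mono) auto
          then have "r \<le> z" by (simp add: z_def r_def)
          then have rz: "r ^ (2 * n) \<le> z ^ (2 * n)" using \<rho> by (intro power_mono) auto
          have "(3 * c\<^sup>2 / 4) * r ^ (2 * n) \<le> (c\<^sup>2 - (x - E)\<^sup>2) * z ^ (2 * n)"
            by (rule mult_mono) (use le2 rz \<rho> in simp_all)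
          moreover have "0 \<le> B\<^sup>2 * \<rho> ^ (2 * n)" using \<rho> by simp
          ultimately show ?thesis using 1 by (simp add: algebra_simps)
        next
          case 2
          then have "(x - E)\<^sup>2 \<le> c\<^sup>2" using c abs_le_square_iff[of "x - E" c] by simp
          then have "((x - E)\<^sup>2 - c\<^sup>2) * z ^ (2 * n) \<le> 0" by (intro mult_nonpos_nonneg) auto
          moreover have "0 \<le> B\<^sup>2 * \<rho> ^ (2 * n)" using \<rho> by simp
          ultimately have "((x - E)\<^sup>2 - c\<^sup>2) * z ^ (2 * n) \<le> B\<^sup>2 * \<rho> ^ (2 * n)" by linarith
          then show ?thesis using 2 by simp
        next
          case 3
          then have ge: "c\<^sup>2 \<le> (x - E)\<^sup>2" using c abs_le_square_iff[of c "x - E"] by simp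
          then have "z \<le> \<rho>" using s by (simp add: z_def \<rho>_def)
          then have "z ^ (2 * n) \<le> \<rho> ^ (2 * n)" using z by (intro power_mono) auto
          then have "((x - E)\<^sup>2 - c\<^sup>2) * z ^ (2 * n) \<le> B\<^sup>2 * \<rho> ^ (2 * n)"
            using xB ge \<rho> z by (intro mult_mono) (auto intro: order_trans[OF _ xB])
          then show ?thesis using 3 by simp
        qed
        then show "(poly ([:-E, 1:] * q n) x)\<^sup>2 - c\<^sup>2 * (poly (q n) x)\<^sup>2
               \<le> B\<^sup>2 * \<rho> ^ (2 * n) - (3 * c\<^sup>2 / 4 * r ^ (2 * n)) * indicator A x"
          unfolding e .
      qed
    qed (use i1 i2 in \<open>auto simp: emeasure_eq_measure\<close>)
    also have "\<dots> = B\<^sup>2 * \<rho> ^ (2 * n) * measure \<mu> UNIV - (3 * c\<^sup>2 / 4 * r ^ (2 * n)) * measure \<mu> A"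
      by (subst Bochner_Integration.integral_diff) (auto simp: emeasure_eq_measure sp)
    finally have "(3 * c\<^sup>2 / 4) * measure \<mu> A * r ^ (2 * n) \<le> B\<^sup>2 * measure \<mu> UNIV * \<rho> ^ (2 * n)"
      by (simp add: algebra_simps)
    then show ?thesis using \<rho> by (simp add: power_divide pos_le_divide_eq)
  qed
  have "(\<lambda>n. B\<^sup>2 * measure \<mu> UNIV * (\<rho> / r) ^ (2 * n)) \<longlonglongrightarrow> B\<^sup>2 * measure \<mu> UNIV * 0"
    unfolding power_mult using \<rho>
    by (intro tendsto_mult_left LIMSEQ_power_zero) (auto simp: power_less_one_iff abs_square_less_1)
  then have "(3 * c\<^sup>2 / 4) * measure \<mu> A \<le> 0"
    using main by (intro LIMSEQ_le_const) auto
  then have "measure \<mu> A \<le> 0" using c by (simp add: mult_le_0_iff)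
  then have "measure \<mu> A = 0" by (simp add: measure_le_0_iff)
  then show ?thesis by (simp add: A_def emeasure_eq_measure)
qed

text \<open>Every point of the complement has a neighbourhood of measure zero; the Lindelof property
  leaves only countably many of them.\<close>

lemma AE_approx_spectrum:
  assumes sm: "spectral_measure \<psi> \<mu>"
  shows "emeasure \<mu> (UNIV - approx_spectrum) = 0"
proof -
  have [measurable_cong]: "sets \<mu> = sets borel" using sm by (simp add: spectral_measure_def)
  define \<F> where "\<F> = {{E - c / 2 <..< E + c / 2} | E c. c > 0 \<and> (\<forall>x. c * norm x \<le> norm (T x - E *\<^sub>R x))}"
  obtain \<F>' where \<F>': "\<F>' \<subseteq> \<F>" "countable \<F>'" "\<Union>\<F>' = \<Union>\<F>"
    by (rule Lindelof[of \<F>]) (auto simp: \<F>_def)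
  have "\<Union>\<F>' \<in> null_sets \<mu>"
  proof (rule null_sets_UN'[of \<F>' "\<lambda>x. x", simplified])
    fix U assume "U \<in> \<F>'"
    then obtain E c where U: "U = {E - c / 2 <..< E + c / 2}" "c > 0" "\<And>x. c * norm x \<le> norm (T x - E *\<^sub>R x)"
      using \<F>' by (auto simp: \<F>_def)
    have "{E - c / 2 .. E + c / 2} \<in> null_sets \<mu>"
      using spectral_measure_near_resolvent[OF sm U(2,3)] by (intro null_setsI) auto
    then show "U \<in> null_sets \<mu>" by (rule null_sets_subset) (auto simp: U(1))
  qed (rule \<F>')
  moreover have "UNIV - approx_spectrum \<subseteq> \<Union>\<F>"
  proof
    fix E assume "E \<in> UNIV - approx_spectrum"
    then obtain c where "c > 0" "\<And>x. c * norm x \<le> norm (T x - E *\<^sub>R x)"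
      by (auto simp: approx_spectrum_def)
    then have "{E - c / 2 <..< E + c / 2} \<in> \<F>" "E \<in> {E - c / 2 <..< E + c / 2}" by (auto simp: \<F>_def)
    then show "E \<in> \<Union>\<F>" by blast
  qed
  ultimately have sub: "\<Union>\<F>' \<in> null_sets \<mu>" "UNIV - approx_spectrum \<subseteq> \<Union>\<F>'" using \<F>'(3) by simp_all
  have "UNIV - approx_spectrum \<in> sets \<mu>"
    using closed_approx_spectrum sm by (simp add: spectral_measure_def)
  from null_sets_subset[OF sub(1) this sub(2)] show ?thesis by (rule null_setsD1)
qed

text \<open>Polynomials \<open>q n\<close> that decrease on the support to the indicator of
  \<open>E\<close> approximate the projection onto the eigenspace. The vectors
  \<open>\<phi> n\<close> converge to its value at \<open>\<psi>\<close>, whose squared norm is the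
  mass of the atom.\<close>

lemma atom_imp_eigenvector:
  assumes sm: "spectral_measure \<psi> \<mu>" and at: "measure \<mu> {E} \<noteq> 0"
  shows "\<exists>\<phi>. \<phi> \<noteq> 0 \<and> T \<phi> = E *\<^sub>R \<phi>"
proof -
  interpret finite_measure \<mu> using sm by (simp add: spectral_measure_def)
  have [measurable_cong]: "sets \<mu> = sets borel" using sm by (simp add: spectral_measure_def)
  obtain K where K: "AE x in \<mu>. \<bar>x\<bar> \<le> K" using sm by (auto simp: spectral_measure_def)
  define B where "B = \<bar>K\<bar> + \<bar>E\<bar> + 1"
  define s where "s = 1 / B\<^sup>2"
  have B: "B > 0" by (auto simp: B_def)
  have s: "s > 0" using B by (simp add: s_def)
  define q where "q n = ([:1 - s * E\<^sup>2, 2 * s * E, - s:]) ^ n" for n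
  have q: "poly (q n) x = (1 - s * (x - E)\<^sup>2) ^ n" for n x
    by (simp add: q_def power2_eq_square algebra_simps)
  have z: "AE x in \<mu>. 0 \<le> 1 - s * (x - E)\<^sup>2"
    using K
  proof (rule eventually_mono)
    fix x assume "\<bar>x\<bar> \<le> K"
    then have "\<bar>x - E\<bar> \<le> B" by (auto simp: B_def)
    then have "(x - E)\<^sup>2 \<le> B\<^sup>2" using B abs_le_square_iff[of "x - E" B] by simp
    then show "0 \<le> 1 - s * (x - E)\<^sup>2" using B by (simp add: s_def)
  qed
  have bd: "AE x in \<mu>. \<forall>n. 0 \<le> poly (q n) x \<and> poly (q n) x \<le> 1"
    using z by (rule eventually_mono) (use s in \<open>auto simp: q power_le_one\<close>)
  have lim: "AE x in \<mu>. (\<lambda>n. poly (q n) x) \<longlonglongrightarrow> indicator {E} x"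
    using z
  proof (rule eventually_mono)
    fix x assume z: "0 \<le> 1 - s * (x - E)\<^sup>2"
    show "(\<lambda>n. poly (q n) x) \<longlonglongrightarrow> indicator {E} x"
    proof (cases "x = E")
      case False
      then have "s * (x - E)\<^sup>2 > 0" using s by simp
      with z False show ?thesis unfolding q by (auto intro!: LIMSEQ_power_zero)
    qed (simp add: q)
  qed
  \<comment> \<open>One dominated convergence with three uses: \<open>A = {E}\<close> shows that
    \<open>q n\<close> converges in mean square, \<open>A = {}\<close> with \<open>f = 1\<close>
    gives the norm of the limit \<open>l\<close>, and \<open>A = {}\<close> with
    \<open>f x = (x - E)^2\<close> gives the norm of \<open>T l - E l\<close>.\<close>
  have L: "(\<lambda>n. LINT x|\<mu>. f x * (poly (q n) x - indicator A x)\<^sup>2) \<longlonglongrightarrow> (LINT x|\<mu>. f x * (indicator {E} x - indicator A x)\<^sup>2)"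
    if [measurable]: "f \<in> borel_measurable borel" "A \<in> sets borel" and f: "AE x in \<mu>. \<bar>f x\<bar> \<le> C" for f :: "real \<Rightarrow> real" and A C
  proof (rule integral_dominated_convergence[where w="\<lambda>x. C"])
    show "AE x in \<mu>. (\<lambda>n. f x * (poly (q n) x - indicator A x)\<^sup>2) \<longlonglongrightarrow> f x * (indicator {E} x - indicator A x)\<^sup>2"
      using lim by (rule eventually_mono) (intro tendsto_intros)
    show "AE x in \<mu>. norm (f x * (poly (q n) x - indicator A x)\<^sup>2) \<le> C" for n
      using bd f
    proof eventually_elim
      case (elim x)
      then have "0 \<le> poly (q n) x" "poly (q n) x \<le> 1" by auto
      then have "\<bar>poly (q n) x - indicator A x\<bar> \<le> \<bar>1\<bar>" by (auto simp: indicator_def)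
      then have "(poly (q n) x - indicator A x)\<^sup>2 \<le> 1\<^sup>2" by (simp only: abs_le_square_iff)
      then have "\<bar>f x\<bar> * (poly (q n) x - indicator A x)\<^sup>2 \<le> C * 1" using elim(2) by (intro mult_mono) auto
      then show ?case by (simp add: abs_mult)
    qed
  qed (auto)
  define \<phi> where "\<phi> n = poly_op (q n) \<psi>" for n
  have sq_int: "integrable \<mu> (\<lambda>x. (poly (q n) x - indicator {E} x)\<^sup>2)" for n
  proof (rule integrable_const_bound[of _ 1])
    show "AE x in \<mu>. norm ((poly (q n) x - indicator {E} x)\<^sup>2) \<le> 1"
      using bd
    proof eventually_elim
      case (elim x)
      then have "0 \<le> poly (q n) x" "poly (q n) x \<le> 1" by auto
      then have "\<bar>poly (q n) x - indicator {E} x\<bar> \<le> \<bar>1\<bar>" by (auto simp: indicator_def)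
      then have "(poly (q n) x - indicator {E} x)\<^sup>2 \<le> 1\<^sup>2" by (simp only: abs_le_square_iff)
      then show ?case by simp
    qed
  qed measurable
  define d where "d n = (LINT x|\<mu>. (poly (q n) x - indicator {E} x)\<^sup>2)" for n
  have d0: "d \<longlonglongrightarrow> 0" using L[of "\<lambda>_. 1" "{E}" 1] by (simp add: d_def[abs_def])
  have diff: "(norm (\<phi> n - \<phi> m))\<^sup>2 \<le> 2 * d n + 2 * d m" for n m
  proof -
    have "(norm (\<phi> n - \<phi> m))\<^sup>2 = (LINT x|\<mu>. (poly (q n - q m) x)\<^sup>2)"
      by (simp only: \<phi>_def spectral_measure_norm_sq[OF sm] poly_op_diff)
    also have "\<dots> \<le> (LINT x|\<mu>. 2 * (poly (q n) x - indicator {E} x)\<^sup>2 + 2 * (poly (q m) x - indicator {E} x)\<^sup>2)"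
    proof (rule integral_mono)
      fix x
      define a where "a = poly (q n) x - indicator {E} x"
      define b where "b = poly (q m) x - indicator {E} x"
      have "(a - b)\<^sup>2 \<le> 2 * a\<^sup>2 + 2 * b\<^sup>2" using zero_le_power2[of "a + b"] by (simp add: power2_eq_square algebra_simps)
      then show "(poly (q n - q m) x)\<^sup>2 \<le> 2 * (poly (q n) x - indicator {E} x)\<^sup>2 + 2 * (poly (q m) x - indicator {E} x)\<^sup>2"
        by (simp add: a_def b_def)
    qed (use sq_int spectral_measure_integrable_sq[OF sm, of "q n - q m"] in auto)
    also have "\<dots> = 2 * d n + 2 * d m" using sq_int by (simp add: d_def)
    finally show ?thesis .
  qed
  have "Cauchy \<phi>"
    unfolding Cauchy_def dist_norm
  proof (intro allI impI)
    fix e :: real assume e: "e > 0"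
    then have "\<forall>\<^sub>F n in sequentially. d n < e\<^sup>2 / 4" using d0 by (intro order_tendstoD) auto
    then obtain N where N: "\<And>n. n \<ge> N \<Longrightarrow> d n < e\<^sup>2 / 4" by (auto simp: eventually_sequentially)
    show "\<exists>N. \<forall>n\<ge>N. \<forall>m\<ge>N. norm (\<phi> n - \<phi> m) < e"
    proof (intro exI allI impI)
      fix n m assume "n \<ge> N" "m \<ge> N"
      then have "(norm (\<phi> n - \<phi> m))\<^sup>2 < e\<^sup>2" using diff[of n m] N[of n] N[of m] by linarith
      then show "norm (\<phi> n - \<phi> m) < e" using e by (simp add: power2_less_imp_less)
    qed
  qed
  then obtain l where l: "\<phi> \<longlonglongrightarrow> l" using Cauchy_convergent by (auto simp: convergent_def)
  have "(\<lambda>n. (norm (\<phi> n))\<^sup>2) \<longlonglongrightarrow> (LINT x|\<mu>. (indicator {E} x :: real)\<^sup>2)"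
    using L[of "\<lambda>_. 1" "{}" 1] by (simp add: \<phi>_def spectral_measure_norm_sq[OF sm, symmetric])
  moreover have "(LINT x|\<mu>. (indicator {E} x :: real)\<^sup>2) = measure \<mu> {E}"
  proof -
    have "(LINT x|\<mu>. (indicator {E} x :: real)\<^sup>2) = (LINT x|\<mu>. indicator {E} x)"
      by (rule Bochner_Integration.integral_cong) (auto simp: indicator_def)
    then show ?thesis by simp
  qed
  moreover have "(\<lambda>n. (norm (\<phi> n))\<^sup>2) \<longlonglongrightarrow> (norm l)\<^sup>2" by (intro tendsto_intros l)
  ultimately have "(norm l)\<^sup>2 = measure \<mu> {E}" using LIMSEQ_unique by metis
  with at have "l \<noteq> 0" by auto
  have E_bd: "AE x in \<mu>. \<bar>(x - E)\<^sup>2\<bar> \<le> B\<^sup>2"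
    using K
  proof (rule eventually_mono)
    fix x assume "\<bar>x\<bar> \<le> K"
    then have "\<bar>x - E\<bar> \<le> B" by (auto simp: B_def)
    then show "\<bar>(x - E)\<^sup>2\<bar> \<le> B\<^sup>2" using B abs_le_square_iff[of "x - E" B] by simp
  qed
  have "(\<lambda>n. (norm (poly_op ([:-E, 1:] * q n) \<psi>))\<^sup>2) \<longlonglongrightarrow> (LINT x|\<mu>. (x - E)\<^sup>2 * (indicator {E} x)\<^sup>2)"
  proof -
    have "(norm (poly_op ([:-E, 1:] * q n) \<psi>))\<^sup>2 = (LINT x|\<mu>. (x - E)\<^sup>2 * (poly (q n) x)\<^sup>2)" for n
      unfolding spectral_measure_norm_sq[OF sm, symmetric] poly_mult power_mult_distrib by simp
    then show ?thesis using L[of "\<lambda>x. (x - E)\<^sup>2" "{}" "B\<^sup>2"] E_bd by simp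
  qed
  moreover have "(LINT x|\<mu>. (x - E)\<^sup>2 * (indicator {E} x)\<^sup>2) = (LINT x|\<mu>. 0)"
    by (rule Bochner_Integration.integral_cong) (auto simp: indicator_def)
  moreover have "poly_op ([:-E, 1:] * q n) \<psi> = T (\<phi> n) - E *\<^sub>R \<phi> n" for n
    unfolding poly_op_mult by (simp add: \<phi>_def zero)
  ultimately have "(\<lambda>n. (norm (T (\<phi> n) - E *\<^sub>R \<phi> n))\<^sup>2) \<longlonglongrightarrow> 0" by simp
  moreover have "(\<lambda>n. (norm (T (\<phi> n) - E *\<^sub>R \<phi> n))\<^sup>2) \<longlonglongrightarrow> (norm (T l - E *\<^sub>R l))\<^sup>2"
    by (intro tendsto_intros l tendsto)
  ultimately have "(norm (T l - E *\<^sub>R l))\<^sup>2 = 0" using LIMSEQ_unique by blast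
  then show ?thesis using \<open>l \<noteq> 0\<close> by auto
qed

text \<open>Around an isolated point \<open>E\<close> the spectral measure of any vector could only
  charge \<open>E\<close> itself, which would be an atom and hence an eigenvalue. Without it the
  measure lives at distance at least \<open>r\<close> from \<open>E\<close>, which contradicts an
  approximate eigenvector of accuracy better than \<open>r\<close>.\<close>

lemma approx_spectrum_islimpt:
  assumes no_ev: "\<And>E \<phi>. T \<phi> = E *\<^sub>R \<phi> \<Longrightarrow> \<phi> = 0" and E: "E \<in> approx_spectrum"
  shows "E islimpt approx_spectrum"
proof (rule ccontr)
  assume "\<not> E islimpt approx_spectrum"
  then obtain r where r: "r > 0" "\<And>F. F \<in> approx_spectrum \<Longrightarrow> F \<noteq> E \<Longrightarrow> \<not> dist F E < r"
    by (auto simp: islimpt_approachable)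
  obtain \<psi> where \<psi>: "norm (T \<psi> - E *\<^sub>R \<psi>) < r * norm \<psi>"
    using E r(1) by (auto simp: approx_spectrum_def not_le)
  obtain \<mu> where sm: "spectral_measure \<psi> \<mu>" using spectral_measure_exists by blast
  interpret finite_measure \<mu> using sm by (simp add: spectral_measure_def)
  have [measurable_cong]: "sets \<mu> = sets borel" using sm by (simp add: spectral_measure_def)
  have "measure \<mu> {E} = 0" using atom_imp_eigenvector[OF sm, of E] no_ev by blast
  then have "{E} \<in> null_sets \<mu>" using sm by (intro null_setsI) (auto simp: emeasure_eq_measure spectral_measure_def)
  moreover have "UNIV - approx_spectrum \<in> null_sets \<mu>"
    using AE_approx_spectrum[OF sm] closed_approx_spectrum sm by (intro null_setsI) (auto simp: spectral_measure_def)
  ultimately have "{E} \<union> (UNIV - approx_spectrum) \<in> null_sets \<mu>" by (rule null_sets.Un)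
  then have "AE x in \<mu>. x \<notin> {E} \<union> (UNIV - approx_spectrum)" by (rule AE_not_in)
  then have AE: "AE x in \<mu>. r\<^sup>2 * (poly 1 x)\<^sup>2 \<le> (poly [:-E, 1:] x)\<^sup>2"
  proof (rule eventually_mono)
    fix x assume "x \<notin> {E} \<union> (UNIV - approx_spectrum)"
    then have "r \<le> \<bar>x - E\<bar>" using r(2)[of x] by (auto simp: dist_real_def)
    then show "r\<^sup>2 * (poly 1 x)\<^sup>2 \<le> (poly [:-E, 1:] x)\<^sup>2" using r(1) abs_le_square_iff[of r "x - E"] by simp
  qed
  have "r\<^sup>2 * (LINT x|\<mu>. (poly 1 x)\<^sup>2) \<le> (LINT x|\<mu>. (poly [:-E, 1:] x)\<^sup>2)"
    unfolding Bochner_Integration.integral_mult_right_zero[symmetric]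
    by (rule integral_mono_AE[OF _ _ AE]) (intro integrable_mult_right spectral_measure_integrable_sq[OF sm])+
  then have "r\<^sup>2 * (norm \<psi>)\<^sup>2 \<le> (norm (T \<psi> - E *\<^sub>R \<psi>))\<^sup>2"
    unfolding spectral_measure_norm_sq[OF sm] by (simp add: zero)
  then have "(r * norm \<psi>)\<^sup>2 \<le> (norm (T \<psi> - E *\<^sub>R \<psi>))\<^sup>2" by (simp add: power_mult_distrib)
  then have "r * norm \<psi> \<le> norm (T \<psi> - E *\<^sub>R \<psi>)" by (rule power2_le_imp_le) simp
  with \<psi> show False by simp
qed

lemma self_adjoint_shift: "self_adjoint (\<lambda>x. T x - E *\<^sub>R x)"
  by (rule self_adjoint.intro)
     (intro bounded_linear_sub bounded_linear bounded_linear_scaleR_right,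
      simp add: inner_diff_left inner_diff_right symmetric)

section \<open>Invertibility and bounds from below\<close>

text \<open>For surjectivity \<open>T (T x) = y\<close> is solved instead of \<open>T x = y\<close>:
  the square of \<open>T\<close> lies between \<open>c^2\<close> and \<open>K^2\<close> as a
  quadratic form, so the gradient step \<open>g\<close> with \<open>s = 1 / (K^2 + c^2)\<close> is a
  contraction.\<close>

lemma bounded_below_imp_bij:
  assumes c: "c > 0" "\<And>x. c * norm x \<le> norm (T x)"
  shows "bij T"
proof (rule bijI)
  show "inj T"
  proof (rule injI)
    fix x y assume "T x = T y"
    then show "x = y" using c(2)[of "x - y"] c(1) by (simp add: diff mult_le_0_iff)
  qed
  obtain K where K: "K > 0" "\<And>x. norm (T x) \<le> K * norm x" using ex_bound by auto
  show "surj T"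
    unfolding surj_def
  proof
    fix y
    define s where "s = 1 / (K\<^sup>2 + c\<^sup>2)"
    have s: "s > 0" "s * K\<^sup>2 < 1" "s * c\<^sup>2 < 1" using K c by (auto simp: s_def add_pos_pos divide_simps)
    define g where "g x = x - s *\<^sub>R (T (T x) - y)" for x
    have contr: "(norm (g x - g x'))\<^sup>2 \<le> (1 - s * c\<^sup>2) * (norm (x - x'))\<^sup>2" for x x'
    proof -
      define v where "v = x - x'"
      have "g x - g x' = v - s *\<^sub>R T (T v)" by (simp add: g_def v_def diff algebra_simps)
      moreover have "(norm (v - s *\<^sub>R T (T v)))\<^sup>2 = (norm v)\<^sup>2 - 2 * s * inner v (T (T v)) + s\<^sup>2 * (norm (T (T v)))\<^sup>2"
        unfolding power2_norm_eq_inner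
        by (simp add: inner_diff_left inner_diff_right inner_commute power2_eq_square algebra_simps)
      ultimately have "(norm (g x - g x'))\<^sup>2 = (norm v)\<^sup>2 - 2 * s * inner v (T (T v)) + s\<^sup>2 * (norm (T (T v)))\<^sup>2"
        by (simp only:)
      also have "inner v (T (T v)) = (norm (T v))\<^sup>2" by (simp add: symmetric[symmetric] power2_norm_eq_inner)
      also have "s\<^sup>2 * (norm (T (T v)))\<^sup>2 \<le> s\<^sup>2 * (K * norm (T v))\<^sup>2"
        using K by (intro mult_left_mono power_mono) auto
      also have "s\<^sup>2 * (K * norm (T v))\<^sup>2 = (s * K\<^sup>2) * (s * (norm (T v))\<^sup>2)" by (simp add: power2_eq_square)
      also have "\<dots> \<le> 1 * (s * (norm (T v))\<^sup>2)" using s by (intro mult_right_mono) auto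
      finally have "(norm (g x - g x'))\<^sup>2 \<le> (norm v)\<^sup>2 - s * (norm (T v))\<^sup>2" by simp
      moreover have "s * (c * norm v)\<^sup>2 \<le> s * (norm (T v))\<^sup>2"
        using s c by (intro mult_left_mono power_mono) auto
      ultimately show ?thesis by (simp add: v_def power_mult_distrib algebra_simps)
    qed
    have "\<exists>!x. g x = x"
    proof (rule banach_fix_type[of "sqrt (1 - s * c\<^sup>2)"])
      show "\<forall>x x'. dist (g x) (g x') \<le> sqrt (1 - s * c\<^sup>2) * dist x x'"
        using real_sqrt_le_mono[OF contr] by (simp add: dist_norm real_sqrt_mult)
    qed (use s c in auto)
    then obtain x where "g x = x" by auto
    then have "y = T (T x)" using s by (simp add: g_def)
    then show "\<exists>x. y = T x" by blast
  qed
qed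

text \<open>Bounded inverse theorem: the functionals \<open>inner u\<close>, for \<open>u\<close> in the preimage of the unit ball,
  are pointwise bounded by symmetry of the inverse, hence uniformly bounded by Baire's theorem.\<close>

lemma bij_imp_bounded_below:
  assumes bij: "bij T"
  shows "\<exists>c>0. \<forall>x. c * norm x \<le> norm (T x)"
proof -
  define A where "A n = {g. \<forall>x. norm (T x) \<le> 1 \<longrightarrow> \<bar>inner x g\<bar> \<le> real n}" for n
  have "UNIV = \<Union> (range A)"
  proof (rule UNIV_eq_I)
    fix g
    obtain h where h: "T h = g" using bij by (metis bij_pointE)
    obtain n where n: "norm h \<le> real n" using real_arch_simple by blast
    have "\<bar>inner x g\<bar> \<le> real n" if "norm (T x) \<le> 1" for x
    proof -
      have "\<bar>inner x g\<bar> = \<bar>inner (T x) h\<bar>" by (simp add: symmetric h)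
      also have "\<dots> \<le> norm (T x) * norm h" by (rule Cauchy_Schwarz_ineq2)
      also have "\<dots> \<le> 1 * norm h" using that by (intro mult_right_mono) auto
      finally show ?thesis using n by simp
    qed
    then have "g \<in> A n" by (simp add: A_def)
    then show "g \<in> \<Union> (range A)" by blast
  qed
  moreover have "closed (A n)" for n
    unfolding A_def by (intro closed_Collect_all closed_Collect_imp closed_Collect_le continuous_intros) auto
  ultimately obtain n where n: "interior (A n) \<noteq> {}"
    using Met_TC.metric_Baire_category_alt[where 'a='a, of "range A"] complete_UNIV[where 'a='a]
    by auto
  then obtain g r where r: "r > 0" "ball g r \<subseteq> A n" by (metis all_not_in_conv mem_interior)
  have "norm x \<le> (4 * real n / r) * norm (T x)" for x
  proof (cases "T x = 0")
    case True
    then have "x = 0" using bij zero by (metis bij_pointE)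
    then show ?thesis by simp
  next
    case False
    define y where "y = (1 / norm (T x)) *\<^sub>R x"
    have "norm (T y) \<le> 1" by (simp add: y_def scaleR)
    have "y \<noteq> 0" using False zero by (auto simp: y_def)
    \<comment> \<open>Moving \<open>g\<close> by \<open>r / 2\<close> in the direction of
      \<open>y\<close> stays in the ball; comparing the two values of the functional
      \<open>inner y\<close> bounds \<open>norm y\<close>.\<close>
    define h where "h = g + (r / (2 * norm y)) *\<^sub>R y"
    have "h \<in> ball g r" "g \<in> ball g r" using r \<open>y \<noteq> 0\<close> by (auto simp: h_def dist_norm)
    then have "h \<in> A n" "g \<in> A n" using r by blast+
    then have "\<bar>inner y h\<bar> \<le> real n" "\<bar>inner y g\<bar> \<le> real n" using \<open>norm (T y) \<le> 1\<close> by (auto simp: A_def)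
    moreover have "inner y h - inner y g = (r / 2) * norm y"
      using \<open>y \<noteq> 0\<close> by (simp add: h_def inner_add_right power2_norm_eq_inner[symmetric] power2_eq_square)
    ultimately have "(r / 2) * norm y \<le> 2 * real n" by linarith
    then have "norm y \<le> 4 * real n / r" using r by (simp add: field_simps)
    then have "norm x / norm (T x) \<le> 4 * real n / r" by (simp add: y_def)
    then show ?thesis using False by (subst (asm) pos_divide_le_eq) auto
  qed
  then have "(1 / (4 * real n / r + 1)) * norm x \<le> norm (T x)" for x
  proof -
    have "norm x \<le> (4 * real n / r + 1) * norm (T x)"
      using \<open>norm x \<le> (4 * real n / r) * norm (T x)\<close> unfolding distrib_right
      by (rule order_trans) simp
    moreover have "4 * real n / r + 1 > 0" using r by (simp add: add_nonneg_pos)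
    ultimately show ?thesis by (simp add: divide_le_eq mult.commute)
  qed
  moreover have "1 / (4 * real n / r + 1) > 0" using r by (simp add: add_nonneg_pos)
  ultimately show ?thesis by blast
qed

end

lemma (in self_adjoint) approx_spectrum_iff_not_bij:
  "E \<in> approx_spectrum \<longleftrightarrow> \<not> bij (\<lambda>x. T x - E *\<^sub>R x)"
proof -
  interpret S: self_adjoint "\<lambda>x. T x - E *\<^sub>R x" by (rule self_adjoint_shift)
  show ?thesis unfolding approx_spectrum_def
    using S.bounded_below_imp_bij S.bij_imp_bounded_below by blast
qed

section \<open>Square-summable sequences and Jacobi operators\<close>

lemma ell2_add:
  assumes "u \<in> ell2" "v \<in> ell2"
  shows "(\<lambda>n. u n + v n) \<in> ell2"
  unfolding ell2_def mem_Collect_eq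
proof (rule summable_on_comparison_test)
  show "(\<lambda>n. 2 * (norm (u n))\<^sup>2 + 2 * (norm (v n))\<^sup>2) summable_on UNIV"
    using assms by (intro summable_on_add summable_on_cmult_right) (auto simp: ell2_def)
  fix n
  have "(norm (u n + v n))\<^sup>2 \<le> (norm (u n) + norm (v n))\<^sup>2"
    by (intro power_mono norm_triangle_ineq) auto
  also have "\<dots> \<le> 2 * (norm (u n))\<^sup>2 + 2 * (norm (v n))\<^sup>2"
    using zero_le_power2[of "norm (u n) - norm (v n)"] by (simp add: power2_eq_square algebra_simps)
  finally show "(norm (u n + v n))\<^sup>2 \<le> 2 * (norm (u n))\<^sup>2 + 2 * (norm (v n))\<^sup>2" .
qed auto

lemma ell2_dominated:
  assumes "u \<in> ell2" "\<And>n. norm (v n) \<le> C * norm (u n)"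
  shows "v \<in> ell2"
  unfolding ell2_def mem_Collect_eq
proof (rule summable_on_comparison_test)
  show "(\<lambda>n. C\<^sup>2 * (norm (u n))\<^sup>2) summable_on UNIV"
    using assms by (intro summable_on_cmult_right) (auto simp: ell2_def)
  show "(norm (v n))\<^sup>2 \<le> C\<^sup>2 * (norm (u n))\<^sup>2" for n
    using power_mono[OF assms(2)[of n], of 2] by (simp add: power_mult_distrib)
qed auto

lemma ell2_scale: "u \<in> ell2 \<Longrightarrow> (\<lambda>n. c * u n) \<in> ell2"
  by (rule ell2_dominated[of u _ "norm c"]) (auto simp: norm_mult)

lemma ell2_inner_summable:
  assumes "u \<in> ell2" "v \<in> ell2"
  shows "(\<lambda>n. cnj (u n) * v n) summable_on UNIV"
proof (rule abs_summable_summable, rule summable_on_comparison_test)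
  show "(\<lambda>n. (norm (u n))\<^sup>2 + (norm (v n))\<^sup>2) summable_on UNIV"
    using assms by (intro summable_on_add) (auto simp: ell2_def)
  show "norm (cnj (u n) * v n) \<le> (norm (u n))\<^sup>2 + (norm (v n))\<^sup>2" for n
  proof -
    have "norm (u n) * norm (v n) \<le> 2 * norm (u n) * norm (v n)" by simp
    also have "\<dots> \<le> (norm (u n))\<^sup>2 + (norm (v n))\<^sup>2" by (rule sum_squares_bound)
    finally show ?thesis by (simp add: norm_mult)
  qed
qed auto

lemma ell2_zero: "(\<lambda>n. 0) \<in> ell2"
  by (simp add: ell2_def)

typedef l2 = ell2 morphisms seq of_seq
  using ell2_zero by blast

setup_lifting type_definition_l2

lemma seq_ell2 [simp]: "seq u \<in> ell2"
  by (rule seq)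

lemma seq_of_seq [simp]: "u \<in> ell2 \<Longrightarrow> seq (of_seq u) = u"
  by (rule of_seq_inverse)

lemma l2_eqI: "(\<And>n. seq u n = seq v n) \<Longrightarrow> u = v"
  by (metis ext seq_inject)

instantiation l2 :: real_vector
begin

lift_definition zero_l2 :: l2 is "\<lambda>n. 0" by (rule ell2_zero)
lift_definition plus_l2 :: "l2 \<Rightarrow> l2 \<Rightarrow> l2" is "\<lambda>u v n. u n + v n" by (rule ell2_add)
lift_definition uminus_l2 :: "l2 \<Rightarrow> l2" is "\<lambda>u n. - u n" using ell2_scale[of _ "-1"] by simp
lift_definition minus_l2 :: "l2 \<Rightarrow> l2 \<Rightarrow> l2" is "\<lambda>u v n. u n - v n"
  using ell2_add ell2_scale[of _ "-1"] by (metis (no_types, lifting) ext diff_conv_add_uminus mult_minus1)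
lift_definition scaleR_l2 :: "real \<Rightarrow> l2 \<Rightarrow> l2" is "\<lambda>c u n. c *\<^sub>R u n"
  by (simp add: scaleR_conv_of_real ell2_scale)

instance
  by standard (transfer; simp add: algebra_simps fun_eq_iff)+

end

lemma seq_zero [simp]: "seq 0 n = 0" by transfer simp
lemma seq_add [simp]: "seq (u + v) n = seq u n + seq v n" by transfer simp
lemma seq_minus [simp]: "seq (- u) n = - seq u n" by transfer simp
lemma seq_diff [simp]: "seq (u - v) n = seq u n - seq v n" by transfer simp
lemma seq_scaleR [simp]: "seq (c *\<^sub>R u) n = c *\<^sub>R seq u n" by transfer simp

lemma seq_sum [simp]: "seq (\<Sum>i\<in>I. f i) n = (\<Sum>i\<in>I. seq (f i) n)"
  by (induction I rule: infinite_finite_induct) auto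

lemma l2_inner_seq_summable: "(\<lambda>n. inner (seq u n) (seq v n)) summable_on UNIV"
proof -
  have "(\<lambda>n. Re (cnj (seq u n) * seq v n)) summable_on UNIV"
    using summable_on_bounded_linear[OF bounded_linear_Re ell2_inner_summable[OF seq_ell2 seq_ell2]]
    by (simp add: o_def)
  then show ?thesis by (simp add: inner_complex_def)
qed

instantiation l2 :: real_inner
begin

definition inner_l2 :: "l2 \<Rightarrow> l2 \<Rightarrow> real" where
  "inner_l2 u v = (\<Sum>\<^sub>\<infinity>n. inner (seq u n) (seq v n))"
definition norm_l2 :: "l2 \<Rightarrow> real" where "norm_l2 u = sqrt (inner u u)"
definition dist_l2 :: "l2 \<Rightarrow> l2 \<Rightarrow> real" where "dist_l2 u v = norm (u - v)"
definition sgn_l2 :: "l2 \<Rightarrow> l2" where "sgn_l2 u = u /\<^sub>R norm u"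
definition uniformity_l2 :: "(l2 \<times> l2) filter" where
  "uniformity_l2 = (INF e\<in>{0 <..}. principal {(x, y). dist x y < e})"
definition open_l2 :: "l2 set \<Rightarrow> bool" where
  "open_l2 U = (\<forall>x\<in>U. eventually (\<lambda>(x', y). x' = x \<longrightarrow> y \<in> U) uniformity)"

instance
proof
  fix u v w :: l2 and r :: real
  show "dist u v = norm (u - v)" by (rule dist_l2_def)
  show "sgn u = u /\<^sub>R norm u" by (rule sgn_l2_def)
  show "uniformity = (INF e\<in>{0 <..}. principal {(x :: l2, y). dist x y < e})" by (rule uniformity_l2_def)
  show "open U = (\<forall>x\<in>U. eventually (\<lambda>(x', y). x' = x \<longrightarrow> y \<in> U) uniformity)" for U :: "l2 set"
    by (rule open_l2_def)
  show "inner u v = inner v u" by (simp add: inner_l2_def inner_commute)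
  show "inner (u + v) w = inner u w + inner v w"
    by (simp add: inner_l2_def inner_add_left infsum_add l2_inner_seq_summable)
  show "inner (r *\<^sub>R u) v = r * inner u v"
    by (simp add: inner_l2_def infsum_cmult_right l2_inner_seq_summable)
  show "0 \<le> inner u u" by (simp add: inner_l2_def infsum_nonneg)
  show "inner u u = 0 \<longleftrightarrow> u = 0"
  proof
    assume 0: "inner u u = 0"
    have "inner (seq u n) (seq u n) = 0" for n
      by (rule nonneg_infsum_le_0D[of "\<lambda>n. inner (seq u n) (seq u n)" UNIV])
         (use 0 l2_inner_seq_summable in \<open>auto simp: inner_l2_def\<close>)
    then show "u = 0" by (intro l2_eqI) simp
  qed (simp add: inner_l2_def)
  show "norm u = sqrt (inner u u)" by (rule norm_l2_def)
qed

end

lemma norm_l2_sq: "(norm (u :: l2))\<^sup>2 = (\<Sum>\<^sub>\<infinity>n. (norm (seq u n))\<^sup>2)"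
  by (simp add: power2_norm_eq_inner inner_l2_def)

lemma summable_norm_sq [simp]: "(\<lambda>n. (norm (seq u n))\<^sup>2) summable_on A"
  using summable_on_subset[of _ UNIV A] seq_ell2[of u] by (auto simp: ell2_def)

lemma norm_seq_le: "norm (seq u n) \<le> norm u"
proof -
  have "(\<Sum>k\<in>{n}. (norm (seq u k))\<^sup>2) \<le> (norm u)\<^sup>2"
    unfolding norm_l2_sq by (rule finite_sum_le_infsum) auto
  then have "(norm (seq u n))\<^sup>2 \<le> (norm u)\<^sup>2" by simp
  then show ?thesis by (rule power2_le_imp_le) simp
qed

lemma norm_l2_mono:
  assumes "\<And>n. norm (seq u n) \<le> norm (seq v n)"
  shows "norm u \<le> norm v"
proof -
  have "(norm u)\<^sup>2 \<le> (norm v)\<^sup>2"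
    unfolding norm_l2_sq by (rule infsum_mono) (use assms in auto)
  then show ?thesis by (rule power2_le_imp_le) simp
qed

lemma norm_l2_le:
  assumes "\<And>F. finite F \<Longrightarrow> (\<Sum>n\<in>F. (norm (seq u n))\<^sup>2) \<le> B\<^sup>2" "B \<ge> 0"
  shows "norm u \<le> B"
proof -
  have "(norm u)\<^sup>2 \<le> B\<^sup>2"
    unfolding norm_l2_sq by (rule infsum_le_finite_sums) (use assms in auto)
  then show ?thesis using assms(2) by (rule power2_le_imp_le)
qed

lemma ell2_iff_finite_sums: "f \<in> ell2 \<longleftrightarrow> (\<exists>B. \<forall>F. finite F \<longrightarrow> (\<Sum>n\<in>F. (norm (f n))\<^sup>2) \<le> B)"
proof
  assume "f \<in> ell2"
  then show "\<exists>B. \<forall>F. finite F \<longrightarrow> (\<Sum>n\<in>F. (norm (f n))\<^sup>2) \<le> B"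
    by (auto simp: ell2_def intro!: exI[of _ "\<Sum>\<^sub>\<infinity>n. (norm (f n))\<^sup>2"] finite_sum_le_infsum)
next
  assume "\<exists>B. \<forall>F. finite F \<longrightarrow> (\<Sum>n\<in>F. (norm (f n))\<^sup>2) \<le> B"
  then obtain B where B: "\<And>F. finite F \<Longrightarrow> (\<Sum>n\<in>F. (norm (f n))\<^sup>2) \<le> B" by blast
  have "bdd_above (sum (\<lambda>n. (norm (f n))\<^sup>2) ` {F. F \<subseteq> UNIV \<and> finite F})"
    by (rule bdd_aboveI2[of _ _ B]) (simp add: B)
  then show "f \<in> ell2" unfolding ell2_def mem_Collect_eq
    by (intro nonneg_bdd_above_summable_on) simp_all
qed

instance l2 :: banach
proof
  fix X :: "nat \<Rightarrow> l2" assume C: "Cauchy X"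
  have "Cauchy (\<lambda>k. seq (X k) n)" for n
  proof (rule metric_CauchyI)
    fix e :: real assume "e > 0"
    then obtain N where N: "\<And>i j. i \<ge> N \<Longrightarrow> j \<ge> N \<Longrightarrow> dist (X i) (X j) < e"
      using C by (meson metric_CauchyD)
    have "dist (seq (X i) n) (seq (X j) n) < e" if "i \<ge> N" "j \<ge> N" for i j
      using norm_seq_le[of "X i - X j" n] N[OF that] by (simp add: dist_norm)
    then show "\<exists>N. \<forall>i\<ge>N. \<forall>j\<ge>N. dist (seq (X i) n) (seq (X j) n) < e" by blast
  qed
  then have "\<exists>l. (\<lambda>k. seq (X k) n) \<longlonglongrightarrow> l" for n
    by (simp add: Cauchy_convergent_iff convergent_def)
  then obtain f where f: "\<And>n. (\<lambda>k. seq (X k) n) \<longlonglongrightarrow> f n" by metis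
  have close: "(\<Sum>n\<in>F. (norm (seq (X i) n - f n))\<^sup>2) \<le> e\<^sup>2"
    if N: "\<And>i j. i \<ge> N \<Longrightarrow> j \<ge> N \<Longrightarrow> dist (X i) (X j) < e" and "i \<ge> N" and "finite F" for N i F and e :: real
  proof (rule LIMSEQ_le_const2)
    show "(\<lambda>j. \<Sum>n\<in>F. (norm (seq (X i) n - seq (X j) n))\<^sup>2) \<longlonglongrightarrow> (\<Sum>n\<in>F. (norm (seq (X i) n - f n))\<^sup>2)"
      by (intro tendsto_intros f)
    have "(\<Sum>n\<in>F. (norm (seq (X i) n - seq (X j) n))\<^sup>2) \<le> e\<^sup>2" if "j \<ge> N" for j
    proof -
      have "(\<Sum>n\<in>F. (norm (seq (X i - X j) n))\<^sup>2) \<le> (norm (X i - X j))\<^sup>2"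
        unfolding norm_l2_sq by (rule finite_sum_le_infsum) (use \<open>finite F\<close> summable_norm_sq[of "X i - X j" UNIV] in auto)
      also have "\<dots> \<le> e\<^sup>2" using N[OF \<open>i \<ge> N\<close> that] by (intro power_mono) (auto simp: dist_norm)
      finally show ?thesis by simp
    qed
    then show "\<exists>N. \<forall>j\<ge>N. (\<Sum>n\<in>F. (norm (seq (X i) n - seq (X j) n))\<^sup>2) \<le> e\<^sup>2" by blast
  qed
  have ex: "\<exists>N. \<forall>i j. i \<ge> N \<longrightarrow> j \<ge> N \<longrightarrow> dist (X i) (X j) < e" if "e > 0" for e
    using C that by (meson metric_CauchyD)
  obtain N where N: "\<And>i j. i \<ge> N \<Longrightarrow> j \<ge> N \<Longrightarrow> dist (X i) (X j) < 1" using ex[of 1] by auto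
  have "(\<lambda>n. seq (X N) n - f n) \<in> ell2"
    unfolding ell2_iff_finite_sums using close[OF N, of N] by auto
  then have "(\<lambda>n. seq (X N) n + (- 1) * (seq (X N) n - f n)) \<in> ell2"
    by (intro ell2_add ell2_scale) auto
  then have fe: "f \<in> ell2" by simp
  have "X \<longlonglongrightarrow> of_seq f"
  proof (rule metric_LIMSEQ_I)
    fix e :: real assume e: "e > 0"
    then obtain N where N: "\<And>i j. i \<ge> N \<Longrightarrow> j \<ge> N \<Longrightarrow> dist (X i) (X j) < e / 2" using ex[of "e / 2"] by auto
    have "dist (X i) (of_seq f) < e" if "i \<ge> N" for i
    proof -
      have "norm (X i - of_seq f) \<le> e / 2"
        using close[OF N that] e fe by (intro norm_l2_le) auto
      then show ?thesis using e by (simp add: dist_norm)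
    qed
    then show "\<exists>N. \<forall>i\<ge>N. dist (X i) (of_seq f) < e" by blast
  qed
  then show "convergent X" by (auto simp: convergent_def)
qed

lift_definition shift :: "int \<Rightarrow> l2 \<Rightarrow> l2" is "\<lambda>j u n. u (n + j)"
proof -
  fix j :: int and u :: "int \<Rightarrow> complex" assume "u \<in> ell2"
  then show "(\<lambda>n. u (n + j)) \<in> ell2"
    using summable_on_reindex_bij_witness[of UNIV "\<lambda>n. n - j" "\<lambda>n. n + j" UNIV
        "\<lambda>n. (norm (u n))\<^sup>2" "\<lambda>n. (norm (u (n + j)))\<^sup>2"] by (simp add: ell2_def)
qed

lemma seq_shift [simp]: "seq (shift j u) n = seq u (n + j)" by transfer simp

lemma shift_0 [simp]: "shift 0 u = u" by (rule l2_eqI) simp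
lemma shift_shift [simp]: "shift i (shift j u) = shift (i + j) u" by (rule l2_eqI) (simp add: add_ac)

lemma inner_shift: "inner (shift j u) v = inner u (shift (- j) v)"
  unfolding inner_l2_def
  by (rule infsum_reindex_bij_witness[of UNIV "\<lambda>n. n - j" "\<lambda>n. n + j"]) auto

lemma norm_shift [simp]: "norm (shift j u) = norm u"
  by (simp add: norm_eq_sqrt_inner inner_shift)

text \<open>\<open>of_seq\<close> is unspecified outside \<open>ell2\<close>; this is why facts
  about \<open>mult_op\<close>, \<open>J\<close> and \<open>res\<close> carry a bound on the
  coefficients.\<close>

definition mult_op :: "(int \<Rightarrow> real) \<Rightarrow> l2 \<Rightarrow> l2" where
  "mult_op a u = of_seq (\<lambda>n. a n *\<^sub>R seq u n)"

lemma seq_mult_op: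
  assumes "\<And>n. \<bar>a n\<bar> \<le> C"
  shows "seq (mult_op a u) n = a n *\<^sub>R seq u n"
proof -
  have "(\<lambda>n. a n *\<^sub>R seq u n) \<in> ell2"
    by (rule ell2_dominated[of "seq u" _ C]) (use assms in \<open>auto intro!: mult_right_mono\<close>)
  then show ?thesis by (simp add: mult_op_def)
qed

lemma norm_mult_op_le:
  assumes "\<And>n. \<bar>a n\<bar> \<le> C"
  shows "norm (mult_op a u) \<le> C * norm u"
proof -
  have C: "C \<ge> 0" using assms[of 0] by linarith
  have "norm (mult_op a u) \<le> norm (C *\<^sub>R u)"
    by (rule norm_l2_mono) (use C assms in \<open>auto simp: seq_mult_op[of a C, OF assms] intro!: mult_right_mono\<close>)
  then show ?thesis using C by simp
qed

definition cut :: "int set \<Rightarrow> l2 \<Rightarrow> l2" where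
  "cut A = mult_op (indicator A)"

lemma seq_cut: "seq (cut A u) n = (if n \<in> A then seq u n else 0)"
proof -
  have "seq (cut A u) n = indicator A n *\<^sub>R seq u n"
    unfolding cut_def by (rule seq_mult_op[of _ 1]) (simp add: indicator_def)
  then show ?thesis by (simp add: indicator_def)
qed

text \<open>The two summands are adjoint to each other, which makes the symmetry of
  \<open>J a\<close> a consequence of \<open>inner_shift\<close>.\<close>

definition J :: "(int \<Rightarrow> real) \<Rightarrow> l2 \<Rightarrow> l2" where
  "J a u = shift (-1) (mult_op a u) + mult_op a (shift 1 u)"

lemma seq_J:
  assumes "\<And>n. \<bar>a n\<bar> \<le> C"
  shows "seq (J a u) n = jacobi a (seq u) n"
  unfolding J_def jacobi_def seq_add seq_shift seq_mult_op[of a C, OF assms] scaleR_conv_of_real by simp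

lemma norm_J_le:
  assumes "\<And>n. \<bar>a n\<bar> \<le> C"
  shows "norm (J a u) \<le> 2 * C * norm u"
proof -
  have "norm (J a u) \<le> norm (shift (-1) (mult_op a u)) + norm (mult_op a (shift 1 u))"
    unfolding J_def by (rule norm_triangle_ineq)
  with norm_mult_op_le[of a C u, OF assms] norm_mult_op_le[of a C "shift 1 u", OF assms] show ?thesis by simp
qed

lemma J_self_adjoint:
  assumes a: "\<And>n. \<bar>a n\<bar> \<le> C"
  shows "self_adjoint (J a)"
proof
  show "J a (u + v) = J a u + J a v" for u v
    by (rule l2_eqI) (simp add: seq_J[of a C, OF a] jacobi_def algebra_simps)
  show "J a (r *\<^sub>R u) = r *\<^sub>R J a u" for r u
    by (rule l2_eqI) (simp add: seq_J[of a C, OF a] jacobi_def algebra_simps scaleR_conv_of_real)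
  show "\<exists>K. \<forall>x. norm (J a x) \<le> norm x * K"
    using norm_J_le[of a C, OF a] by (metis mult.commute)
  have m: "inner (mult_op a u) v = inner u (mult_op a v)" for u v
    by (simp add: inner_l2_def seq_mult_op[of a C, OF a])
  show "inner (J a u) v = inner u (J a v)" for u v
    unfolding J_def by (simp add: inner_add_left inner_add_right inner_shift m)
qed

text \<open>Turns a pointwise bound by finitely many neighbours into a norm bound: the sequence of
  absolute values of \<open>u\<close> has the norm of \<open>u\<close>, and shifts are
  isometries.\<close>

lemma norm_l2_le_shifts:
  assumes "finite I" "C \<ge> 0" and le: "\<And>n. norm (seq v n) \<le> C * (\<Sum>i\<in>I. norm (seq u (n + i)))"
  shows "norm v \<le> C * real (card I) * norm u"
proof -
  define w where "w = of_seq (\<lambda>n. of_real (norm (seq u n)))"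
  have "(\<lambda>n. of_real (norm (seq u n)) :: complex) \<in> ell2"
    by (rule ell2_dominated[of "seq u" _ 1]) auto
  then have w: "seq w n = of_real (norm (seq u n))" for n by (simp add: w_def)
  have nw: "norm w = norm u" by (rule antisym; rule norm_l2_mono) (auto simp: w)
  have "norm v \<le> norm (C *\<^sub>R (\<Sum>i\<in>I. shift i w))"
  proof (rule norm_l2_mono)
    fix n
    have "norm (seq (C *\<^sub>R (\<Sum>i\<in>I. shift i w)) n) = norm (of_real (C * (\<Sum>i\<in>I. norm (seq u (n + i)))) :: complex)"
      by (simp add: w scaleR_conv_of_real del: of_real_sum) (simp add: norm_mult flip: of_real_sum)
    also have "\<dots> = C * (\<Sum>i\<in>I. norm (seq u (n + i)))"
      using assms by (simp only: norm_of_real) (simp add: sum_nonneg)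
    finally show "norm (seq v n) \<le> norm (seq (C *\<^sub>R (\<Sum>i\<in>I. shift i w)) n)" using le[of n] by simp
  qed
  also have "\<dots> \<le> C * (\<Sum>i\<in>I. norm (shift i w))"
    using norm_sum[of "\<lambda>i. shift i w" I] assms(2) by (simp add: mult_left_mono)
  finally show ?thesis by (simp add: nw mult_ac)
qed

section \<open>Transfer matrices of periodic Jacobi operators\<close>

datatype mat2 = Mat2 (m11: real) (m12: real) (m21: real) (m22: real)

instantiation mat2 :: monoid_mult
begin

definition one_mat2 :: mat2 where "one_mat2 = Mat2 1 0 0 1"
definition times_mat2 :: "mat2 \<Rightarrow> mat2 \<Rightarrow> mat2" where
  "times_mat2 A B = Mat2 (m11 A * m11 B + m12 A * m21 B) (m11 A * m12 B + m12 A * m22 B)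
                         (m21 A * m11 B + m22 A * m21 B) (m21 A * m12 B + m22 A * m22 B)"

instance
  by standard (auto simp: one_mat2_def times_mat2_def algebra_simps)

end

definition tr2 :: "mat2 \<Rightarrow> real" where "tr2 A = m11 A + m22 A"
definition det2 :: "mat2 \<Rightarrow> real" where "det2 A = m11 A * m22 A - m12 A * m21 A"

lemma tr2_commute: "tr2 (A * B) = tr2 (B * A)"
  by (simp add: tr2_def times_mat2_def)

lemma det2_mult: "det2 (A * B) = det2 A * det2 B"
  by (simp add: det2_def times_mat2_def algebra_simps)

lemma det2_one [simp]: "det2 1 = 1"
  by (simp add: det2_def one_mat2_def)

lemma tr2_conj:
  assumes "X * A = A * Y" "det2 A = 1"
  shows "tr2 X = tr2 Y"
proof -
  define B where "B = Mat2 (m22 A) (- m12 A) (- m21 A) (m11 A)"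
  have B: "A * B = 1" "B * A = 1"
    using assms(2) by (simp_all add: B_def times_mat2_def one_mat2_def det2_def algebra_simps)
  have "X = A * Y * B" using assms(1) B(1) by (metis mult.assoc mult.right_neutral)
  then have "tr2 X = tr2 (B * (A * Y))" by (simp add: tr2_commute)
  then show ?thesis using B(2) by (simp add: mult.assoc[symmetric])
qed

definition act :: "mat2 \<Rightarrow> complex \<times> complex \<Rightarrow> complex \<times> complex" where
  "act A v = (m11 A *\<^sub>R fst v + m12 A *\<^sub>R snd v, m21 A *\<^sub>R fst v + m22 A *\<^sub>R snd v)"

lemma act_mult: "act (A * B) v = act A (act B v)"
  by (simp add: act_def times_mat2_def algebra_simps)

lemma act_one [simp]: "act 1 v = v"
  by (simp add: act_def one_mat2_def)

lemma act_diff: "act A (v - w) = act A v - act A w"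
  by (simp add: act_def algebra_simps)

lemma cayley_hamilton:
  assumes "det2 A = 1"
  shows "act A (act A v) - tr2 A *\<^sub>R act A v + v = 0"
proof -
  have d: "m12 A * m21 A = m11 A * m22 A - 1" using assms by (simp add: det2_def)
  have e: "m11 A * m11 A + m12 A * m21 A - (m11 A + m22 A) * m11 A + 1 = 0"
    "m21 A * m12 A + m22 A * m22 A - (m11 A + m22 A) * m22 A + 1 = 0"
    using d by (simp_all add: algebra_simps)
  have "fst (act A (act A v) - tr2 A *\<^sub>R act A v + v) =
     (m11 A * m11 A + m12 A * m21 A - (m11 A + m22 A) * m11 A + 1) *\<^sub>R fst v"
    "snd (act A (act A v) - tr2 A *\<^sub>R act A v + v) =
     (m21 A * m12 A + m22 A * m22 A - (m11 A + m22 A) * m22 A + 1) *\<^sub>R snd v"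
    by (simp_all add: act_def tr2_def algebra_simps)
  then show ?thesis unfolding e by (simp add: prod_eq_iff)
qed

definition norm1 :: "complex \<times> complex \<Rightarrow> real" where "norm1 v = norm (fst v) + norm (snd v)"

lemma norm1_triangle: "norm1 (v + w) \<le> norm1 v + norm1 w"
  using norm_triangle_ineq[of "fst v" "fst w"] norm_triangle_ineq[of "snd v" "snd w"]
  by (simp add: norm1_def)

lemma norm1_triangle_diff: "norm1 (v - w) \<le> norm1 v + norm1 w"
  using norm_triangle_ineq4[of "fst v" "fst w"] norm_triangle_ineq4[of "snd v" "snd w"]
  by (simp add: norm1_def)

lemma norm1_scaleR: "norm1 (c *\<^sub>R v) = \<bar>c\<bar> * norm1 v"
  by (simp add: norm1_def distrib_left)

text \<open>The operator norm with respect to \<open>norm1\<close>.\<close>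

definition colnorm :: "mat2 \<Rightarrow> real" where
  "colnorm A = max (\<bar>m11 A\<bar> + \<bar>m21 A\<bar>) (\<bar>m12 A\<bar> + \<bar>m22 A\<bar>)"

lemma norm1_act: "norm1 (act A v) \<le> colnorm A * norm1 v"
proof -
  have "norm1 (act A v) \<le> (\<bar>m11 A\<bar> + \<bar>m21 A\<bar>) * norm (fst v) + (\<bar>m12 A\<bar> + \<bar>m22 A\<bar>) * norm (snd v)"
    using norm_triangle_ineq[of "m11 A *\<^sub>R fst v" "m12 A *\<^sub>R snd v"]
      norm_triangle_ineq[of "m21 A *\<^sub>R fst v" "m22 A *\<^sub>R snd v"]
    by (simp add: norm1_def act_def algebra_simps)
  also have "\<dots> \<le> colnorm A * norm (fst v) + colnorm A * norm (snd v)"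
    by (intro add_mono mult_right_mono) (auto simp: colnorm_def)
  finally show ?thesis by (simp add: norm1_def algebra_simps)
qed

lemma colnorm_mult: "colnorm (A * B) \<le> colnorm A * colnorm B"
proof -
  have col: "\<bar>m11 A * x + m12 A * y\<bar> + \<bar>m21 A * x + m22 A * y\<bar> \<le> colnorm A * (\<bar>x\<bar> + \<bar>y\<bar>)" for x y
    using norm1_act[of A "(of_real x, of_real y)"]
    by (simp add: norm1_def act_def scaleR_conv_of_real flip: of_real_mult of_real_add)
  have nonneg: "0 \<le> colnorm A" by (simp add: colnorm_def le_max_iff_disj)
  have B: "\<bar>m11 B\<bar> + \<bar>m21 B\<bar> \<le> colnorm B" "\<bar>m12 B\<bar> + \<bar>m22 B\<bar> \<le> colnorm B"
    by (simp_all add: colnorm_def)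
  show ?thesis
    unfolding colnorm_def[of "A * B"]
  proof (rule max.boundedI)
    show "\<bar>m11 (A * B)\<bar> + \<bar>m21 (A * B)\<bar> \<le> colnorm A * colnorm B"
      using order_trans[OF col mult_left_mono[OF B(1) nonneg]] by (simp add: times_mat2_def)
    show "\<bar>m12 (A * B)\<bar> + \<bar>m22 (A * B)\<bar> \<le> colnorm A * colnorm B"
      using order_trans[OF col mult_left_mono[OF B(2) nonneg]] by (simp add: times_mat2_def)
  qed
qed

lemma abs_tr2_le: "\<bar>tr2 A\<bar> \<le> 2 * colnorm A"
  by (auto simp: tr2_def colnorm_def max_def)

text \<open>Transfer matrices act on the vectors \<open>(u (n + 1), a n * u n)\<close>. In this normalization they have
  determinant 1, and multiplying \<open>a n\<close> by \<open>exp (- t)\<close> multiplies them by \<open>diag (exp t, exp (- t))\<close>.\<close>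

definition transfer :: "(int \<Rightarrow> real) \<Rightarrow> real \<Rightarrow> int \<Rightarrow> mat2" where
  "transfer a E n = Mat2 (E / a n) (- 1 / a n) (a n) 0"

text \<open>The factors belong to the sites \<open>n + 1\<close> to \<open>n + q\<close>, so that
  for solutions of the eigenvalue equation the product carries \<open>phase_vec\<close> at
  \<open>n\<close> to \<open>phase_vec\<close> at \<open>n + q\<close>.\<close>

primrec transfers :: "(int \<Rightarrow> real) \<Rightarrow> real \<Rightarrow> int \<Rightarrow> nat \<Rightarrow> mat2" where
  "transfers a E n 0 = 1"
| "transfers a E n (Suc q) = transfer a E (n + int (Suc q)) * transfers a E n q"

lemma transfers_add: "transfers a E n (q + r) = transfers a E (n + int q) r * transfers a E n q"
  by (induction r) (simp_all add: mult.assoc algebra_simps)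

lemma det2_transfers:
  assumes "\<And>n. a n \<noteq> 0"
  shows "det2 (transfers a E n q) = 1"
  by (induction q) (simp_all add: det2_mult, simp add: det2_def transfer_def assms)

lemma transfers_periodic:
  assumes "\<And>n. a (n + int q) = a n"
  shows "transfers a E (n + int q) r = transfers a E n r"
proof (induction r)
  case (Suc r)
  have "a (n + int q + int (Suc r)) = a (n + int (Suc r))"
    using assms[of "n + int (Suc r)"] by (simp add: algebra_simps)
  then show ?case using Suc by (simp add: transfer_def)
qed simp

text \<open>Moving the base point by one site conjugates the monodromy matrix by a one-step transfer
  matrix, which has determinant 1.\<close>

lemma tr2_transfers:
  assumes a: "\<And>n. a n \<noteq> 0" and per: "\<And>n. a (n + int q) = a n"
  shows "tr2 (transfers a E n q) = tr2 (transfers a E 0 q)"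
proof -
  have step: "tr2 (transfers a E (n + 1) q) = tr2 (transfers a E n q)" for n
  proof (rule tr2_conj)
    have "transfers a E n (1 + q) = transfers a E (n + 1) q * transfers a E n 1"
      using transfers_add[of a E n 1 q] by simp
    moreover have "transfers a E n (q + 1) = transfers a E n 1 * transfers a E n q"
      using transfers_add[of a E n q 1] transfers_periodic[of a q E n 1, OF per] by simp
    ultimately show "transfers a E (n + 1) q * transfers a E n 1 = transfers a E n 1 * transfers a E n q"
      by (simp add: add.commute)
  qed (rule det2_transfers[OF a])
  show ?thesis
  proof (induction n rule: int_induct[of _ 0])
    case (step2 i)
    then show ?case using step[of "i - 1"] by simp
  qed (use step in auto)
qed

lemma colnorm_transfers:
  assumes a: "\<And>n. inverse M \<le> a n" "\<And>n. a n \<le> M" and "M > 1" "\<bar>E\<bar> \<le> R"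
  shows "colnorm (transfers a E n q) \<le> (M * R + M) ^ q"
proof (induction q)
  case 0
  then show ?case by (simp add: colnorm_def one_mat2_def)
next
  case (Suc q)
  have t: "colnorm (transfer a E k) \<le> M * R + M" for k
  proof -
    have pos: "a k > 0" using a(1)[of k] assms by (meson inverse_positive_iff_positive less_le_trans order_less_trans zero_less_one)
    have inv: "1 / a k \<le> M" using a(1)[of k] pos assms by (simp add: field_simps)
    have "\<bar>E / a k\<bar> = \<bar>E\<bar> * (1 / a k)" using pos by simp
    also have "\<dots> \<le> R * M" using inv assms pos by (intro mult_mono) auto
    finally have "\<bar>E / a k\<bar> \<le> M * R" by (simp add: mult.commute)
    moreover have "0 \<le> M * R" using assms by auto
    ultimately show ?thesis using pos inv a(2)[of k] by (auto simp: colnorm_def transfer_def)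
  qed
  have "colnorm (transfers a E n (Suc q)) \<le> colnorm (transfer a E (n + int (Suc q))) * colnorm (transfers a E n q)"
    by (simp only: transfers.simps colnorm_mult)
  also have "\<dots> \<le> (M * R + M) * (M * R + M) ^ q"
    using t Suc assms by (intro mult_mono) (auto simp: colnorm_def)
  finally show ?case by simp
qed

definition phase_vec :: "(int \<Rightarrow> real) \<Rightarrow> (int \<Rightarrow> complex) \<Rightarrow> int \<Rightarrow> complex \<times> complex" where
  "phase_vec a u n = (u (n + 1), a n *\<^sub>R u n)"

lemma phase_vec_step:
  assumes "a n \<noteq> 0"
  shows "phase_vec a u n = act (transfer a E n) (phase_vec a u (n - 1))
           + ((1 / a n) *\<^sub>R (jacobi a u n - of_real E * u n), 0)"
proof -
  have "u (n + 1) = (E / a n) *\<^sub>R u n + (- 1 / a n) *\<^sub>R (a (n - 1) *\<^sub>R u (n - 1))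
      + (1 / a n) *\<^sub>R (jacobi a u n - of_real E * u n)"
    using assms by (simp add: jacobi_def scaleR_conv_of_real field_simps)
  then show ?thesis by (simp add: phase_vec_def act_def transfer_def)
qed

text \<open>Variation of constants with crude constants: each site injects the residual of the
  eigenvalue equation, divided by \<open>a n\<close> and so at most multiplied by \<open>M\<close>,
  and every later step amplifies it by at most \<open>M * R + M\<close>.\<close>

lemma phase_vec_transfers:
  assumes a: "\<And>n. inverse M \<le> a n" "\<And>n. a n \<le> M" and M: "M > 1" and E: "\<bar>E\<bar> \<le> R"
  shows "norm1 (phase_vec a u (n + int q) - act (transfers a E n q) (phase_vec a u n))
     \<le> M * (M * R + M) ^ q * (\<Sum>j=1..q. norm (jacobi a u (n + int j) - of_real E * u (n + int j)))"
proof (induction q)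
  case 0
  then show ?case by (simp add: norm1_def)
next
  case (Suc q)
  define f where "f n = jacobi a u n - of_real E * u n" for n
  define K where "K = M * R + M"
  have "M * R \<ge> 0" using M E by (intro mult_nonneg_nonneg) auto
  then have K: "K \<ge> 1" using M by (simp add: K_def)
  define m where "m = n + int (Suc q)"
  have pos: "a m > 0" using a(1)[of m] M by (meson inverse_positive_iff_positive less_le_trans order_less_trans zero_less_one)
  have inv: "1 / a m \<le> M" using a(1)[of m] pos M by (simp add: field_simps)
  have m1: "m - 1 = n + int q" by (simp add: m_def)
  have "phase_vec a u m - act (transfers a E n (Suc q)) (phase_vec a u n)
      = act (transfer a E m) (phase_vec a u (n + int q) - act (transfers a E n q) (phase_vec a u n)) + ((1 / a m) *\<^sub>R f m, 0)"
  proof -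
    have "n + int (Suc q) = m" by (simp add: m_def)
    then show ?thesis using phase_vec_step[of a m u E] pos by (simp add: act_mult act_diff f_def m1 del: of_nat_Suc)
  qed
  then have "norm1 (phase_vec a u m - act (transfers a E n (Suc q)) (phase_vec a u n))
     \<le> norm1 (act (transfer a E m) (phase_vec a u (n + int q) - act (transfers a E n q) (phase_vec a u n))) + norm1 ((1 / a m) *\<^sub>R f m, 0)"
    by (simp add: norm1_triangle)
  also have "\<dots> \<le> K * (M * K ^ q * (\<Sum>j=1..q. norm (f (n + int j)))) + M * K ^ Suc q * norm (f m)"
  proof (rule add_mono)
    have c: "colnorm (transfer a E m) \<le> K" 
      using colnorm_transfers[of M a E R "m - 1" 1, OF a M E] by (simp add: K_def)
    show "norm1 (act (transfer a E m) (phase_vec a u (n + int q) - act (transfers a E n q) (phase_vec a u n)))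
       \<le> K * (M * K ^ q * (\<Sum>j=1..q. norm (f (n + int j))))"
      by (rule order_trans[OF norm1_act]) (use c Suc K in \<open>auto intro!: mult_mono simp: f_def K_def norm1_def\<close>)
    have "norm1 ((1 / a m) *\<^sub>R f m, 0) = (1 / a m) * norm (f m)" using pos by (simp add: norm1_def)
    also have "\<dots> \<le> (M * K ^ Suc q) * norm (f m)"
    proof (rule mult_right_mono)
      have "M * 1 \<le> M * K ^ Suc q" using K M by (intro mult_left_mono one_le_power) auto
      then show "1 / a m \<le> M * K ^ Suc q" using inv by simp
    qed simp
    finally show "norm1 ((1 / a m) *\<^sub>R f m, 0) \<le> M * K ^ Suc q * norm (f m)" .
  qed
  also have "\<dots> = M * K ^ Suc q * (\<Sum>j=1..Suc q. norm (f (n + int j)))"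
    by (simp add: m_def algebra_simps)
  finally show ?case by (simp add: f_def K_def m_def)
qed

text \<open>With \<open>K = M * R + M\<close>, the error at one site is at most
  \<open>4 * M * K ^ (2 * q)\<close> times the residuals over a window of two periods; the 2q sites
  of this window supply the remaining factor.\<close>

definition period_const :: "real \<Rightarrow> real \<Rightarrow> nat \<Rightarrow> real" where
  "period_const M R q = 8 * real q * M * (M * R + M) ^ (2 * q)"

text \<open>The operator identity \<open>\<Delta>(J) = S\<^sup>q + S\<^sup>-\<^sup>q\<close> for the discriminant of a periodic Jacobi operator, in the
  quantitative form that is obtained from the Cayley--Hamilton theorem for the monodromy matrix.\<close>

lemma periodic_shift_bound:
  assumes a: "\<And>n. inverse M \<le> a n" "\<And>n. a n \<le> M" and M: "M > 1" and E: "\<bar>E\<bar> \<le> R"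
    and per: "\<And>n. a (n + int q) = a n"
  shows "norm (shift (int q) u - tr2 (transfers a E 0 q) *\<^sub>R u + shift (- int q) u)
     \<le> period_const M R q * norm (J a u - E *\<^sub>R u)"
proof -
  have a0: "a n > 0" for n using a(1)[of n] M by (meson inverse_positive_iff_positive less_le_trans order_less_trans zero_less_one)
  have abd: "\<bar>a n\<bar> \<le> M" for n using a0[of n] a(2)[of n] by simp
  define K where "K = M * R + M"
  have "M * R \<ge> 0" using M E by (intro mult_nonneg_nonneg) auto
  then have K: "K \<ge> 1" using M by (simp add: K_def)
  define \<tau> where "\<tau> = tr2 (transfers a E 0 q)"
  define f where "f = J a u - E *\<^sub>R u"
  define S where "S m k = (\<Sum>j=1..k. norm (seq f (m + int j)))" for m k
  have f: "seq f n = jacobi a (seq u) n - of_real E * seq u n" for n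
    by (simp add: f_def seq_J[of a M, OF abd] scaleR_conv_of_real)
  have pt: "norm (seq (shift (int q) u - \<tau> *\<^sub>R u + shift (- int q) u) n)
      \<le> (4 * M * K ^ (2 * q)) * (\<Sum>i\<in>{-int q..<int q}. norm (seq f (n + i)))" for n
  proof -
    \<comment> \<open>The first component of \<open>phase_vec\<close> at \<open>m\<close> is the
      value at \<open>m + 1\<close>. With this base point the vectors at \<open>m\<close>,
      \<open>m + q\<close>, \<open>m + 2 q\<close> therefore show \<open>u\<close> at
      \<open>n - q\<close>, \<open>n\<close>, \<open>n + q\<close>.\<close>
    define m where "m = n - int q - 1"
    define v where "v = phase_vec a (seq u)"
    define \<Phi> where "\<Phi> = transfers a E m q"
    have \<Phi>': "transfers a E (m + int q) q = \<Phi>" unfolding \<Phi>_def by (rule transfers_periodic) (rule per)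
    have \<tau>: "tr2 \<Phi> = \<tau>" unfolding \<Phi>_def \<tau>_def by (rule tr2_transfers[where a=a and q=q, OF _ per]) (use a0 in \<open>auto simp: less_le\<close>)
    have det: "det2 \<Phi> = 1" unfolding \<Phi>_def by (rule det2_transfers) (use a0 in \<open>auto simp: less_le\<close>)
    have cn: "colnorm \<Phi> \<le> K ^ q" unfolding \<Phi>_def K_def by (rule colnorm_transfers[OF a M E])
    have \<tau>_le: "\<bar>\<tau>\<bar> \<le> 2 * K ^ q" using abs_tr2_le[of \<Phi>] cn \<tau> by simp
    define e1 where "e1 = v (m + int q) - act \<Phi> (v m)"
    define e2 where "e2 = v (m + int q + int q) - act \<Phi> (v (m + int q))"
    have e1: "norm1 e1 \<le> M * K ^ q * S m q"
      unfolding e1_def v_def \<Phi>_def K_def S_def f by (rule phase_vec_transfers[OF a M E])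
    have e2: "norm1 e2 \<le> M * K ^ q * S (m + int q) q"
      unfolding e2_def v_def \<Phi>'[symmetric] K_def S_def f by (rule phase_vec_transfers[OF a M E])
    have S0: "S m q \<ge> 0" "S (m + int q) q \<ge> 0" by (auto simp: S_def sum_nonneg)
    \<comment> \<open>For exact solutions this combination vanishes by Cayley-Hamilton; the errors
      \<open>e1\<close> and \<open>e2\<close> of the two periods are all that is left.\<close>
    have "v (m + int q + int q) - \<tau> *\<^sub>R v (m + int q) + v m
        = (act \<Phi> (act \<Phi> (v m)) - \<tau> *\<^sub>R act \<Phi> (v m) + v m) + (act \<Phi> e1 + e2 - \<tau> *\<^sub>R e1)"
      by (simp add: e1_def e2_def act_diff algebra_simps)
    also have "act \<Phi> (act \<Phi> (v m)) - \<tau> *\<^sub>R act \<Phi> (v m) + v m = 0" using cayley_hamilton[OF det] by (simp add: \<tau>)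
    finally have id: "v (m + int q + int q) - \<tau> *\<^sub>R v (m + int q) + v m = act \<Phi> e1 + e2 - \<tau> *\<^sub>R e1" by simp
    have "norm (seq (shift (int q) u - \<tau> *\<^sub>R u + shift (- int q) u) n) \<le> norm1 (v (m + int q + int q) - \<tau> *\<^sub>R v (m + int q) + v m)"
      by (simp add: norm1_def v_def phase_vec_def m_def algebra_simps)
    also have "\<dots> \<le> norm1 (act \<Phi> e1) + norm1 e2 + \<bar>\<tau>\<bar> * norm1 e1"
      unfolding id using norm1_triangle_diff[of "act \<Phi> e1 + e2" "\<tau> *\<^sub>R e1"] norm1_triangle[of "act \<Phi> e1" e2]
      by (simp add: norm1_scaleR)
    also have "\<dots> \<le> K ^ q * norm1 e1 + norm1 e2 + 2 * K ^ q * norm1 e1"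
      using norm1_act[of \<Phi> e1] cn \<tau>_le by (intro add_mono mult_right_mono order_trans[OF norm1_act]) (auto simp: norm1_def)
    also have "\<dots> \<le> 3 * K ^ q * (M * K ^ q * S m q) + K ^ q * (M * K ^ q * S (m + int q) q)"
    proof -
      have "K ^ q * norm1 e1 \<le> K ^ q * (M * K ^ q * S m q)" using e1 K by (intro mult_left_mono) auto
      moreover have "1 * (M * K ^ q * S (m + int q) q) \<le> K ^ q * (M * K ^ q * S (m + int q) q)"
        using K M S0 by (intro mult_right_mono one_le_power) auto
      ultimately show ?thesis using e2 by linarith
    qed
    also have "\<dots> \<le> 4 * (K ^ q * (M * K ^ q * (S m q + S (m + int q) q)))"
    proof -
      have "0 \<le> K ^ q * (M * K ^ q * S m q)" "0 \<le> K ^ q * (M * K ^ q * S (m + int q) q)" using K M S0 by auto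
      then show ?thesis by (simp add: algebra_simps)
    qed
    also have "S m q + S (m + int q) q = S m (q + q)"
    proof -
      have "S m (q + q) = S m q + (\<Sum>j=q+1..q+q. norm (seq f (m + int j)))"
        unfolding S_def using sum.ub_add_nat[of 1 q "\<lambda>j. norm (seq f (m + int j))" q] by simp
      also have "(\<Sum>j=q+1..q+q. norm (seq f (m + int j))) = S (m + int q) q"
        unfolding S_def by (rule sum.reindex_bij_witness[of _ "\<lambda>j. j + q" "\<lambda>j. j - q"]) (auto simp: of_nat_diff)
      finally show ?thesis by simp
    qed
    also have "S m (q + q) = (\<Sum>i\<in>{-int q..<int q}. norm (seq f (n + i)))"
      unfolding S_def m_def
      by (rule sum.reindex_bij_witness[of _ "\<lambda>i. nat (i + int q + 1)" "\<lambda>j. int j - int q - 1"]) (auto simp: algebra_simps)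
    finally show ?thesis unfolding power_even_eq power2_eq_square by (simp add: mult_ac)
  qed
  have "norm (shift (int q) u - \<tau> *\<^sub>R u + shift (- int q) u)
      \<le> (4 * M * K ^ (2 * q)) * real (card {-int q..<int q}) * norm f"
    by (rule norm_l2_le_shifts[OF _ _ pt]) (use M K in auto)
  also have "\<dots> = period_const M R q * norm f" by (simp add: period_const_def K_def)
  finally show ?thesis by (simp add: \<tau>_def f_def)
qed

text \<open>The sum of the shifts by \<open>q\<close> and \<open>- q\<close> has norm at most 2, so
  its difference from the trace is bounded below by the excess of the trace over 2;
  \<open>periodic_shift_bound\<close> transfers this to \<open>J a - E\<close>.\<close>

lemma hyperbolic_bounded_below:
  assumes a: "\<And>n. inverse M \<le> a n" "\<And>n. a n \<le> M" and M: "M > 1"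
    and per: "\<And>n. a (n + int q) = a n" and hyp: "\<bar>tr2 (transfers a E 0 q)\<bar> > 2"
  shows "\<exists>c>0. \<forall>u. c * norm u \<le> norm (J a u - E *\<^sub>R u)"
proof -
  define \<tau> where "\<tau> = tr2 (transfers a E 0 q)"
  define C where "C = \<bar>period_const M \<bar>E\<bar> q\<bar> + 1"
  have le: "(\<bar>\<tau>\<bar> - 2) * norm u \<le> C * norm (J a u - E *\<^sub>R u)" for u
  proof -
    define h where "h = shift (int q) u - \<tau> *\<^sub>R u + shift (- int q) u"
    have "norm h \<le> period_const M \<bar>E\<bar> q * norm (J a u - E *\<^sub>R u)"
      unfolding h_def \<tau>_def by (rule periodic_shift_bound[where a=a and q=q, OF a M _ per]) auto
    also have "\<dots> \<le> C * norm (J a u - E *\<^sub>R u)" by (intro mult_right_mono) (auto simp: C_def)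
    finally have h: "norm h \<le> C * norm (J a u - E *\<^sub>R u)" .
    have "\<bar>\<tau>\<bar> * norm u = norm (shift (int q) u + shift (- int q) u - h)" by (simp add: h_def)
    also have "\<dots> \<le> norm (shift (int q) u) + norm (shift (- int q) u) + norm h"
      using norm_triangle_ineq4[of "shift (int q) u + shift (- int q) u" h]
        norm_triangle_ineq[of "shift (int q) u" "shift (- int q) u"] by linarith
    finally show ?thesis using h by (simp add: algebra_simps)
  qed
  show ?thesis
  proof (intro exI[of _ "(\<bar>\<tau>\<bar> - 2) / C"] conjI allI)
    show "(\<bar>\<tau>\<bar> - 2) / C > 0" using hyp by (simp add: \<tau>_def C_def add_nonneg_pos)
    have "C > 0" by (simp add: C_def add_nonneg_pos)
    then show "(\<bar>\<tau>\<bar> - 2) / C * norm u \<le> norm (J a u - E *\<^sub>R u)" for u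
      using le[of u] by (simp add: field_simps)
  qed
qed

section \<open>Absence of eigenvalues\<close>

lemma cut_finite_approx:
  assumes "e > 0"
  shows "\<exists>F. finite F \<and> norm (u - cut F u) < e"
proof -
  have "((\<lambda>n. (norm (seq u n))\<^sup>2) has_sum (norm u)\<^sup>2) UNIV"
    unfolding norm_l2_sq by (rule has_sum_infsum) simp
  then have "(sum (\<lambda>n. (norm (seq u n))\<^sup>2) \<longlongrightarrow> (norm u)\<^sup>2) (finite_subsets_at_top UNIV)"
    by (simp add: has_sum_def)
  then have "\<forall>\<^sub>F F in finite_subsets_at_top UNIV. (norm u)\<^sup>2 - e\<^sup>2 < (\<Sum>n\<in>F. (norm (seq u n))\<^sup>2)"
    using assms by (intro order_tendstoD) auto
  then obtain F where F: "finite F" "(norm u)\<^sup>2 - e\<^sup>2 < (\<Sum>n\<in>F. (norm (seq u n))\<^sup>2)"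
    by (auto simp: eventually_finite_subsets_at_top)
  have "(norm u)\<^sup>2 = (\<Sum>\<^sub>\<infinity>n\<in>F \<union> (UNIV - F). (norm (seq u n))\<^sup>2)" by (simp add: norm_l2_sq)
  also have "\<dots> = (\<Sum>\<^sub>\<infinity>n\<in>F. (norm (seq u n))\<^sup>2) + (\<Sum>\<^sub>\<infinity>n\<in>UNIV - F. (norm (seq u n))\<^sup>2)"
    by (rule infsum_Un_disjoint) auto
  also have "(\<Sum>\<^sub>\<infinity>n\<in>UNIV - F. (norm (seq u n))\<^sup>2) = (norm (u - cut F u))\<^sup>2"
    unfolding norm_l2_sq by (rule infsum_cong_neutral) (auto simp: seq_cut)
  finally have "(norm (u - cut F u))\<^sup>2 < e\<^sup>2" using F by simp
  then have "norm (u - cut F u) < e" by (rule power2_less_imp_less) (use assms in simp)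
  then show ?thesis using F(1) by blast
qed

text \<open>For a finitely supported vector the supports become disjoint after a long shift; the
  general case follows by truncation.\<close>

lemma shift_weakly_null: "(\<lambda>k. inner (shift (int k) u) u) \<longlonglongrightarrow> 0"
proof (rule LIMSEQ_I)
  fix r :: real assume r: "r > 0"
  define e where "e = r / (2 * norm u + 1)"
  have e: "e > 0" using r by (simp add: e_def add_nonneg_pos)
  obtain F where F: "finite F" "norm (u - cut F u) < e" using cut_finite_approx[OF e] by blast
  define w where "w = cut F u"
  have nw: "norm w \<le> norm u" by (rule norm_l2_mono) (auto simp: w_def seq_cut)
  obtain N where N: "\<And>n. n \<in> F \<Longrightarrow> \<bar>n\<bar> \<le> N"
    using bdd_above_finite[of "abs ` F"] F(1) by (auto simp: bdd_above_def)
  have "norm (inner (shift (int k) u) u - 0) < r" if k: "k > nat (2 * N)" for k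
  proof -
    have "inner (shift (int k) w) w = 0"
    proof -
      have "inner (seq w (n + int k)) (seq w n) = 0" for n
        using N[of n] N[of "n + int k"] k by (auto simp: w_def seq_cut)
      then show ?thesis by (simp add: inner_l2_def)
    qed
    then have "inner (shift (int k) u) u = inner (shift (int k) u - shift (int k) w) u + inner (shift (int k) w) (u - w)"
      by (simp add: inner_diff_left inner_diff_right)
    also have "shift (int k) u - shift (int k) w = shift (int k) (u - w)" by (rule l2_eqI) simp
    finally have "\<bar>inner (shift (int k) u) u\<bar> \<le> norm (u - w) * norm u + norm w * norm (u - w)"
      using Cauchy_Schwarz_ineq2[of "shift (int k) (u - w)" u] Cauchy_Schwarz_ineq2[of "shift (int k) w" "u - w"]
      by (simp add: abs_le_iff) 
    also have "\<dots> \<le> e * norm u + norm u * e"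
      using F(2) nw e by (intro add_mono mult_mono) (auto simp: w_def)
    also have "\<dots> < r"
    proof -
      have "2 * norm u + 1 \<noteq> 0" using norm_ge_zero[of u] by linarith
      then have "e * (2 * norm u + 1) = r" by (simp add: e_def)
      then show ?thesis using e by (simp add: algebra_simps)
    qed
    finally show ?thesis by simp
  qed
  then show "\<exists>N. \<forall>k\<ge>N. norm (inner (shift (int k) u) u - 0) < r" by (intro exI[of _ "Suc (nat (2 * N))"]) auto
qed

text \<open>A Gordon-type argument. For an eigenvector \<open>u\<close> the vectors \<open>S\<^sup>q u\<close>, \<open>u\<close>, \<open>S\<^sup>-\<^sup>q u\<close> become linearly dependent
  along the periods \<open>q\<close> of the approximants, whereas they become orthogonal as \<open>q\<close> tends to infinity.\<close>

lemma gordon_no_eigenvector: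
  assumes M: "M > 1" and a: "\<And>n. \<bar>a n\<bar> \<le> M"
    and appr: "\<And>k::nat. \<exists>b q. q \<ge> k \<and> (\<forall>n. b (n + int q) = b n) \<and> (\<forall>n. inverse M \<le> b n \<and> b n \<le> M) \<and>
       (\<exists>\<rho>. (\<forall>n. \<bar>a n - b n\<bar> \<le> \<rho>) \<and> real (Suc k) * (\<rho> * period_const M (2 * M) q) \<le> 1)"
    and ev: "J a u = E *\<^sub>R u"
  shows "u = 0"
proof (rule ccontr)
  assume u: "u \<noteq> 0"
  have E: "\<bar>E\<bar> \<le> 2 * M"
    using norm_J_le[of a M u, OF a] u by (simp add: ev)
  define q where "q k = (SOME q. \<exists>b. q \<ge> k \<and> (\<forall>n. b (n + int q) = b n) \<and> (\<forall>n. inverse M \<le> b n \<and> b n \<le> M) \<and>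
       (\<exists>\<rho>. (\<forall>n. \<bar>a n - b n\<bar> \<le> \<rho>) \<and> real (Suc k) * (\<rho> * period_const M (2 * M) q) \<le> 1))" for k
  have q: "\<exists>b. q k \<ge> k \<and> (\<forall>n. b (n + int (q k)) = b n) \<and> (\<forall>n. inverse M \<le> b n \<and> b n \<le> M) \<and>
       (\<exists>\<rho>. (\<forall>n. \<bar>a n - b n\<bar> \<le> \<rho>) \<and> real (Suc k) * (\<rho> * period_const M (2 * M) (q k)) \<le> 1)" for k
    unfolding q_def by (rule someI_ex) (use appr[of k] in blast)
  have "\<exists>\<tau>. norm (shift (int (q k)) u - \<tau> *\<^sub>R u + shift (- int (q k)) u) \<le> 2 * norm u / real (Suc k)" for k
  proof -
    obtain b \<rho> where b: "\<And>n. b (n + int (q k)) = b n" "\<And>n. inverse M \<le> b n" "\<And>n. b n \<le> M"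
      and \<rho>: "\<And>n. \<bar>a n - b n\<bar> \<le> \<rho>" and le: "real (Suc k) * (\<rho> * period_const M (2 * M) (q k)) \<le> 1"
      using q[of k] by blast
    have bM: "\<bar>b n\<bar> \<le> M" for n
    proof -
      have "0 < inverse M" using M by simp
      then show ?thesis using b(2)[of n] b(3)[of n] by linarith
    qed
    have pc: "0 \<le> period_const M (2 * M) (q k)" using M by (simp add: period_const_def)
    have "seq (J b u - E *\<^sub>R u) n = - seq (J (\<lambda>n. a n - b n) u) n" for n
      unfolding ev[symmetric] 
      by (simp add: seq_J[of a M, OF a] seq_J[of b M, OF bM] seq_J[of "\<lambda>n. a n - b n" \<rho>, OF \<rho>] jacobi_def algebra_simps)
    then have "J b u - E *\<^sub>R u = - J (\<lambda>n. a n - b n) u" by (intro l2_eqI) simp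
    then have n1: "norm (J b u - E *\<^sub>R u) \<le> 2 * \<rho> * norm u"
      using norm_J_le[of "\<lambda>n. a n - b n" \<rho> u, OF \<rho>] by simp
    have "norm (shift (int (q k)) u - tr2 (transfers b E 0 (q k)) *\<^sub>R u + shift (- int (q k)) u)
       \<le> period_const M (2 * M) (q k) * norm (J b u - E *\<^sub>R u)"
      by (rule periodic_shift_bound[where a=b and q="q k", OF b(2,3) M E b(1)])
    also have "\<dots> \<le> period_const M (2 * M) (q k) * (2 * \<rho> * norm u)"
      using n1 pc by (rule mult_left_mono)
    also have "\<dots> = (\<rho> * period_const M (2 * M) (q k)) * (2 * norm u)" by simp
    also have "\<dots> \<le> (1 / real (Suc k)) * (2 * norm u)"
      using le by (intro mult_right_mono) (auto simp: pos_le_divide_eq mult.commute)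
    finally show ?thesis by (auto simp: algebra_simps)
  qed
  then obtain \<tau> where \<tau>: "\<And>k. norm (shift (int (q k)) u - \<tau> k *\<^sub>R u + shift (- int (q k)) u) \<le> 2 * norm u / real (Suc k)"
    by metis
  define h where "h k = shift (int (q k)) u - \<tau> k *\<^sub>R u + shift (- int (q k)) u" for k
  have "(\<lambda>k. 2 * norm u / real (Suc k)) \<longlonglongrightarrow> 0" by real_asymp
  then have h0: "h \<longlonglongrightarrow> 0"
    by (rule Lim_null_comparison[rotated]) (use \<tau> in \<open>auto simp: h_def\<close>)
  have qinf: "filterlim q at_top sequentially"
    by (rule filterlim_at_top_mono[OF filterlim_ident]) (use q in auto)
  have c1: "(\<lambda>k. inner (shift (int (q k)) u) u) \<longlonglongrightarrow> 0"
    by (rule filterlim_compose[OF shift_weakly_null qinf])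
  have q2: "filterlim (\<lambda>k. 2 * q k) at_top sequentially"
    by (rule filterlim_at_top_mono[OF qinf]) auto
  have c2: "(\<lambda>k. inner (shift (int (2 * q k)) u) u) \<longlonglongrightarrow> 0"
    by (rule filterlim_compose[OF shift_weakly_null q2])
  \<comment> \<open>The traces \<open>\<tau> k\<close> are not controlled beforehand. Pairing
    \<open>h k\<close> with \<open>u\<close> expresses them by quantities that tend to 0.\<close>
  have "\<tau> k = (2 * inner (shift (int (q k)) u) u - inner (h k) u) / (norm u)\<^sup>2" for k
  proof -
    have "inner (h k) u = 2 * inner (shift (int (q k)) u) u - \<tau> k * (norm u)\<^sup>2"
    proof -
      have "inner (shift (- int (q k)) u) u = inner (shift (int (q k)) u) u"
        unfolding inner_shift[of "- int (q k)"] by (simp add: inner_commute)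
      then show ?thesis
        by (simp add: h_def inner_add_left inner_diff_left power2_norm_eq_inner)
    qed
    then show ?thesis using u by (simp add: field_simps)
  qed
  moreover have "(\<lambda>k. (2 * inner (shift (int (q k)) u) u - inner (h k) u) / (norm u)\<^sup>2) \<longlonglongrightarrow> (2 * 0 - inner 0 u) / (norm u)\<^sup>2"
    by (intro tendsto_intros c1 h0) (use u in auto)
  ultimately have "(\<lambda>k. \<tau> k) \<longlonglongrightarrow> (2 * 0 - inner 0 u) / (norm u)\<^sup>2" by (simp only:)
  then have \<tau>0: "\<tau> \<longlonglongrightarrow> 0" by simp
  have "(\<lambda>k. (norm (h k + \<tau> k *\<^sub>R u))\<^sup>2) \<longlonglongrightarrow> (norm (0 + 0 *\<^sub>R u))\<^sup>2"
    by (intro tendsto_intros h0 \<tau>0)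
  \<comment> \<open>This square tends to 0 because \<open>h\<close> and \<open>\<tau>\<close> do.
    Expanding it instead leaves \<open>2 * (norm u)^2\<close>, since the cross term is a correlation
    at distance \<open>2 * q k\<close> and vanishes in the limit.\<close>
  moreover have "(norm (h k + \<tau> k *\<^sub>R u))\<^sup>2 = 2 * (norm u)\<^sup>2 + 2 * inner (shift (int (2 * q k)) u) u" for k
  proof -
    have "h k + \<tau> k *\<^sub>R u = shift (int (q k)) u + shift (- int (q k)) u" by (simp add: h_def)
    moreover have c: "inner (shift (int (q k)) u) (shift (- int (q k)) u) = inner (shift (int (2 * q k)) u) u"
      using inner_shift[of "int (q k)" u "shift (- int (q k)) u"] inner_shift[of "int (2 * q k)" u u] by simp
    moreover have "inner (shift (- int (q k)) u) (shift (int (q k)) u) = inner (shift (int (2 * q k)) u) u"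
      using c by (simp only: inner_commute)
    moreover have "inner (shift j u) (shift j u) = (norm u)\<^sup>2" for j
      by (simp flip: power2_norm_eq_inner)
    ultimately show ?thesis
      unfolding power2_norm_eq_inner[of "h k + \<tau> k *\<^sub>R u"] by (simp add: inner_add_left inner_add_right)
  qed
  moreover have "(\<lambda>k. 2 * (norm u)\<^sup>2 + 2 * inner (shift (int (2 * q k)) u) u) \<longlonglongrightarrow> 2 * (norm u)\<^sup>2 + 2 * 0"
    by (intro tendsto_intros c2)
  ultimately have "2 * (norm u)\<^sup>2 = 0" using LIMSEQ_unique by fastforce
  then show False using u by simp
qed

section \<open>Opening gaps\<close>

definition diag2 :: "real \<Rightarrow> mat2" where "diag2 s = Mat2 (exp s) 0 0 (exp (- s))"

lemma diag2_0 [simp]: "diag2 0 = 1"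
  by (simp add: diag2_def one_mat2_def)

lemma transfer_exp: "transfer (\<lambda>n. a n * exp (- t n)) E n = diag2 (t n) * transfer a E n"
  by (simp add: transfer_def diag2_def times_mat2_def exp_minus field_simps)

lemma transfers_cong:
  assumes "\<And>k. n < k \<Longrightarrow> k \<le> n + int q \<Longrightarrow> a k = b k"
  shows "transfers a E n q = transfers b E n q"
  using assms by (induction q) (simp_all add: transfer_def)

lemma periodic_multiple:
  fixes a :: "int \<Rightarrow> 'a"
  assumes "\<And>n. a (n + p) = a n"
  shows "a (n + int k * p) = a n"
proof (induction k)
  case (Suc k)
  have "n + int (Suc k) * p = (n + int k * p) + p" by (simp add: algebra_simps)
  then show ?case using assms[of "n + int k * p"] Suc by (simp only:)
qed simp

text \<open>The monodromy over \<open>N\<close> periods when the coefficient at the site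
  \<open>k * p\<close>, the last one of the \<open>k\<close>-th period, is multiplied by
  \<open>exp (- t k)\<close>; see \<open>transfers_perturbed\<close>. The value \<open>t 0\<close>
  is never read.\<close>

primrec word :: "mat2 \<Rightarrow> (nat \<Rightarrow> real) \<Rightarrow> nat \<Rightarrow> mat2" where
  "word A t 0 = 1"
| "word A t (Suc N) = diag2 (t (Suc N)) * A * word A t N"

lemma word_eq_power: "(\<And>k. 0 < k \<Longrightarrow> k \<le> N \<Longrightarrow> t k = 0) \<Longrightarrow> word A t N = A ^ N"
  by (induction N) auto

lemma transfers_perturbed:
  assumes p: "p > 0" and per: "\<And>n. a (n + int p) = a n"
    and b: "\<And>n. 0 < n \<Longrightarrow> b n = (if int p dvd n then a n * exp (- t (nat (n div int p))) else a n)"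
  shows "transfers b E 0 (N * p) = word (transfers a E 0 p) t N"
proof (induction N)
  case (Suc N)
  define m where "m = int (N * p)"
  have am: "a (m + k) = a k" for k
    using periodic_multiple[of a "int p" k N, OF per] by (simp add: m_def add.commute)
  have shift: "transfers a E m r = transfers a E 0 r" for r
    by (induction r) (simp_all add: transfer_def am flip: add.assoc, simp_all add: am add.assoc)
  obtain p' where p': "p = Suc p'" using p by (cases p) auto
  have "transfers b E m p' = transfers a E m p'"
  proof (rule transfers_cong)
    fix k assume k: "m < k" "k \<le> m + int p'"
    then have "0 < k - m" "k - m < int p" by (auto simp: p')
    then have "\<not> int p dvd k - m" using zdvd_not_zless by blast
    then have "\<not> int p dvd k" by (metis dvd_diff dvd_triv_right m_def of_nat_mult)
    moreover have "k > 0" using k(1) of_nat_0_le_iff[of "N * p"] unfolding m_def by linarith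
    ultimately show "b k = a k" by (simp add: b)
  qed
  moreover have "transfer b E (m + int p) = diag2 (t (Suc N)) * transfer a E (m + int p)"
  proof -
    have dv: "(m + int p) div int p = int (Suc N)" using p by (simp add: m_def)
    have "int p dvd m + int p" by (simp add: m_def)
    moreover have "0 < m + int p" unfolding m_def using p of_nat_0_le_iff[of "N * p"] by linarith
    ultimately have "b (m + int p) = a (m + int p) * exp (- t (Suc N))"
      using b[of "m + int p"] by (simp only: dv nat_int if_True)
    then show ?thesis using transfer_exp[of a "\<lambda>_. t (Suc N)" E "m + int p"] by (simp add: transfer_def)
  qed
  ultimately have "transfers b E m p = diag2 (t (Suc N)) * transfers a E m p"
    by (simp add: p' mult.assoc del: of_nat_Suc)
  then show ?case
    using transfers_add[of b E 0 "N * p" p] Suc shift[of p] by (simp add: m_def add.commute mult.assoc)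
qed simp

text \<open>The two traces add up to \<open>2 * cosh s\<close> times the trace of \<open>A\<close>,
  which exceeds 4 in absolute value; so one of them exceeds 2.\<close>

lemma parabolic_perturb:
  assumes det: "det2 A = 1" and tr: "\<bar>tr2 A\<bar> = 2" and s: "s > 0"
  shows "\<bar>tr2 (diag2 s * A)\<bar> > 2 \<or> \<bar>tr2 (diag2 (- s) * A)\<bar> > 2"
proof -
  define x w where "x = m11 A" and "w = m22 A"
  have e: "tr2 (diag2 s * A) = exp s * x + exp (- s) * w" "tr2 (diag2 (- s) * A) = exp (- s) * x + exp s * w"
    by (simp_all add: tr2_def times_mat2_def diag2_def x_def w_def)
  have cosh: "exp s + exp (- s) > 2"
  proof -
    have "(exp (s / 2) - exp (- s / 2))\<^sup>2 > 0" using s by simp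
    moreover have "(exp (s / 2) - exp (- s / 2))\<^sup>2 = exp s + exp (- s) - 2"
      by (simp add: power2_diff flip: exp_double exp_add)
    ultimately show ?thesis by linarith
  qed
  have "(exp s * x + exp (- s) * w) + (exp (- s) * x + exp s * w) = (exp s + exp (- s)) * (x + w)"
    by (simp add: algebra_simps)
  moreover have "\<bar>(exp s + exp (- s)) * (x + w)\<bar> > 4"
    using tr cosh by (simp add: abs_mult tr2_def x_def w_def)
  ultimately show ?thesis unfolding e by linarith
qed

text \<open>The Chebyshev form of the powers, a consequence of Cayley-Hamilton. It makes the trace
  in \<open>elliptic_perturb\<close> an explicit function of an angle.\<close>

lemma elliptic_power:
  assumes det: "det2 A = 1" and tr: "tr2 A = 2 * cos \<theta>" and sin: "sin \<theta> \<noteq> 0"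
  shows "A ^ n = Mat2 (sin (real n * \<theta>) / sin \<theta> * m11 A - sin ((real n - 1) * \<theta>) / sin \<theta>)
     (sin (real n * \<theta>) / sin \<theta> * m12 A) (sin (real n * \<theta>) / sin \<theta> * m21 A)
     (sin (real n * \<theta>) / sin \<theta> * m22 A - sin ((real n - 1) * \<theta>) / sin \<theta>)"
proof (induction n)
  case 0
  then show ?case using sin by (simp add: one_mat2_def)
next
  case (Suc n)
  define S T U where "S = sin (real n * \<theta>) / sin \<theta>" and "T = sin ((real n - 1) * \<theta>) / sin \<theta>"
    and "U = sin (real (Suc n) * \<theta>) / sin \<theta>"
  have "sin (real n * \<theta> + \<theta>) + sin (real n * \<theta> - \<theta>) = 2 * cos \<theta> * sin (real n * \<theta>)"
    by (simp add: sin_add sin_diff)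
  then have "sin (real (Suc n) * \<theta>) = 2 * cos \<theta> * sin (real n * \<theta>) - sin ((real n - 1) * \<theta>)"
    by (simp add: algebra_simps)
  then have U: "U = (m11 A + m22 A) * S - T"
    using sin tr by (simp add: U_def S_def T_def tr2_def diff_divide_distrib)
  have d: "m12 A * m21 A = m11 A * m22 A - 1" using det by (simp add: det2_def)
  have e: "m11 A * (S * m11 A - T) + m12 A * (S * m21 A) = U * m11 A - S"
    "m11 A * (S * m12 A) + m12 A * (S * m22 A - T) = U * m12 A"
    "m21 A * (S * m11 A - T) + m22 A * (S * m21 A) = U * m21 A"
    "m21 A * (S * m12 A) + m22 A * (S * m22 A - T) = U * m22 A - S"
  proof -
    have "S * (m12 A * m21 A) = S * (m11 A * m22 A) - S" by (simp add: d algebra_simps)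
    then show "m11 A * (S * m11 A - T) + m12 A * (S * m21 A) = U * m11 A - S"
      "m11 A * (S * m12 A) + m12 A * (S * m22 A - T) = U * m12 A"
      "m21 A * (S * m11 A - T) + m22 A * (S * m21 A) = U * m21 A"
      "m21 A * (S * m12 A) + m22 A * (S * m22 A - T) = U * m22 A - S"
      unfolding U by (simp_all add: algebra_simps)
  qed
  have "A ^ Suc n = A * Mat2 (S * m11 A - T) (S * m12 A) (S * m21 A) (S * m22 A - T)"
    using Suc by (simp add: S_def T_def)
  also have "\<dots> = Mat2 (U * m11 A - S) (U * m12 A) (U * m21 A) (U * m22 A - S)"
    unfolding times_mat2_def mat2.sel e ..
  finally show ?case by (simp add: U_def S_def)
qed

text \<open>An elliptic monodromy matrix \<open>A\<close> has a power close to the identity, so that \<open>D A D\<inverse> A\<^sup>N\<^sup>-\<^sup>1\<close>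
  is close to the commutator of \<open>D\<close> and \<open>A\<close>, and this commutator is hyperbolic.\<close>

lemma elliptic_perturb:
  assumes det: "det2 A = 1" and tr: "\<bar>tr2 A\<bar> < 2" and s: "s > 0"
  shows "\<exists>N\<ge>2. tr2 (diag2 s * A * (diag2 (- s) * A * A ^ (N - 2))) > 2"
proof -
  define \<tau> where "\<tau> = tr2 A"
  define \<theta> where "\<theta> = arccos (\<tau> / 2)"
  have \<tau>: "\<tau> = 2 * cos \<theta>" using tr by (simp add: \<theta>_def \<tau>_def cos_arccos)
  have "0 < \<theta> \<and> \<theta> < pi" unfolding \<theta>_def
    using tr by (intro arccos_lt_bounded) (auto simp: \<tau>_def)
  then have sin: "sin \<theta> > 0" by (simp add: sin_gt_zero)
  define \<kappa> where "\<kappa> = exp (2 * s) + exp (- (2 * s)) - 2"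
  have "\<kappa> = (exp s - exp (- s))\<^sup>2" by (simp add: \<kappa>_def power2_diff flip: exp_double exp_add)
  then have \<kappa>: "\<kappa> > 0" using s by simp
  \<comment> \<open>For elliptic \<open>A\<close> this product is negative, because
    \<open>4 * m11 A * m22 A\<close> is at most the squared trace, which is less than 4. The sign
    makes the commutator trace \<open>2 - yz * \<kappa>\<close> exceed 2.\<close>
  define yz where "yz = m12 A * m21 A"
  have xw: "m11 A * m22 A = 1 + yz" using det by (simp add: det2_def yz_def)
  have "\<tau>\<^sup>2 < 2\<^sup>2" using tr abs_square_less_1[of "\<tau> / 2"] by (simp add: \<tau>_def power_divide)
  moreover have "4 * (m11 A * m22 A) \<le> \<tau>\<^sup>2"
    using zero_le_power2[of "m11 A - m22 A"] by (simp add: \<tau>_def tr2_def power2_eq_square algebra_simps)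
  ultimately have yz: "yz < 0" using xw by simp
  \<comment> \<open>The trace as a function of a real angle in place of \<open>N * \<theta>\<close>.
    Its value at 0 is the trace of the commutator, and being continuous and invariant under
    multiples of 2 pi it only requires \<open>N * \<theta>\<close> to be close to such a
    multiple.\<close>
  define F where "F \<phi> = (sin (\<phi> - \<theta>) * (\<tau>\<^sup>2 - 2 + yz * \<kappa>) - sin (\<phi> - 2 * \<theta>) * \<tau>) / sin \<theta>" for \<phi>
  have trF: "tr2 (diag2 s * A * (diag2 (- s) * A * A ^ (N - 2))) = F (real N * \<theta>)" if N: "N \<ge> 2" for N
  proof -
    have "A * A ^ (N - 2) = A ^ (N - 1)" 
    proof -
      have "Suc (N - 2) = N - 1" using N by linarith
      then show ?thesis by (metis power_Suc)
    qed
    then have "diag2 s * A * (diag2 (- s) * A * A ^ (N - 2)) = (diag2 s * A * diag2 (- s)) * A ^ (N - 1)"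
      by (simp add: mult.assoc)
    moreover have r: "real (N - 1) = real N - 1" using N by (simp add: of_nat_diff)
    moreover have "diag2 s * A * diag2 (- s)
        = Mat2 (m11 A) (exp (2 * s) * m12 A) (exp (- (2 * s)) * m21 A) (m22 A)"
    proof -
      have "exp (2 * s) = exp s * exp s" "exp (- (2 * s)) = exp (- s) * exp (- s)" by (simp_all flip: exp_add)
      then show ?thesis by (simp add: times_mat2_def diag2_def exp_minus)
    qed
    moreover have "tr2 (Mat2 (m11 A) (exp (2 * s) * m12 A) (exp (- (2 * s)) * m21 A) (m22 A) * A ^ (N - 1))
      = (sin ((real N - 1) * \<theta>) / sin \<theta>) * ((m11 A)\<^sup>2 + (m22 A)\<^sup>2 + yz * (exp (2 * s) + exp (- (2 * s))))
        - (sin ((real N - 2) * \<theta>) / sin \<theta>) * \<tau>"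
    proof -
      have "tr2 (Mat2 (m11 A) (e * m12 A) (f * m21 A) (m22 A) * Mat2 (P * m11 A - Q) (P * m12 A) (P * m21 A) (P * m22 A - Q))
        = P * ((m11 A)\<^sup>2 + (m22 A)\<^sup>2 + yz * (e + f)) - Q * \<tau>" for P Q e f
        by (simp add: tr2_def times_mat2_def yz_def \<tau>_def power2_eq_square algebra_simps)
      moreover have "real N - 1 - 1 = real N - 2" by simp
      ultimately show ?thesis
        unfolding elliptic_power[OF det \<tau>[unfolded \<tau>_def] less_imp_neq[OF sin, symmetric]] r by (simp only:)
    qed
    moreover have "(m11 A)\<^sup>2 + (m22 A)\<^sup>2 + yz * (exp (2 * s) + exp (- (2 * s))) = \<tau>\<^sup>2 - 2 + yz * \<kappa>"
      using xw by (simp add: \<kappa>_def \<tau>_def tr2_def power2_eq_square algebra_simps)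
    moreover have "(real N - 1) * \<theta> = real N * \<theta> - \<theta>" "(real N - 2) * \<theta> = real N * \<theta> - 2 * \<theta>"
      by (simp_all add: left_diff_distrib)
    ultimately show ?thesis by (simp add: F_def diff_divide_distrib)
  qed
  have "F 0 = 2 - yz * \<kappa>"
  proof -
    have "F 0 = (sin \<theta> * (2 - yz * \<kappa>)) / sin \<theta>"
      by (simp only: F_def diff_0 sin_minus sin_double \<tau>) (simp add: power2_eq_square algebra_simps)
    then show ?thesis using sin by simp
  qed
  then have F0: "F 0 > 2" using yz \<kappa> by (simp add: mult_neg_pos)
  have "isCont F 0" unfolding F_def using sin by (intro continuous_intros) auto
  then have "\<forall>\<^sub>F \<phi> in at 0. F \<phi> > 2" using F0 unfolding isCont_def by (rule order_tendstoD)
  then obtain d where d0: "d > 0" "\<And>\<phi>. \<phi> \<noteq> 0 \<Longrightarrow> \<bar>\<phi>\<bar> < d \<Longrightarrow> F \<phi> > 2"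
    unfolding eventually_at by (auto simp: dist_real_def)
  have d: "F \<phi> > 2" if "\<bar>\<phi>\<bar> < d" for \<phi>
    using d0 F0 that by (cases "\<phi> = 0", auto)
  obtain n :: nat where n: "4 * pi / d < real n" using reals_Archimedean2 by blast
  then have n0: "n > 0" using d0(1) pi_gt_zero by (cases n) (auto simp: divide_less_0_iff)
  obtain h k where k: "0 < k" and hk: "\<bar>of_int k * (\<theta> / (2 * pi)) - of_int h\<bar> < 1 / real n"
    using Dirichlet_approx[OF n0] by metis
  \<comment> \<open>Taking \<open>2 * k\<close> guarantees \<open>N >= 2\<close>. The doubling also
    doubles the approximation error, hence the bound \<open>4 * pi / d\<close> in the choice of
    \<open>n\<close>.\<close>
  define N where "N = nat (2 * k)"
  have N: "N \<ge> 2" "real N = 2 * of_int k" using k by (auto simp: N_def)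
  define \<phi> where "\<phi> = real N * \<theta> - 2 * pi * of_int (2 * h)"
  have "\<phi> = 4 * pi * (of_int k * (\<theta> / (2 * pi)) - of_int h)" by (simp add: \<phi>_def N field_simps)
  then have "\<bar>\<phi>\<bar> = 4 * pi * \<bar>of_int k * (\<theta> / (2 * pi)) - of_int h\<bar>" by (simp add: abs_mult)
  also have "\<dots> < 4 * pi * (1 / real n)" using hk by (intro mult_strict_left_mono) auto
  also have "\<dots> < d" using n n0 d0(1) by (simp add: field_simps)
  finally have "F \<phi> > 2" by (rule d)
  moreover have "F \<phi> = F (real N * \<theta>)"
  proof -
    have "sin (x + 2 * pi * of_int j) = sin x" for x j
      using sin_cos_eq_iff[of "x + 2 * pi * of_int j" x] by (metis add.commute mult.commute mult.left_commute)
    from this[of "\<phi> - \<theta>" "2 * h"] this[of "\<phi> - 2 * \<theta>" "2 * h"]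
    show ?thesis by (simp add: F_def \<phi>_def algebra_simps)
  qed
  ultimately show ?thesis using trF[OF N(1)] N(1) by (metis)
qed

text \<open>A trichotomy on the trace: a hyperbolic matrix is left alone, a parabolic one needs one
  altered site per period, an elliptic one two altered sites among \<open>N\<close> periods. The
  size \<open>s\<close> is arbitrary; the price is a new period that depends on
  \<open>E\<close>.\<close>

lemma hyperbolic_perturbation:
  assumes a0: "\<And>n. a n \<noteq> 0" and p: "p > 0" and per: "\<And>n. a (n + int p) = a n" and s: "s > 0"
  shows "\<exists>b q. q > 0 \<and> (\<forall>n. b (n + int q) = b n) \<and>
     (\<forall>n. b n = a n \<or> b n = a n * exp s \<or> b n = a n * exp (- s)) \<and> \<bar>tr2 (transfers b E 0 q)\<bar> > 2"
proof -
  define A where "A = transfers a E 0 p"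
  have det: "det2 A = 1" unfolding A_def by (rule det2_transfers[OF a0])
  \<comment> \<open>Realises a word by a sequence of period \<open>N * p\<close>. Reading
    \<open>t\<close> at \<open>k mod N\<close> makes the pattern periodic.\<close>
  have make: "\<exists>b q. q > 0 \<and> (\<forall>n. b (n + int q) = b n) \<and>
     (\<forall>n. b n = a n \<or> b n = a n * exp s \<or> b n = a n * exp (- s)) \<and> \<bar>tr2 (transfers b E 0 q)\<bar> > 2"
    if N: "N > 0" and t: "\<And>k. t (k mod N) \<in> {0, s, - s}" and tr: "\<bar>tr2 (word A (\<lambda>k. t (k mod N)) N)\<bar> > 2" for N t
  proof -
    define b where "b n = (if int p dvd n then a n * exp (- t (nat ((n div int p) mod int N))) else a n)" for n
    have "transfers b E 0 (N * p) = word A (\<lambda>k. t (k mod N)) N"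
      unfolding A_def
    proof (rule transfers_perturbed[where a=a and p=p, OF p per])
      fix n :: int assume "0 < n"
      then have "nat ((n div int p) mod int N) = nat (n div int p) mod N"
        using p by (simp add: nat_mod_distrib pos_imp_zdiv_nonneg_iff)
      then show "b n = (if int p dvd n then a n * exp (- t (nat (n div int p) mod N)) else a n)"
        by (simp add: b_def)
    qed
    moreover have "b (n + int (N * p)) = b n" for n
    proof -
      have "a (n + int (N * p)) = a n"
        using periodic_multiple[of a "int p" n N, OF per] by simp
      moreover have "(n + int (N * p)) div int p = n div int p + int N" using p by simp
      ultimately show ?thesis by (simp add: b_def)
    qed
    moreover have "b n = a n \<or> b n = a n * exp s \<or> b n = a n * exp (- s)" for n
    proof -
      define k where "k = nat ((n div int p) mod int N)"
      have "k mod N = k" using N by (simp add: k_def nat_less_iff)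
      then show ?thesis using t[of k] by (auto simp: b_def k_def[symmetric])
    qed
    ultimately show ?thesis using N p tr by (intro exI[of _ b] exI[of _ "N * p"]) auto
  qed
  consider "\<bar>tr2 A\<bar> > 2" | "\<bar>tr2 A\<bar> = 2" | "\<bar>tr2 A\<bar> < 2" by linarith
  then show ?thesis
  proof cases
    case 1
    show ?thesis by (rule make[of 1 "\<lambda>_. 0"]) (use 1 in auto)
  next
    case 2
    from parabolic_perturb[OF det 2 s] show ?thesis
    proof
      assume "2 < \<bar>tr2 (diag2 s * A)\<bar>"
      then show ?thesis by (intro make[of 1 "\<lambda>_. s"]) auto
    next
      assume "2 < \<bar>tr2 (diag2 (- s) * A)\<bar>"
      then show ?thesis by (intro make[of 1 "\<lambda>_. - s"]) auto
    qed
  next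
    case 3
    obtain N where N: "N \<ge> 2" "tr2 (diag2 s * A * (diag2 (- s) * A * A ^ (N - 2))) > 2"
      using elliptic_perturb[OF det 3 s] by blast
    \<comment> \<open>The word index \<open>N\<close> is read as 0, so \<open>s\<close> belongs to
      the leftmost factor and \<open>- s\<close> to the one next to it.\<close>
    define t where "t k = (if k = 0 then s else if Suc k = N then - s else 0)" for k :: nat
    obtain N' where N': "N = Suc (Suc N')" using N(1) by (metis Suc_1 add_2_eq_Suc le_Suc_ex)
    have "word A (\<lambda>k. t (k mod N)) N' = A ^ N'"
      by (rule word_eq_power) (auto simp: t_def N')
    then have "word A (\<lambda>k. t (k mod N)) N = diag2 s * A * (diag2 (- s) * A * A ^ (N - 2))"
      by (simp add: N' t_def)
    then show ?thesis using N by (intro make[of N t]) (auto simp: t_def)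
  qed
qed

section \<open>Localization in spectral gaps\<close>

lemma norm_cut_split:
  assumes "B \<subseteq> A"
  shows "(norm (cut A u))\<^sup>2 = (norm (cut B u))\<^sup>2 + (norm (cut (A - B) u))\<^sup>2"
proof -
  have "cut A u = cut B u + cut (A - B) u" using assms by (intro l2_eqI) (auto simp: seq_cut)
  moreover have "inner (cut B u) (cut (A - B) u) = 0"
  proof -
    have "inner (seq (cut B u) n) (seq (cut (A - B) u) n) = 0" for n by (simp add: seq_cut)
    then show ?thesis by (simp add: inner_l2_def)
  qed
  ultimately show ?thesis
    by (simp add: power2_norm_eq_inner inner_add_left inner_add_right inner_commute)
qed

lemma norm_cut_le: "norm (cut A u) \<le> norm u"
  by (rule norm_l2_mono) (simp add: seq_cut)

lemma norm_cut_mono: "A \<subseteq> B \<Longrightarrow> norm (cut A u) \<le> norm (cut B u)"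
  by (rule norm_l2_mono) (auto simp: seq_cut)

lemma cut_UNIV [simp]: "cut UNIV u = u"
  by (rule l2_eqI) (simp add: seq_cut)

lemma norm_cut_UN:
  assumes "finite F" "\<And>i j. i \<in> F \<Longrightarrow> j \<in> F \<Longrightarrow> i \<noteq> j \<Longrightarrow> A i \<inter> A j = {}"
  shows "(norm (cut (\<Union>i\<in>F. A i) u))\<^sup>2 = (\<Sum>i\<in>F. (norm (cut (A i) u))\<^sup>2)"
  using assms
proof (induction F)
  case empty
  have "cut {} u = 0" by (rule l2_eqI) (simp add: seq_cut)
  then show ?case by simp
next
  case (insert x F)
  have "A x \<inter> (\<Union>i\<in>F. A i) = {}" using insert.hyps insert.prems by blast
  then have "(\<Union>i\<in>insert x F. A i) - A x = (\<Union>i\<in>F. A i)" by auto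
  then show ?case
    using norm_cut_split[of "A x" "\<Union>i\<in>insert x F. A i" u] insert by auto
qed

definition res :: "(int \<Rightarrow> real) \<Rightarrow> real \<Rightarrow> l2 \<Rightarrow> l2" where
  "res a E u = J a u - E *\<^sub>R u"

lemma seq_res:
  assumes "\<And>n. \<bar>a n\<bar> \<le> C"
  shows "seq (res a E u) n = a (n - 1) *\<^sub>R seq u (n - 1) + a n *\<^sub>R seq u (n + 1) - E *\<^sub>R seq u n"
  by (simp add: res_def seq_J[of a C, OF assms] jacobi_def scaleR_conv_of_real)

lemma res_diff:
  assumes "\<And>n. \<bar>a n\<bar> \<le> C"
  shows "res a E (u - v) = res a E u - res a E v"
  by (rule l2_eqI) (simp add: seq_res[of a C, OF assms] algebra_simps)

lemma res_shift:
  assumes "\<And>n. \<bar>a n\<bar> \<le> C" "\<And>n. a (n + j) = a n"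
  shows "res a E (shift j u) = shift j (res a E u)"
proof (rule l2_eqI)
  fix n
  have "a (n + j - 1) = a (n - 1)" using assms(2)[of "n - 1"] by (simp add: algebra_simps)
  then show "seq (res a E (shift j u)) n = seq (shift j (res a E u)) n"
    using assms(2)[of n] by (simp add: seq_res[of a C, OF assms(1)] algebra_simps)
qed

lemma norm_res_le:
  assumes "\<And>n. \<bar>a n\<bar> \<le> C"
  shows "norm (res a E u) \<le> (2 * C + \<bar>E\<bar>) * norm u"
  using norm_triangle_ineq4[of "J a u" "E *\<^sub>R u"] norm_J_le[of a C u, OF assms]
  by (simp add: res_def algebra_simps)

text \<open>The commutator of \<open>J\<close> with the restriction to \<open>S\<close> only sees the boundary of \<open>S\<close>.\<close>

lemma norm_res_cut_le:
  assumes a: "\<And>n. \<bar>a n\<bar> \<le> C" "C \<ge> 0" and W: "\<And>n. (n \<in> S) \<noteq> (n + 1 \<in> S) \<Longrightarrow> n \<in> W \<and> n + 1 \<in> W"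
  shows "norm (res a E (cut S u)) \<le> norm (res a E u) + 2 * C * norm (cut W u)"
proof -
  define K where "K = res a E (cut S u) - cut S (res a E u)"
  have "norm (seq K n) \<le> C * (\<Sum>i\<in>{-1, 1::int}. norm (seq (cut W u) (n + i)))" for n
  proof -
    define x y where "x = (indicator S n - indicator S (n - 1) :: real)" and "y = (indicator S n - indicator S (n + 1) :: real)"
    have "seq K n = - (x * a (n - 1)) *\<^sub>R seq u (n - 1) - (y * a n) *\<^sub>R seq u (n + 1)"
      by (simp add: K_def x_def y_def seq_res[of a C, OF a(1)] seq_cut indicator_def algebra_simps)
    then have "norm (seq K n) \<le> \<bar>x * a (n - 1)\<bar> * norm (seq u (n - 1)) + \<bar>y * a n\<bar> * norm (seq u (n + 1))"
      using norm_triangle_ineq4[of "- (x * a (n - 1)) *\<^sub>R seq u (n - 1)" "(y * a n) *\<^sub>R seq u (n + 1)"] by simp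
    also have "\<bar>x * a (n - 1)\<bar> * norm (seq u (n - 1)) \<le> C * norm (seq (cut W u) (n - 1))"
    proof (cases "(n - 1 \<in> S) \<noteq> (n \<in> S)")
      case True
      then have "n - 1 \<in> W" using W[of "n - 1"] by simp
      moreover have "\<bar>x * a (n - 1)\<bar> \<le> C" using True a(1)[of "n - 1"] by (auto simp: x_def indicator_def)
      ultimately show ?thesis by (simp add: seq_cut mult_right_mono)
    qed (use a(2) in \<open>auto simp: x_def indicator_def\<close>)
    also have "\<bar>y * a n\<bar> * norm (seq u (n + 1)) \<le> C * norm (seq (cut W u) (n + 1))"
    proof (cases "(n \<in> S) \<noteq> (n + 1 \<in> S)")
      case True
      then have "n + 1 \<in> W" using W[of n] by simp
      moreover have "\<bar>y * a n\<bar> \<le> C" using True a(1)[of n] by (auto simp: y_def indicator_def)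
      ultimately show ?thesis by (simp add: seq_cut mult_right_mono)
    qed (use a(2) in \<open>auto simp: y_def indicator_def\<close>)
    finally show ?thesis by (simp add: algebra_simps)
  qed
  then have "norm K \<le> C * real (card {-1, 1::int}) * norm (cut W u)"
    by (intro norm_l2_le_shifts) (use a in auto)
  then have "norm K \<le> 2 * C * norm (cut W u)" by (simp add: mult.commute)
  moreover have "res a E (cut S u) = cut S (res a E u) + K" by (simp add: K_def)
  moreover have "norm (cut S (res a E u)) \<le> norm (res a E u)" by (rule norm_cut_le)
  ultimately show ?thesis using norm_triangle_ineq[of "cut S (res a E u)" K] by simp
qed

text \<open>The blocks do not interact because \<open>w\<close> vanishes around their end points, so at least one block
  inherits the bound that holds for their sum.\<close>

lemma block_localization:
  assumes a: "\<And>n. \<bar>a n\<bar> \<le> C" and P: "P > 0" and per: "\<And>n. a (n + P) = a n"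
    and w: "w \<noteq> 0" "norm (res a E w) \<le> \<delta> * norm w" "\<delta> \<ge> 0"
    and van: "\<And>n k. \<bar>n - c - k * P\<bar> \<le> 1 \<Longrightarrow> seq w n = 0"
  shows "\<exists>v. v \<noteq> 0 \<and> (\<forall>n. n \<notin> {c..<c + P} \<longrightarrow> seq v n = 0) \<and> norm (res a E v) \<le> \<delta> * norm v"
proof (rule ccontr)
  assume no: "\<not> ?thesis"
  define A where "A k = {c + k * P..<c + (k + 1) * P}" for k
  define f where "f = res a E w"
  have blk: "n \<in> A k \<longleftrightarrow> (n - c) div P = k" for n k
  proof -
    define i r where "i = (n - c) div P" and "r = (n - c) mod P"
    have r: "n - c = i * P + r" "0 \<le> r" "r < P" using P by (auto simp: i_def r_def)
    have "i = k" if "k * P \<le> n - c" "n - c < (k + 1) * P"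
      unfolding i_def
    proof (rule int_div_pos_eq[of _ _ _ "n - c - k * P"])
      show "n - c = P * k + (n - c - k * P)" by (simp add: algebra_simps)
    qed (use that in \<open>auto simp: algebra_simps\<close>)
    moreover have "k * P \<le> n - c \<and> n - c < (k + 1) * P" if "i = k"
      using r that by (simp add: algebra_simps)
    ultimately show ?thesis unfolding A_def i_def[symmetric] by (auto simp: algebra_simps)
  qed
  \<comment> \<open>Since \<open>w\<close> vanishes on both sides of every block boundary, cutting
    there creates no new residual.\<close>
  have res_cut: "res a E (cut (A k) w) = cut (A k) f" for k
  proof (rule l2_eqI)
    fix n
    have edge: "seq w (c + k * P) = 0" "seq w (c + k * P - 1) = 0" "seq w (c + k * P + P) = 0" "seq w (c + k * P + P - 1) = 0"
      using van[of "c + k * P" k] van[of "c + k * P - 1" k] van[of "c + k * P + P" "k + 1"] van[of "c + k * P + P - 1" "k + 1"]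
      by (auto simp: algebra_simps)
    have A: "A k = {c + k * P..<c + k * P + P}" by (simp add: A_def algebra_simps)
    consider "n \<in> A k" | "n < c + k * P - 1" | "n = c + k * P - 1" | "n = c + k * P + P" | "n > c + k * P + P"
      unfolding A by fastforce
    then show "seq (res a E (cut (A k) w)) n = seq (cut (A k) f) n"
    proof cases
      case 1
      have "seq (cut (A k) w) (n - 1) = seq w (n - 1)"
        using 1 edge by (cases "n = c + k * P") (auto simp: seq_cut A)
      moreover have "seq (cut (A k) w) (n + 1) = seq w (n + 1)"
        using 1 edge by (cases "n = c + k * P + P - 1") (auto simp: seq_cut A)
      ultimately show ?thesis using 1 by (simp add: seq_res[of a C, OF a] f_def seq_cut)
    qed (use edge in \<open>auto simp: seq_res[of a C, OF a] seq_cut A\<close>)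
  qed
  have strict: "\<delta> * norm (cut (A k) w) < norm (cut (A k) f)" if "cut (A k) w \<noteq> 0" for k
  proof -
    define v where "v = shift (k * P) (cut (A k) w)"
    have v0: "v \<noteq> 0" using that by (metis norm_eq_zero norm_shift v_def)
    have "seq v n = 0" if "n \<notin> {c..<c + P}" for n
      using that by (auto simp: v_def seq_cut A_def algebra_simps)
    moreover have perk: "a (n + k * P) = a n" for n
    proof (cases "k \<ge> 0")
      case True
      then show ?thesis using periodic_multiple[of a P n "nat k", OF per] by simp
    next
      case False
      then show ?thesis using periodic_multiple[of a P "n + k * P" "nat (- k)", OF per] by simp
    qed
    ultimately have "\<not> norm (res a E v) \<le> \<delta> * norm v" using no v0 by blast
    then show ?thesis
      by (simp add: v_def res_shift[of a C, OF a perk] res_cut)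
  qed
  have weak: "\<delta>\<^sup>2 * (norm (cut (A k) w))\<^sup>2 \<le> (norm (cut (A k) f))\<^sup>2" for k
  proof (cases "cut (A k) w = 0")
    case False
    from power_mono[OF less_imp_le[OF strict[OF this]], of 2] w(3) show ?thesis by (simp add: power_mult_distrib)
  qed simp
  obtain n0 where "seq w n0 \<noteq> 0" using w(1) by (metis l2_eqI seq_zero)
  define k0 where "k0 = (n0 - c) div P"
  have "seq (cut (A k0) w) n0 = seq w n0" by (simp add: seq_cut blk k0_def)
  then have k0: "cut (A k0) w \<noteq> 0" using \<open>seq w n0 \<noteq> 0\<close> by (metis seq_zero)
  define g where "g = (norm (cut (A k0) f))\<^sup>2 - \<delta>\<^sup>2 * (norm (cut (A k0) w))\<^sup>2"
  have "(\<delta> * norm (cut (A k0) w))\<^sup>2 < (norm (cut (A k0) f))\<^sup>2"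
    using strict[OF k0] w(3) by (intro power_strict_mono) auto
  then have g: "g > 0" by (simp add: g_def power_mult_distrib)
  \<comment> \<open>Only finitely many blocks can be summed. The tail \<open>e\<close> is chosen so
    that its contribution stays below the strict gain \<open>g\<close> of the block
    \<open>k0\<close>.\<close>
  define e where "e = sqrt (g / (\<delta>\<^sup>2 + 1))"
  have \<delta>1: "\<delta>\<^sup>2 + 1 > 0" using zero_le_power2[of \<delta>] by linarith
  have e: "e > 0" using g \<delta>1 by (simp add: e_def)
  have "e\<^sup>2 = g / (\<delta>\<^sup>2 + 1)" using g \<delta>1 by (simp add: e_def)
  then have "(\<delta>\<^sup>2 + 1) * e\<^sup>2 = g" using \<delta>1 by simp
  moreover have "e\<^sup>2 > 0" using e by simp
  ultimately have e2: "\<delta>\<^sup>2 * e\<^sup>2 < g" unfolding distrib_right by linarith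
  obtain F0 where F0: "finite F0" "norm (w - cut F0 w) < e" using cut_finite_approx[OF e] by blast
  define F where "F = insert k0 ((\<lambda>n. (n - c) div P) ` F0)"
  have F: "finite F" "k0 \<in> F" using F0 by (auto simp: F_def)
  define U where "U = (\<Union>k\<in>F. A k)"
  have disj: "A i \<inter> A j = {}" if "i \<noteq> j" for i j using that blk by auto
  have "F0 \<subseteq> U" by (auto simp: U_def F_def blk)
  have "norm (cut (UNIV - U) w) \<le> norm (w - cut F0 w)"
    by (rule norm_l2_mono) (use \<open>F0 \<subseteq> U\<close> in \<open>auto simp: seq_cut\<close>)
  then have "(norm (cut (UNIV - U) w))\<^sup>2 \<le> e\<^sup>2" using F0 by (intro power_mono) auto
  then have wU: "(norm w)\<^sup>2 \<le> (norm (cut U w))\<^sup>2 + e\<^sup>2" using norm_cut_split[of U UNIV w] by simp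
  have "\<delta>\<^sup>2 * (norm (cut U w))\<^sup>2 + g = (\<Sum>k\<in>F. \<delta>\<^sup>2 * (norm (cut (A k) w))\<^sup>2) + g"
    unfolding U_def by (subst norm_cut_UN) (use F disj in \<open>auto simp: sum_distrib_left\<close>)
  also have "\<dots> = (\<Sum>k\<in>F - {k0}. \<delta>\<^sup>2 * (norm (cut (A k) w))\<^sup>2) + (norm (cut (A k0) f))\<^sup>2"
    using F by (simp add: sum.remove[of F k0] g_def)
  also have "\<dots> \<le> (\<Sum>k\<in>F - {k0}. (norm (cut (A k) f))\<^sup>2) + (norm (cut (A k0) f))\<^sup>2"
    by (intro add_mono sum_mono weak) auto
  also have "\<dots> = (\<Sum>k\<in>F. (norm (cut (A k) f))\<^sup>2)" using F by (simp add: sum.remove[of F k0])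
  also have "\<dots> = (norm (cut U f))\<^sup>2" unfolding U_def by (subst norm_cut_UN) (use F disj in auto)
  also have "\<dots> \<le> (norm f)\<^sup>2" by (intro power_mono norm_cut_le) auto
  also have "\<dots> \<le> (\<delta> * norm w)\<^sup>2" using w(2) by (intro power_mono) (auto simp: f_def)
  also have "\<dots> \<le> \<delta>\<^sup>2 * ((norm (cut U w))\<^sup>2 + e\<^sup>2)" using wU by (simp add: power_mult_distrib mult_left_mono)
  finally show False using e2 by (simp add: algebra_simps)
qed

text \<open>A hole-filling argument. \<open>G r\<close> is the mass of \<open>u\<close> within
  distance \<open>r\<close> of the centres \<open>c + k * P\<close>. There \<open>b\<close> agrees
  with \<open>B\<close>, so the gap bounds \<open>G r\<close> by the residual of \<open>u\<close>
  and the mass in the annulus between \<open>r - 1\<close> and \<open>r + 1\<close>; adding the hole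
  gives the factor \<open>\<theta>\<close> per two sites. After \<open>t\<close> rounds the mass
  near the centres is of relative size \<open>\<beta>\<close>, and it may be removed.\<close>

lemma gap_region_localization:
  assumes M: "M > 1" and b: "\<And>n. \<bar>b n\<bar> \<le> M" and B: "\<And>n. \<bar>B n\<bar> \<le> M"
    and gap: "\<gamma> > 0" "\<And>u. \<gamma> * norm u \<le> norm (res B E u)"
    and agree: "\<And>n k. \<bar>n - c - k * P\<bar> \<le> int (2 * t + 1) \<Longrightarrow> b n = B n"
    and E: "\<bar>E\<bar> \<le> 2 * M" and \<theta>: "\<theta> = 1 / (1 + \<gamma>\<^sup>2 / (8 * M\<^sup>2))" and \<eta>: "\<eta> \<ge> 0" "\<eta>\<^sup>2 * (real t + 1) \<le> \<theta> ^ t"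
    and \<beta>: "\<beta> = sqrt (\<theta> ^ t)" "\<beta> \<le> 1 / 4"
    and u: "u \<noteq> 0" "norm (res b E u) \<le> \<eta> * norm u"
  shows "\<exists>w. w \<noteq> 0 \<and> (\<forall>n k. \<bar>n - c - k * P\<bar> \<le> 1 \<longrightarrow> seq w n = 0) \<and> norm (res b E w) \<le> 18 * M * \<beta> * norm w"
proof -
  define S where "S r = {n. \<exists>k. \<bar>n - c - k * P\<bar> \<le> r}" for r :: int
  define G where "G r = (norm (cut (S r) u))\<^sup>2" for r
  have S_mono: "r \<le> r' \<Longrightarrow> S r \<subseteq> S r'" for r r'
    unfolding S_def by (intro Collect_mono) (meson order_trans)
  define \<kappa> where "\<kappa> = \<gamma>\<^sup>2 / (8 * M\<^sup>2)"
  have \<kappa>: "\<kappa> > 0" using gap M by (simp add: \<kappa>_def)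
  have \<theta>1: "0 < \<theta>" "\<theta> < 1" "\<theta> * (1 + \<kappa>) = 1" using \<kappa> by (auto simp: \<theta> \<kappa>_def[symmetric])
  define N where "N = (norm u)\<^sup>2"
  have step: "G (r - 1) \<le> \<theta> * G (r + 1) + \<eta>\<^sup>2 * N" if r: "1 \<le> r" "r \<le> 2 * int t" for r
  proof -
    define W where "W = S (r + 1) - S (r - 1)"
    \<comment> \<open>The residual of a vector supported in \<open>S r\<close> involves the
      coefficients next to its support; \<open>r <= 2 * t\<close> keeps these within the distance
      \<open>2 * t + 1\<close> where \<open>b\<close> and \<open>B\<close> agree.\<close>
    have resB: "res b E (cut (S r) u) = res B E (cut (S r) u)"
    proof (rule l2_eqI)
      fix n
      have e1: "b (n - 1) = B (n - 1)" if n: "n - 1 \<in> S r"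
      proof -
        obtain k where "\<bar>n - 1 - c - k * P\<bar> \<le> r" using n by (auto simp: S_def)
        then show ?thesis using r by (intro agree[of "n - 1" k]) linarith
      qed
      have e2: "b n = B n" if n: "n + 1 \<in> S r"
      proof -
        obtain k where "\<bar>n + 1 - c - k * P\<bar> \<le> r" using n by (auto simp: S_def)
        then show ?thesis using r by (intro agree[of n k]) linarith
      qed
      show "seq (res b E (cut (S r) u)) n = seq (res B E (cut (S r) u)) n"
        using e1 e2 by (auto simp: seq_res[of b M, OF b] seq_res[of B M, OF B] seq_cut)
    qed
    have "\<gamma> * norm (cut (S r) u) \<le> norm (res b E (cut (S r) u))" unfolding resB by (rule gap)
    also have "\<dots> \<le> norm (res b E u) + 2 * M * norm (cut W u)"
    proof (rule norm_res_cut_le[of b M, OF b])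
      fix n assume n: "(n \<in> S r) \<noteq> (n + 1 \<in> S r)"
      have s1: "n + 1 \<in> S (q + 1)" if n: "n \<in> S q" for q
      proof -
        obtain k where "\<bar>n - c - k * P\<bar> \<le> q" using n by (auto simp: S_def)
        then have "\<bar>n + 1 - c - k * P\<bar> \<le> q + 1" by linarith
        then show ?thesis unfolding S_def by blast
      qed
      have s2: "n \<in> S (q + 1)" if n: "n + 1 \<in> S q" for q
      proof -
        obtain k where "\<bar>n + 1 - c - k * P\<bar> \<le> q" using n by (auto simp: S_def)
        then have "\<bar>n - c - k * P\<bar> \<le> q + 1" by linarith
        then show ?thesis unfolding S_def by blast
      qed
      from n have "n \<in> S (r + 1) \<and> n + 1 \<in> S (r + 1)"
        using s1[of r] s2[of r] S_mono[of r "r + 1"] by auto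
      moreover have "n \<notin> S (r - 1) \<and> n + 1 \<notin> S (r - 1)"
        using n s1[of "r - 1"] s2[of "r - 1"] S_mono[of "r - 1" r] by auto
      ultimately show "n \<in> W \<and> n + 1 \<in> W" by (simp add: W_def)
    qed (use M in auto)
    also have "\<dots> \<le> \<eta> * norm u + 2 * M * norm (cut W u)" using u by simp
    finally have "(\<gamma> * norm (cut (S r) u))\<^sup>2 \<le> (\<eta> * norm u + 2 * M * norm (cut W u))\<^sup>2"
      using gap by (intro power_mono) auto
    also have "\<dots> \<le> 2 * (\<eta> * norm u)\<^sup>2 + 2 * (2 * M * norm (cut W u))\<^sup>2"
      using sum_squares_bound[of "\<eta> * norm u" "2 * M * norm (cut W u)"] by (simp add: power2_sum)
    finally have "\<gamma>\<^sup>2 * G r \<le> 2 * \<eta>\<^sup>2 * N + 8 * M\<^sup>2 * (norm (cut W u))\<^sup>2"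
      by (simp add: G_def N_def power_mult_distrib)
    moreover have "(norm (cut W u))\<^sup>2 = G (r + 1) - G (r - 1)"
      using norm_cut_split[OF S_mono[of "r - 1" "r + 1"], of u] by (simp add: G_def W_def)
    moreover have "\<gamma>\<^sup>2 * G (r - 1) \<le> \<gamma>\<^sup>2 * G r"
      unfolding G_def by (intro mult_left_mono power_mono norm_cut_mono S_mono) auto
    moreover have "\<gamma>\<^sup>2 = \<kappa> * (8 * M\<^sup>2)" using M by (simp add: \<kappa>_def)
    ultimately have "8 * M\<^sup>2 * (\<kappa> * G (r - 1)) \<le> 2 * \<eta>\<^sup>2 * N + 8 * M\<^sup>2 * (G (r + 1) - G (r - 1))" by (simp add: mult_ac)
    also have "2 * \<eta>\<^sup>2 * N \<le> 8 * M\<^sup>2 * (\<eta>\<^sup>2 * N)"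
    proof -
      have "1 \<le> M\<^sup>2" using M by (simp add: one_le_power)
      then have "2 * (\<eta>\<^sup>2 * N) \<le> (8 * M\<^sup>2) * (\<eta>\<^sup>2 * N)" by (intro mult_right_mono) (auto simp: N_def)
      then show ?thesis by simp
    qed
    finally have "8 * M\<^sup>2 * (\<kappa> * G (r - 1)) \<le> 8 * M\<^sup>2 * (\<eta>\<^sup>2 * N + (G (r + 1) - G (r - 1)))"
      by (simp add: algebra_simps)
    then have "\<kappa> * G (r - 1) \<le> \<eta>\<^sup>2 * N + (G (r + 1) - G (r - 1))" using M by simp
    then have "(1 + \<kappa>) * G (r - 1) \<le> G (r + 1) + \<eta>\<^sup>2 * N" by (simp add: algebra_simps)
    then have "\<theta> * ((1 + \<kappa>) * G (r - 1)) \<le> \<theta> * (G (r + 1) + \<eta>\<^sup>2 * N)" using \<theta>1 by (intro mult_left_mono) auto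
    then have "G (r - 1) \<le> \<theta> * G (r + 1) + \<theta> * (\<eta>\<^sup>2 * N)" using \<theta>1(3) by (simp add: mult.assoc[symmetric] distrib_left)
    moreover have "\<theta> * (\<eta>\<^sup>2 * N) \<le> 1 * (\<eta>\<^sup>2 * N)" using \<theta>1 by (intro mult_right_mono) (auto simp: N_def)
    ultimately show ?thesis by simp
  qed
  have iter: "G 1 \<le> \<theta> ^ j * G (1 + 2 * int j) + real j * (\<eta>\<^sup>2 * N)" if "j \<le> t" for j
    using that
  proof (induction j)
    case (Suc j)
    have "\<theta> ^ j * G (1 + 2 * int j) \<le> \<theta> ^ j * (\<theta> * G (1 + 2 * int (Suc j)) + \<eta>\<^sup>2 * N)"
      using step[of "2 + 2 * int j"] Suc.prems \<theta>1 by (intro mult_left_mono) (auto simp: algebra_simps)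
    moreover have "\<theta> ^ j * (\<eta>\<^sup>2 * N) \<le> 1 * (\<eta>\<^sup>2 * N)"
      using \<theta>1 by (intro mult_right_mono power_le_one) (auto simp: N_def)
    ultimately show ?case using Suc by (simp add: algebra_simps)
  qed simp
  have GN: "G r \<le> N" for r unfolding G_def N_def by (intro power_mono norm_cut_le) auto
  have "\<theta> ^ t \<le> 1" using \<theta>1 by (intro power_le_one) auto
  have \<beta>2: "\<beta>\<^sup>2 = \<theta> ^ t" "\<beta> \<ge> 0" using \<theta>1 by (auto simp: \<beta>)
  have "G 1 \<le> \<theta> ^ t * N + real t * (\<eta>\<^sup>2 * N)"
    using iter[of t] GN[of "1 + 2 * int t"] \<theta>1 by (auto intro: order_trans mult_left_mono)
  also have "\<dots> \<le> \<theta> ^ t * N + \<theta> ^ t * N"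
  proof -
    have "\<eta>\<^sup>2 * real t \<le> \<theta> ^ t" using \<eta>(2) zero_le_power2[of \<eta>] unfolding distrib_left by linarith
    then have "\<eta>\<^sup>2 * real t * N \<le> \<theta> ^ t * N" by (intro mult_right_mono) (auto simp: N_def)
    then show ?thesis by (simp add: mult_ac)
  qed
  also have "\<dots> \<le> (2 * \<beta> * norm u)\<^sup>2" using \<theta>1 by (simp add: power_mult_distrib \<beta>2 N_def)
  finally have "(norm (cut (S 1) u))\<^sup>2 \<le> (2 * \<beta> * norm u)\<^sup>2" by (simp add: G_def)
  then have small: "norm (cut (S 1) u) \<le> 2 * \<beta> * norm u" by (rule power2_le_imp_le) (use \<beta>2 in auto)
  \<comment> \<open>The summand 1 in \<open>real t + 1\<close> is spent here; the \<open>t\<close>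
    rounds of the iteration consumed the rest.\<close>
  have "\<eta>\<^sup>2 \<le> \<beta>\<^sup>2"
  proof -
    have "\<eta>\<^sup>2 * 1 \<le> \<eta>\<^sup>2 * (real t + 1)" by (intro mult_left_mono) auto
    then show ?thesis using \<eta>(2) \<beta>2 by simp
  qed
  then have \<eta>\<beta>: "\<eta> \<le> \<beta>" using \<beta>2(2) by (rule power2_le_imp_le)
  define w where "w = u - cut (S 1) u"
  have "norm u \<le> norm w + norm (cut (S 1) u)" using norm_triangle_ineq[of w "cut (S 1) u"] by (simp add: w_def)
  also have "\<dots> \<le> norm w + (1 / 2) * norm u"
  proof -
    have "2 * \<beta> * norm u \<le> (1 / 2) * norm u" using \<beta>(2) by (intro mult_right_mono) auto
    then show ?thesis using small by simp
  qed
  finally have uw: "norm u \<le> 2 * norm w" by simp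
  then have "w \<noteq> 0" using u(1) by auto
  moreover have "seq w n = 0" if "\<bar>n - c - k * P\<bar> \<le> 1" for n k
    using that by (auto simp: w_def seq_cut S_def)
  moreover have "norm (res b E w) \<le> 18 * M * \<beta> * norm w"
  proof -
    have "norm (res b E w) \<le> norm (res b E u) + norm (res b E (cut (S 1) u))"
      unfolding w_def res_diff[of b M, OF b] by (rule norm_triangle_ineq4)
    also have "\<dots> \<le> \<beta> * norm u + 4 * M * (2 * \<beta> * norm u)"
    proof (rule add_mono)
      show "norm (res b E u) \<le> \<beta> * norm u" using u(2) mult_right_mono[OF \<eta>\<beta>, of "norm u"] by simp
      have "norm (res b E (cut (S 1) u)) \<le> (2 * M + \<bar>E\<bar>) * norm (cut (S 1) u)" by (rule norm_res_le[OF b])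
      also have "\<dots> \<le> 4 * M * (2 * \<beta> * norm u)" using small E M by (intro mult_mono) auto
      finally show "norm (res b E (cut (S 1) u)) \<le> 4 * M * (2 * \<beta> * norm u)" .
    qed
    also have "\<dots> = (1 + 8 * M) * (\<beta> * norm u)" by (simp add: algebra_simps)
    \<comment> \<open>\<open>1 + 8 * M <= 9 * M\<close>, and \<open>u\<close> loses at most half of
      its norm in the removal; together this is the constant 18.\<close>
    also have "\<dots> \<le> (9 * M) * (\<beta> * (2 * norm w))"
      using M \<beta>2 uw by (intro mult_mono) auto
    finally show ?thesis by (simp add: mult_ac)
  qed
  ultimately show ?thesis by blast
qed

text \<open>By symmetry of \<open>T\<close>, almost eigenvectors with well separated energies are
  almost orthogonal. If there were one more of them than elements of \<open>B\<close>, their Gram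
  matrix would still be diagonally dominant, so they would be linearly independent in a span of too
  small a dimension.\<close>

lemma almost_eigenvector_count:
  fixes T :: "'a::real_inner \<Rightarrow> 'a"
  assumes sym: "\<And>x y. inner (T x) y = inner x (T y)"
    and X: "finite X" "\<And>x y. x \<in> X \<Longrightarrow> y \<in> X \<Longrightarrow> x \<noteq> y \<Longrightarrow> s \<le> \<bar>x - y\<bar>" and s: "s > 0" "4 * \<delta> * (real (card B) + 1) \<le> s"
    and v: "\<And>x. x \<in> X \<Longrightarrow> norm (v x) = 1" "\<And>x. x \<in> X \<Longrightarrow> norm (T (v x) - x *\<^sub>R v x) \<le> \<delta>"
      "\<And>x. x \<in> X \<Longrightarrow> v x \<in> span B" and B: "finite B"
  shows "card X \<le> card B"
proof (rule ccontr)
  assume "\<not> ?thesis"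
  then obtain Y where Y: "Y \<subseteq> X" "card Y = Suc (card B)" "finite Y"
    using obtain_subset_with_card_n[of "Suc (card B)" X] X(1) finite_subset by (metis not_less_eq_eq)
  define n where "n = real (card B)"
  \<comment> \<open>Small enough that \<open>card B\<close> off-diagonal entries of this size add up
    to less than 1; the hypothesis on \<open>s\<close> is exactly what makes
    \<open>2 * \<delta> <= s * e\<close>.\<close>
  define e where "e = 1 / (2 * (n + 1))"
  have n: "n \<ge> 0" by (simp add: n_def)
  have e: "e > 0" "e \<le> 1 / 2" "n * e < 1" using n by (auto simp: e_def divide_simps)
  have orth: "\<bar>inner (v x) (v y)\<bar> \<le> e" if "x \<in> Y" "y \<in> Y" "x \<noteq> y" for x y
  proof -
    have xy: "x \<in> X" "y \<in> X" using that Y by auto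
    have "(x - y) * inner (v x) (v y) = inner (v x) (T (v y) - y *\<^sub>R v y) - inner (T (v x) - x *\<^sub>R v x) (v y)"
      by (simp add: inner_diff_left inner_diff_right sym algebra_simps)
    then have "\<bar>x - y\<bar> * \<bar>inner (v x) (v y)\<bar> \<le> \<bar>inner (v x) (T (v y) - y *\<^sub>R v y)\<bar> + \<bar>inner (T (v x) - x *\<^sub>R v x) (v y)\<bar>"
      unfolding abs_mult[symmetric] by simp
    also have "\<dots> \<le> \<delta> + \<delta>"
      using Cauchy_Schwarz_ineq2[of "v x" "T (v y) - y *\<^sub>R v y"] Cauchy_Schwarz_ineq2[of "T (v x) - x *\<^sub>R v x" "v y"]
        v(1,2)[OF xy(1)] v(1,2)[OF xy(2)] by simp
    finally have "\<bar>x - y\<bar> * \<bar>inner (v x) (v y)\<bar> \<le> 2 * \<delta>" by simp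
    moreover have "s * \<bar>inner (v x) (v y)\<bar> \<le> \<bar>x - y\<bar> * \<bar>inner (v x) (v y)\<bar>"
      using X(2)[OF xy that(3)] by (intro mult_right_mono) auto
    moreover have "2 * \<delta> \<le> s * e" using s n by (simp add: e_def n_def field_simps)
    ultimately have "s * \<bar>inner (v x) (v y)\<bar> \<le> s * e" by linarith
    then show ?thesis using s by simp
  qed
  have unit: "inner (v x) (v x) = 1" if "x \<in> Y" for x
    using v(1)[of x] that Y by (auto simp: power2_norm_eq_inner[symmetric])
  have inj: "inj_on v Y"
  proof (rule inj_onI)
    fix x y assume xy: "x \<in> Y" "y \<in> Y" "v x = v y"
    show "x = y"
    proof (rule ccontr)
      assume "x \<noteq> y"
      from orth[OF xy(1,2) this] unit[OF xy(1)] e(2) xy(3) show False by simp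
    qed
  qed
  have "independent (v ` Y)"
  proof
    assume "dependent (v ` Y)"
    then obtain u where u: "\<exists>w\<in>v ` Y. u w \<noteq> 0" "(\<Sum>w\<in>v ` Y. u w *\<^sub>R w) = 0"
      using Y(3) by (auto simp: dependent_finite)
    define c where "c x = u (v x)" for x
    have sum0: "(\<Sum>x\<in>Y. c x *\<^sub>R v x) = 0" using u(2) by (simp add: sum.reindex[OF inj] c_def)
    have "Y \<noteq> {}" using u(1) by auto
    have "\<exists>x0\<in>Y. \<forall>x\<in>Y. \<bar>c x\<bar> \<le> \<bar>c x0\<bar>"
    proof -
      have "finite ((\<lambda>x. \<bar>c x\<bar>) ` Y)" "(\<lambda>x. \<bar>c x\<bar>) ` Y \<noteq> {}" using Y(3) \<open>Y \<noteq> {}\<close> by auto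
      from Max_in[OF this] Max_ge[OF this(1)] show ?thesis by fastforce
    qed
    then obtain x0 where x0: "x0 \<in> Y" "\<And>x. x \<in> Y \<Longrightarrow> \<bar>c x\<bar> \<le> \<bar>c x0\<bar>" by blast
    have c0: "\<bar>c x0\<bar> > 0"
    proof -
      obtain x where "x \<in> Y" "c x \<noteq> 0" using u(1) by (auto simp: c_def)
      then show ?thesis using x0(2)[of x] by linarith
    qed
    have "0 = inner (\<Sum>x\<in>Y. c x *\<^sub>R v x) (v x0)" by (simp add: sum0)
    also have "\<dots> = c x0 + (\<Sum>x\<in>Y - {x0}. c x * inner (v x) (v x0))"
      using Y(3) x0(1) by (simp add: sum.remove[of Y x0] unit inner_add_left inner_sum_left)
    finally have "\<bar>c x0\<bar> = \<bar>\<Sum>x\<in>Y - {x0}. c x * inner (v x) (v x0)\<bar>" by linarith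
    also have "\<dots> \<le> (\<Sum>x\<in>Y - {x0}. \<bar>c x0\<bar> * e)"
    proof (rule order_trans[OF sum_abs sum_mono])
      fix x assume x: "x \<in> Y - {x0}"
      then show "\<bar>c x * inner (v x) (v x0)\<bar> \<le> \<bar>c x0\<bar> * e"
        unfolding abs_mult using x0 orth by (intro mult_mono) auto
    qed
    also have "\<dots> = \<bar>c x0\<bar> * (n * e)" using Y x0(1) by (simp add: n_def)
    also have "\<dots> < \<bar>c x0\<bar> * 1" using e(3) c0 by (rule mult_strict_left_mono)
    finally show False by simp
  qed
  then have "card (v ` Y) \<le> card B"
    using independent_span_bound[OF B, of "v ` Y"] v(3) Y(1) by auto
  then show False using Y(2) by (simp add: card_image[OF inj])
qed

text \<open>A separated subset of largest cardinality is also a net: every point of \<open>S\<close>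
  is within \<open>s\<close> of it, which explains the interval length \<open>2 * s\<close>.\<close>

lemma separated_imp_cover:
  fixes S :: "real set"
  assumes s: "s > 0" and sep: "\<And>X. finite X \<Longrightarrow> X \<subseteq> S \<Longrightarrow> (\<And>x y. x \<in> X \<Longrightarrow> y \<in> X \<Longrightarrow> x \<noteq> y \<Longrightarrow> s \<le> \<bar>x - y\<bar>) \<Longrightarrow> card X \<le> n"
  shows "\<exists>c::nat \<Rightarrow> real. S \<subseteq> (\<Union>i<n. {c i..c i + 2 * s})"
proof -
  define Q where "Q X \<longleftrightarrow> finite X \<and> X \<subseteq> S \<and> (\<forall>x\<in>X. \<forall>y\<in>X. x \<noteq> y \<longrightarrow> s \<le> \<bar>x - y\<bar>)" for X
  have bd: "card X \<le> n" if "Q X" for X using sep[of X] that by (auto simp: Q_def)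
  have "Q {}" by (simp add: Q_def)
  then obtain X where X: "Q X" "\<And>Y. Q Y \<Longrightarrow> card Y \<le> card X"
    using ex_has_greatest_nat[of Q "{}" card "Suc n"] bd by (metis le_imp_less_Suc)
  obtain h where h: "bij_betw h {0..<card X} X" using ex_bij_betw_nat_finite[of X] X(1) unfolding Q_def by blast
  have "S \<subseteq> (\<Union>i<n. {h i - s..h i - s + 2 * s})"
  proof
    fix y assume y: "y \<in> S"
    have "\<exists>x\<in>X. \<bar>y - x\<bar> \<le> s"
    proof (rule ccontr)
      assume no: "\<not> ?thesis"
      then have "y \<notin> X" using s by force
      moreover have "Q (insert y X)" using no X(1) y by (force simp: Q_def abs_minus_commute not_le)
      ultimately show False using X(2)[of "insert y X"] X(1) by (auto simp: Q_def)
    qed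
    then obtain x where x: "x \<in> X" "\<bar>y - x\<bar> \<le> s" by blast
    then have "x \<in> h ` {0..<card X}" using h by (simp add: bij_betw_def)
    then obtain i where i: "i < card X" "\<bar>y - h i\<bar> \<le> s" using x by auto
    then have "i < n" using bd[OF X(1)] by simp
    then show "y \<in> (\<Union>i<n. {h i - s..h i - s + 2 * s})" using i(2) by (auto simp: abs_le_iff intro!: bexI[of _ i])
  qed
  then show ?thesis by (rule exI[of _ "\<lambda>i. h i - s"])
qed

section \<open>Periodic approximants with thin spectrum\<close>

lemma hyperbolic_approximation:
  assumes M: "M > 1" and p: "p > 0" "\<And>n. a (n + int p) = a n" and r: "r > 0" "\<And>n. inverse M + r \<le> a n" "\<And>n. a n \<le> M - r"
    and \<epsilon>: "\<epsilon> > 0"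
  shows "\<exists>b q c. q > 0 \<and> (\<forall>n. b (n + int q) = b n) \<and> (\<forall>n. inverse M \<le> b n \<and> b n \<le> M \<and> \<bar>b n - a n\<bar> \<le> \<epsilon>) \<and>
     c > 0 \<and> (\<forall>u. c * norm u \<le> norm (res b E u))"
proof -
  define d where "d = min \<epsilon> r"
  \<comment> \<open>With this choice multiplication by \<open>exp s\<close> moves a coefficient,
    which is at most \<open>M\<close>, by at most \<open>d\<close>; multiplication by
    \<open>exp (- s)\<close> moves it less.\<close>
  define s where "s = ln (1 + d / M)"
  have d: "d > 0" "d \<le> \<epsilon>" "d \<le> r" using \<epsilon> r by (auto simp: d_def)
  have dM: "d / M > 0" using d M by simp
  then have s: "s > 0" "exp s = 1 + d / M" by (auto simp: s_def)
  have a0: "a n > 0" for n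
  proof -
    have "0 < inverse M" using M by simp
    then show ?thesis using r(1) r(2)[of n] by linarith
  qed
  have "a n \<noteq> 0" for n using a0[of n] by simp
  then have "\<exists>b q. q > 0 \<and> (\<forall>n. b (n + int q) = b n) \<and>
     (\<forall>n. b n = a n \<or> b n = a n * exp s \<or> b n = a n * exp (- s)) \<and> \<bar>tr2 (transfers b E 0 q)\<bar> > 2"
    by (rule hyperbolic_perturbation) (fact p s(1))+
  then obtain b q where b: "q > 0" "\<And>n. b (n + int q) = b n" "\<And>n. b n = a n \<or> b n = a n * exp s \<or> b n = a n * exp (- s)"
    "\<bar>tr2 (transfers b E 0 q)\<bar> > 2"
    by blast
  have close: "\<bar>b n - a n\<bar> \<le> d" for n
  proof -
    have aM: "a n \<le> M" using r(1) r(3)[of n] by linarith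
    have es: "exp s - 1 = d / M" using s(2) by simp
    have "a n * (exp s - 1) \<le> M * (exp s - 1)" unfolding es using aM dM by (intro mult_right_mono) auto
    also have "\<dots> = d" unfolding es using M by simp
    finally have up: "a n * (exp s - 1) \<le> d" .
    have up0: "0 \<le> a n * (exp s - 1)" unfolding es using a0[of n] dM by (intro mult_nonneg_nonneg) auto
    have "1 - exp (- s) \<le> exp s - 1"
    proof -
      have "1 + s \<le> exp s" "1 + - s \<le> exp (- s)" by (rule exp_ge_add_one_self)+
      then show ?thesis by linarith
    qed
    then have "a n * (1 - exp (- s)) \<le> a n * (exp s - 1)" using a0[of n] by (intro mult_left_mono) auto
    moreover have "0 \<le> a n * (1 - exp (- s))" using a0[of n] s(1) by simp
    ultimately have dn: "\<bar>a n * exp (- s) - a n\<bar> \<le> d" using up unfolding right_diff_distrib by linarith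
    have "\<bar>a n * exp s - a n\<bar> \<le> d" using up up0 unfolding right_diff_distrib by linarith
    moreover have "\<bar>a n - a n\<bar> \<le> d" using d(1) by simp
    ultimately show ?thesis using dn b(3)[of n] by metis
  qed
  have bd: "inverse M \<le> b n" "b n \<le> M" for n
    using close[of n] d r(2)[of n] r(3)[of n] by linarith+
  have "\<exists>c>0. \<forall>u. c * norm u \<le> norm (J b u - E *\<^sub>R u)"
    by (rule hyperbolic_bounded_below) (fact bd M b(2,4))+
  then obtain c where "c > 0 \<and> (\<forall>u. c * norm u \<le> norm (res b E u))"
    unfolding res_def by blast
  moreover have "\<bar>b n - a n\<bar> \<le> \<epsilon>" for n using close[of n] d by linarith
  ultimately show ?thesis using b(1,2) bd
    by (intro exI[of _ b] exI[of _ q] exI[of _ c]) simp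
qed

text \<open>A lower bound \<open>c E\<close> at the energy \<open>E\<close> leaves
  \<open>c E / 2\<close> at all energies within \<open>c E / 2\<close>. Compactness leaves finitely
  many sequences, with the minimum of the bounds as \<open>\<gamma>\<close> and the product of the
  periods as a common period.\<close>

lemma gap_family:
  assumes M: "M > 1" and p: "p > 0" "\<And>n. a (n + int p) = a n" and r: "r > 0" "\<And>n. inverse M + r \<le> a n" "\<And>n. a n \<le> M - r"
    and \<epsilon>: "\<epsilon> > 0"
  shows "\<exists>(m::nat) B q \<gamma>. m > 0 \<and> q > 0 \<and> \<gamma> > 0 \<and>
     (\<forall>j<m. (\<forall>n. B j (n + int q) = B j n) \<and> (\<forall>n. inverse M \<le> B j n \<and> B j n \<le> M \<and> \<bar>B j n - a n\<bar> \<le> \<epsilon>)) \<and>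
     (\<forall>E. \<bar>E\<bar> \<le> 2 * M \<longrightarrow> (\<exists>j<m. \<forall>u. \<gamma> * norm u \<le> norm (res (B j) E u)))"
proof -
  have "\<forall>E. \<exists>b q c. q > 0 \<and> (\<forall>n. b (n + int q) = b n) \<and> (\<forall>n. inverse M \<le> b n \<and> b n \<le> M \<and> \<bar>b n - a n\<bar> \<le> \<epsilon>) \<and>
     c > 0 \<and> (\<forall>u. c * norm u \<le> norm (res b E u))"
    using hyperbolic_approximation[OF M p(1) _ r(1) _ _ \<epsilon>, of a] p(2) r(2,3) by blast
  then obtain b q c where f: "\<And>E. q E > 0" "\<And>E n. b E (n + int (q E)) = b E n"
    "\<And>E n. inverse M \<le> b E n \<and> b E n \<le> M \<and> \<bar>b E n - a n\<bar> \<le> \<epsilon>"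
    "\<And>E. c E > 0" "\<And>E u. c E * norm u \<le> norm (res (b E) E u)"
    by metis
  obtain D where D: "D \<subseteq> {- 2 * M..2 * M}" "finite D" "{- 2 * M..2 * M} \<subseteq> (\<Union>E\<in>D. ball E (c E / 2))"
  proof (rule compactE_image[of "{- 2 * M..2 * M}" "{- 2 * M..2 * M}" "\<lambda>E. ball E (c E / 2)"])
    show "{- 2 * M..2 * M} \<subseteq> (\<Union>E\<in>{- 2 * M..2 * M}. ball E (c E / 2))" using f(4) by force
  qed auto
  have "0 \<in> {- 2 * M..2 * M}" using M by simp
  then have ne: "D \<noteq> {}" using D(3) by blast
  obtain h where h: "bij_betw h {0..<card D} D" using ex_bij_betw_nat_finite[OF D(2)] by blast
  have hD: "h j \<in> D" if "j < card D" for j using h that by (auto simp: bij_betw_def)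
  define Q where "Q = (\<Prod>E\<in>D. q E)"
  define \<gamma> where "\<gamma> = Min ((\<lambda>E. c E / 2) ` D)"
  have \<gamma>: "\<gamma> > 0" using f(4) D(2) ne by (simp add: \<gamma>_def)
  have Q: "card D > 0" "Q > 0"
    using D(2) ne f(1) by (auto simp: card_gt_0_iff Q_def intro: prod_pos)
  have per: "b (h j) (n + int Q) = b (h j) n" if j: "j < card D" for j n
  proof -
    have "q (h j) dvd Q" unfolding Q_def using D(2) hD[OF j] by (rule dvd_prodI)
    then obtain k where "Q = q (h j) * k" by (auto simp: dvd_def)
    then have "int Q = int k * int (q (h j))" by simp
    then show ?thesis
      using periodic_multiple[of "b (h j)" "int (q (h j))" n k, OF f(2)] by simp
  qed
  have gap: "\<exists>j<card D. \<forall>u. \<gamma> * norm u \<le> norm (res (b (h j)) E u)" if "\<bar>E\<bar> \<le> 2 * M" for E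
  proof -
    have "E \<in> {- 2 * M..2 * M}" using that by auto
    then obtain E' where E': "E' \<in> D" "\<bar>E' - E\<bar> < c E' / 2" using D(3) by (auto simp: dist_real_def)
    then have "E' \<in> h ` {0..<card D}" using h by (simp add: bij_betw_def)
    then obtain j where j: "j < card D" "h j = E'" by auto
    have "\<gamma> \<le> c E' / 2" unfolding \<gamma>_def by (rule Min_le) (use D(2) E' in auto)
    have "\<gamma> * norm u \<le> norm (res (b (h j)) E u)" for u
    proof -
      have "c E' * norm u \<le> norm (res (b E') E' u)" by (rule f(5))
      also have "res (b E') E' u = res (b E') E u - (E' - E) *\<^sub>R u" by (simp add: res_def algebra_simps)
      also have "norm \<dots> \<le> norm (res (b E') E u) + \<bar>E' - E\<bar> * norm u"
        using norm_triangle_ineq4[of "res (b E') E u" "(E' - E) *\<^sub>R u"] by simp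
      also have "\<dots> \<le> norm (res (b E') E u) + (c E' / 2) * norm u"
        using E' by (intro add_left_mono mult_right_mono) auto
      finally have "(c E' / 2) * norm u \<le> norm (res (b E') E u)" by simp
      moreover have "\<gamma> * norm u \<le> (c E' / 2) * norm u" using \<open>\<gamma> \<le> c E' / 2\<close> by (intro mult_right_mono) auto
      ultimately show ?thesis by (simp add: j(2))
    qed
    then show ?thesis using j(1) by blast
  qed
  show ?thesis
    by (rule exI[of _ "card D"], rule exI[of _ "\<lambda>j. b (h j)"], rule exI[of _ Q], rule exI[of _ \<gamma>])
       (use Q \<gamma> per f(3) gap in blast)
qed

definition unit_vec :: "complex \<Rightarrow> int \<Rightarrow> l2" where
  "unit_vec z n = of_seq (\<lambda>k. if k = n then z else 0)"

lemma seq_unit_vec: "seq (unit_vec z n) k = (if k = n then z else 0)"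
proof -
  have "(\<Sum>k\<in>F. (norm (if k = n then z else 0))\<^sup>2) \<le> (norm z)\<^sup>2" if "finite F" for F
  proof -
    have "(\<Sum>k\<in>F. (norm (if k = n then z else 0))\<^sup>2) = (\<Sum>k\<in>F. if k = n then (norm z)\<^sup>2 else 0)"
      by (rule sum.cong) auto
    then show ?thesis using that by (simp add: sum.delta)
  qed
  then have "(\<lambda>k. if k = n then z else 0) \<in> ell2" unfolding ell2_iff_finite_sums by blast
  then show ?thesis by (simp add: unit_vec_def)
qed

text \<open>The scalars are real, so each site needs two vectors; a block of \<open>P\<close> sites
  therefore counts with dimension at most \<open>2 * P\<close>.\<close>

lemma finite_support_in_span:
  assumes "finite A" "\<And>n. n \<notin> A \<Longrightarrow> seq v n = 0"
  shows "v \<in> span (unit_vec 1 ` A \<union> unit_vec \<i> ` A)"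
proof -
  have "v = (\<Sum>n\<in>A. Re (seq v n) *\<^sub>R unit_vec 1 n + Im (seq v n) *\<^sub>R unit_vec \<i> n)"
  proof (rule l2_eqI)
    fix k
    have "seq (\<Sum>n\<in>A. Re (seq v n) *\<^sub>R unit_vec 1 n + Im (seq v n) *\<^sub>R unit_vec \<i> n) k
      = (\<Sum>n\<in>A. if k = n then Re (seq v n) *\<^sub>R 1 + Im (seq v n) *\<^sub>R \<i> else 0)"
      by (simp add: seq_unit_vec) (rule sum.cong, auto)
    also have "\<dots> = (if k \<in> A then Re (seq v k) *\<^sub>R 1 + Im (seq v k) *\<^sub>R \<i> else 0)"
      using assms(1) by simp
    also have "\<dots> = seq v k" using assms(2)[of k] by (auto simp: complex_eq_iff)
    finally show "seq v k = seq (\<Sum>n\<in>A. Re (seq v n) *\<^sub>R unit_vec 1 n + Im (seq v n) *\<^sub>R unit_vec \<i> n) k" by simp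
  qed
  also have "\<dots> \<in> span (unit_vec 1 ` A \<union> unit_vec \<i> ` A)"
    by (intro span_sum span_add span_scale span_base) auto
  finally show ?thesis .
qed

lemma poly_times_geometric_tendsto_0:
  fixes A C D x :: real
  assumes "A > 0" "C > 0" "D > 0" "0 < x" "x < 1"
  shows "(\<lambda>t::nat. (A * (real t + 1)) ^ K * (C * x ^ t * (D * (real t + 1) + 1))) \<longlonglongrightarrow> 0"
proof -
  define y where "y = - ln x"
  have y: "y > 0" using assms by (simp add: y_def)
  have x: "x ^ t = exp (- y * real t)" for t
    using assms by (simp add: y_def exp_of_nat2_mult mult.commute[of _ "real t"] exp_of_nat_mult)
  show ?thesis unfolding x using assms y by real_asymp
qed

lemma cover_union:
  fixes S :: "nat \<Rightarrow> real set"
  assumes "\<And>j. j < m \<Longrightarrow> \<exists>c::nat \<Rightarrow> real. S j \<subseteq> (\<Union>i<n. {c i..c i + s})"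
  shows "\<exists>c::nat \<Rightarrow> real. (\<Union>j<m. S j) \<subseteq> (\<Union>i<m * n. {c i..c i + s})"
proof -
  obtain c where c: "\<And>j. j < m \<Longrightarrow> S j \<subseteq> (\<Union>i<n. {c j i..c j i + s})" using assms by metis
  have "(\<Union>j<m. S j) \<subseteq> (\<Union>i<m * n. {c (i div n) (i mod n)..c (i div n) (i mod n) + s})"
  proof
    fix x assume "x \<in> (\<Union>j<m. S j)"
    then obtain j i where ji: "j < m" "i < n" "x \<in> {c j i..c j i + s}" using c by blast
    have "j * n + i < m * n"
    proof -
      have "j * n + i < (j + 1) * n" using ji by simp
      also have "\<dots> \<le> m * n" using ji by (intro mult_right_mono) auto
      finally show ?thesis .
    qed
    moreover have "(j * n + i) div n = j" "(j * n + i) mod n = i" using ji by auto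
    ultimately show "x \<in> (\<Union>i<m * n. {c (i div n) (i mod n)..c (i div n) (i mod n) + s})"
      using ji(3) by (intro UN_I[of "j * n + i"]) auto
  qed
  then show ?thesis by (rule exI[of _ "\<lambda>i. c (i div n) (i mod n)"])
qed

text \<open>The enlargement by \<open>\<eta>\<close> lets a covering found for a periodic
  \<open>b\<close> serve for the spectra of all sequences close to \<open>b\<close>.\<close>

definition pseudo_spectrum :: "(int \<Rightarrow> real) \<Rightarrow> real \<Rightarrow> real \<Rightarrow> real set" where
  "pseudo_spectrum b \<eta> R = {E. \<bar>E\<bar> \<le> R \<and> (\<exists>u. u \<noteq> 0 \<and> norm (res b E u) \<le> \<eta> * norm u)}"

text \<open>\<open>b\<close> follows each of the \<open>m\<close> sequences of
  \<open>gap_family\<close> for a stretch of length \<open>l\<close>. For an energy in a gap of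
  \<open>B j\<close>, the localization lemmas cut an approximate eigenvector at the middle of the
  stretches of \<open>B j\<close> and leave one supported in a single period; such energies are
  counted by dimension. As \<open>t\<close> grows, the number of intervals is linear and their
  length is geometric in \<open>t\<close>.\<close>

lemma thin_approximation:
  assumes M: "M > 1" and p: "p > 0" "\<And>n. a (n + int p) = a n" and r: "r > 0" "\<And>n. inverse M + r \<le> a n" "\<And>n. a n \<le> M - r"
    and \<epsilon>: "\<epsilon> > 0"
  shows "\<exists>b q \<eta> N s c. q > 0 \<and> q \<ge> K \<and> (\<forall>n. b (n + int q) = b n) \<and> (\<forall>n. inverse M \<le> b n \<and> b n \<le> M \<and> \<bar>b n - a n\<bar> \<le> \<epsilon>) \<and>
     \<eta> > 0 \<and> s > 0 \<and> N > 0 \<and> real N ^ K * s \<le> 1 / real (Suc K) \<and> pseudo_spectrum b \<eta> (2 * M) \<subseteq> (\<Union>i<N. {c i..c i + s})"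
proof -
  obtain m :: nat and B q0 \<gamma> where m: "m > 0" "q0 > 0" "\<gamma> > 0"
    and Bper: "\<And>j n. j < m \<Longrightarrow> B j (n + int q0) = B j n"
    and Bbd: "\<And>j n. j < m \<Longrightarrow> inverse M \<le> B j n \<and> B j n \<le> M \<and> \<bar>B j n - a n\<bar> \<le> \<epsilon>"
    and gap: "\<And>E. \<bar>E\<bar> \<le> 2 * M \<Longrightarrow> \<exists>j<m. \<forall>u. \<gamma> * norm u \<le> norm (res (B j) E u)"
    using gap_family[OF M p(1) _ r(1) _ _ \<epsilon>, of a] p(2) r(2,3) by metis
  define \<theta> where "\<theta> = 1 / (1 + \<gamma>\<^sup>2 / (8 * M\<^sup>2))"
  have \<theta>: "0 < \<theta>" "\<theta> < 1" using m M by (auto simp: \<theta>_def add_pos_pos)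
  define x where "x = sqrt \<theta>"
  have x: "0 < x" "x < 1" using \<theta> by (auto simp: x_def)
  \<comment> \<open>Chosen so that the number of intervals is \<open>A * (t + 1)\<close> and the
    dimension bound \<open>2 * P\<close> is \<open>D * (t + 1)\<close>. In the limit below, 144 = 2
    * 4 * 18: interval length \<open>2 * s0\<close>, separation \<open>4 * \<delta>\<close> per
    dimension, and \<open>\<delta> = 18 * M * \<beta>\<close>.\<close>
  define A where "A = real (8 * m * m * q0)"
  define D where "D = real (8 * m * q0)"
  have AD: "A > 0" "D > 0" using m by (auto simp: A_def D_def)
  have "(\<lambda>t::nat. (A * (real t + 1)) ^ K * ((144 * M) * x ^ t * (D * (real t + 1) + 1))) \<longlonglongrightarrow> 0"
    by (rule poly_times_geometric_tendsto_0) (use AD M x in auto)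
  then have ev1: "\<forall>\<^sub>F t in sequentially. (A * (real t + 1)) ^ K * ((144 * M) * x ^ t * (D * (real t + 1) + 1)) < 1 / real (Suc K)"
    by (rule order_tendstoD) simp
  have "(\<lambda>t::nat. x ^ t) \<longlonglongrightarrow> 0" by (rule LIMSEQ_power_zero) (use x in auto)
  then have ev2: "\<forall>\<^sub>F t in sequentially. x ^ t < 1 / 4" by (rule order_tendstoD) simp
  obtain t where t: "t \<ge> K" "x ^ t < 1 / 4" "(A * (real t + 1)) ^ K * ((144 * M) * x ^ t * (D * (real t + 1) + 1)) < 1 / real (Suc K)"
    using eventually_conj[OF eventually_conj[OF ev1 ev2] eventually_ge_at_top[of K]]
    by (auto simp: eventually_sequentially)
  \<comment> \<open>A multiple of \<open>q0\<close>, so that \<open>b\<close> has period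
    \<open>m * l\<close>, and at least \<open>4 * t + 4\<close>, so that a window of radius
    \<open>2 * t + 1\<close> fits into each stretch.\<close>
  define l where "l = q0 * (4 * t + 4)"
  define P where "P = m * l"
  define \<beta> where "\<beta> = sqrt (\<theta> ^ t)"
  have \<beta>x: "\<beta> = x ^ t" by (simp add: \<beta>_def x_def real_sqrt_power)
  have \<beta>: "\<beta> > 0" "\<beta> \<le> 1 / 4" using x t by (auto simp: \<beta>x)
  define \<eta> where "\<eta> = sqrt (\<theta> ^ t / (real t + 1))"
  have \<eta>: "\<eta> > 0" "\<eta>\<^sup>2 * (real t + 1) \<le> \<theta> ^ t" using \<theta> by (auto simp: \<eta>_def)
  have l: "l > 0" "l \<ge> 4 * t + 4" using m by (auto simp: l_def)
  have P: "P > 0" using m l by (simp add: P_def)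
  define b where "b n = B (nat ((n div int l) mod int m)) n" for n
  have jm: "nat ((n div int l) mod int m) < m" for n using m by (simp add: nat_less_iff)
  have bbd: "inverse M \<le> b n \<and> b n \<le> M \<and> \<bar>b n - a n\<bar> \<le> \<epsilon>" for n
    unfolding b_def by (rule Bbd[OF jm])
  have abs_le: "\<bar>z\<bar> \<le> M" if "inverse M \<le> z \<and> z \<le> M" for z
  proof -
    have "0 < inverse M" using M by simp
    then show ?thesis using that by linarith
  qed
  have babs: "\<bar>b n\<bar> \<le> M" for n using bbd[of n] abs_le by blast
  have bper: "b (n + int P) = b n" for n
  proof -
    have "int P = int (m * (4 * t + 4)) * int q0" by (simp add: P_def l_def)
    then have "B j (n + int P) = B j n" if "j < m" for j
      using periodic_multiple[of "B j" "int q0" n "m * (4 * t + 4)", OF Bper[OF that]] by simp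
    moreover have "(n + int P) div int l = n div int l + int m" using l by (simp add: P_def)
    ultimately show ?thesis using jm[of n] by (simp add: b_def)
  qed
  define \<delta> where "\<delta> = 18 * M * \<beta>"
  define s0 where "s0 = 4 * \<delta> * (real (2 * P) + 1)"
  have \<delta>: "\<delta> > 0" using M \<beta> by (simp add: \<delta>_def)
  then have s0: "s0 > 0" by (simp add: s0_def add_nonneg_pos)
  \<comment> \<open>Energies are sorted by a sequence \<open>B j\<close> with a gap there, because
    the place of the cut depends on \<open>j\<close>.\<close>
  define S where "S j = {E \<in> pseudo_spectrum b \<eta> (2 * M). \<forall>u. \<gamma> * norm u \<le> norm (res (B j) E u)}" for j
  have "\<exists>c::nat \<Rightarrow> real. S j \<subseteq> (\<Union>i<2 * P. {c i..c i + 2 * s0})" if j: "j < m" for j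
  proof (rule separated_imp_cover[OF s0])
    fix X assume X: "finite X" "X \<subseteq> S j" and sep: "\<And>x y. x \<in> X \<Longrightarrow> y \<in> X \<Longrightarrow> x \<noteq> y \<Longrightarrow> s0 \<le> \<bar>x - y\<bar>"
    \<comment> \<open>The offset \<open>2 * t + 2\<close> places the window of radius
      \<open>2 * t + 1\<close> around \<open>c\<close> inside the stretch of
      \<open>B j\<close>.\<close>
    define c where "c = int (j * l + 2 * t + 2)"
    define I where "I = {c..<c + int P}"
    define V where "V = unit_vec 1 ` I \<union> unit_vec \<i> ` I"
    have V: "finite V" "card V \<le> 2 * P"
    proof -
      show "finite V" by (simp add: V_def I_def)
      have "card V \<le> card (unit_vec 1 ` I) + card (unit_vec \<i> ` I)" unfolding V_def by (rule card_Un_le)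
      also have "\<dots> \<le> card I + card I" by (intro add_mono card_image_le) (auto simp: I_def)
      finally show "card V \<le> 2 * P" by (simp add: I_def)
    qed
    have agree: "b n = B j n" if n: "\<bar>n - c - k * int P\<bar> \<le> int (2 * t + 1)" for n k
    proof -
      define e where "e = n - c - k * int P + int (2 * t + 2)"
      have e: "0 \<le> e" "e < int l" using n l by (auto simp: e_def abs_le_iff)
      have "n = int l * (int j + k * int m) + e" by (simp add: e_def c_def P_def algebra_simps)
      then have "n div int l = int j + k * int m" using e by (rule int_div_pos_eq)
      then have "nat ((n div int l) mod int m) = j" using j by simp
      then show ?thesis by (simp add: b_def)
    qed
    have "\<exists>v. norm v = 1 \<and> norm (J b v - E *\<^sub>R v) \<le> \<delta> \<and> v \<in> span V" if E: "E \<in> X" for E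
    proof -
      obtain u where u: "\<bar>E\<bar> \<le> 2 * M" "u \<noteq> 0" "norm (res b E u) \<le> \<eta> * norm u"
        and gapE: "\<And>u. \<gamma> * norm u \<le> norm (res (B j) E u)"
        using E X(2) by (auto simp: S_def pseudo_spectrum_def)
      have Babs: "\<bar>B j n\<bar> \<le> M" for n using Bbd[OF j, of n] abs_le by blast
      have "\<exists>w. w \<noteq> 0 \<and> (\<forall>n k. \<bar>n - c - k * int P\<bar> \<le> 1 \<longrightarrow> seq w n = 0) \<and> norm (res b E w) \<le> 18 * M * \<beta> * norm w"
        by (rule gap_region_localization[where B="B j" and u=u and t=t and \<gamma>=\<gamma> and \<theta>=\<theta> and \<eta>=\<eta>])
           (fact M babs Babs m(3) gapE agree u \<theta>_def less_imp_le[OF \<eta>(1)] \<eta>(2) \<beta>_def \<beta>(2))+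
      then obtain w where w: "w \<noteq> 0" "\<And>n k. \<bar>n - c - k * int P\<bar> \<le> 1 \<Longrightarrow> seq w n = 0" "norm (res b E w) \<le> \<delta> * norm w"
        unfolding \<delta>_def by blast
      have "\<exists>v. v \<noteq> 0 \<and> (\<forall>n. n \<notin> {c..<c + int P} \<longrightarrow> seq v n = 0) \<and> norm (res b E v) \<le> \<delta> * norm v"
      proof (rule block_localization[where a=b and C=M and w=w])
        show "int P > 0" using P by simp
      qed (fact babs bper w less_imp_le[OF \<delta>])+
      then obtain v where v: "v \<noteq> 0" "\<And>n. n \<notin> {c..<c + int P} \<Longrightarrow> seq v n = 0" "norm (res b E v) \<le> \<delta> * norm v"
        by blast
      define v' where "v' = (1 / norm v) *\<^sub>R v"
      have "norm v' = 1" using v(1) by (simp add: v'_def)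
      moreover have "norm (J b v' - E *\<^sub>R v') \<le> \<delta>"
      proof -
        interpret Jb: self_adjoint "J b" by (rule J_self_adjoint[of b M, OF babs])
        have "J b v' - E *\<^sub>R v' = (1 / norm v) *\<^sub>R res b E v"
          by (simp add: v'_def res_def Jb.scaleR scaleR_diff_right)
        then show ?thesis using v by (simp add: pos_divide_le_eq)
      qed
      moreover have "v' \<in> span V"
        unfolding V_def by (rule finite_support_in_span) (use v(2) in \<open>auto simp: I_def v'_def\<close>)
      ultimately show ?thesis by blast
    qed
    then obtain v where v: "\<And>E. E \<in> X \<Longrightarrow> norm (v E) = 1" "\<And>E. E \<in> X \<Longrightarrow> norm (J b (v E) - E *\<^sub>R v E) \<le> \<delta>"
      "\<And>E. E \<in> X \<Longrightarrow> v E \<in> span V" by metis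
    interpret Jb: self_adjoint "J b" by (rule J_self_adjoint[of b M, OF babs])
    have "card X \<le> card V"
    proof (rule almost_eigenvector_count[OF Jb.symmetric X(1) sep s0 _ v V(1)])
      have "4 * \<delta> * (real (card V) + 1) \<le> 4 * \<delta> * (real (2 * P) + 1)"
        using V(2) \<delta> by (intro mult_left_mono) auto
      then show "4 * \<delta> * (real (card V) + 1) \<le> s0" by (simp add: s0_def)
    qed
    then show "card X \<le> 2 * P" using V(2) by simp
  qed
  then obtain c :: "nat \<Rightarrow> real" where c: "(\<Union>j<m. S j) \<subseteq> (\<Union>i<m * (2 * P). {c i..c i + 2 * s0})"
    using cover_union[where m=m and S=S and n="2 * P" and s="2 * s0"] by blast
  have "pseudo_spectrum b \<eta> (2 * M) \<subseteq> (\<Union>j<m. S j)"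
  proof
    fix E assume E: "E \<in> pseudo_spectrum b \<eta> (2 * M)"
    then obtain j where "j < m" "\<forall>u. \<gamma> * norm u \<le> norm (res (B j) E u)" using gap[of E] by (auto simp: pseudo_spectrum_def)
    with E show "E \<in> (\<Union>j<m. S j)" by (auto simp: S_def)
  qed
  with c have cov: "pseudo_spectrum b \<eta> (2 * M) \<subseteq> (\<Union>i<m * (2 * P). {c i..c i + 2 * s0})" by blast
  have "real (m * (2 * P)) = A * (real t + 1)" "real (2 * P) = D * (real t + 1)"
    by (simp_all add: A_def D_def P_def l_def algebra_simps)
  moreover have "2 * s0 = 144 * M * x ^ t * (real (2 * P) + 1)" by (simp add: s0_def \<delta>_def \<beta>x)
  ultimately have "real (m * (2 * P)) ^ K * (2 * s0) \<le> 1 / real (Suc K)"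
    using less_imp_le[OF t(3)] by (simp only:)
  moreover have "P \<ge> K"
  proof -
    have "t \<le> l" using l(2) by simp
    also have "l \<le> P" using m(1) by (simp add: P_def)
    finally show ?thesis using t(1) by simp
  qed
  ultimately show ?thesis using P m(1) bper bbd \<eta>(1) s0 cov
    by (intro exI[of _ b] exI[of _ P] exI[of _ \<eta>] exI[of _ "m * (2 * P)"] exI[of _ "2 * s0"] exI[of _ c]) simp
qed

section \<open>The dense set\<close>

text \<open>\<open>4 * \<rho> <= \<eta>\<close> transfers the covering from \<open>b\<close> to the
  spectrum of \<open>a\<close>: passing from \<open>a\<close> to \<open>b\<close> costs
  \<open>2 * \<rho>\<close>, which is half of \<open>\<eta>\<close>. The last inequality is the
  hypothesis of \<open>gordon_no_eigenvector\<close> for \<open>k = K\<close>.\<close>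

definition thinly_approximated :: "real \<Rightarrow> nat \<Rightarrow> (int \<Rightarrow> real) \<Rightarrow> bool" where
  "thinly_approximated M K a \<longleftrightarrow>
     (\<exists>b q \<eta> N s c \<rho>. q \<ge> K \<and> (\<forall>n. b (n + int q) = b n) \<and> (\<forall>n. inverse M \<le> b n \<and> b n \<le> M) \<and>
        0 < \<eta> \<and> 0 < s \<and> 0 < N \<and> real N ^ K * s \<le> 1 / real (Suc K) \<and>
        pseudo_spectrum b \<eta> (2 * M) \<subseteq> (\<Union>i<N. {c i..c i + s}) \<and>
        (\<forall>n. \<bar>a n - b n\<bar> \<le> \<rho>) \<and> 4 * \<rho> \<le> \<eta> \<and> real (Suc K) * (\<rho> * period_const M (2 * M) q) \<le> 1)"

text \<open>Supplies a dense open set for each \<open>K\<close>: the property holds in a whole ball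
  around \<open>b\<close>, although the radius depends on the period of \<open>b\<close>.\<close>

lemma thin_periodic_dense:
  assumes M: "M > 1" and a: "a \<in> LP_plus M" and \<delta>: "\<delta> > 0"
  shows "\<exists>b \<rho>. b \<in> LP_plus M \<and> (\<forall>n. \<bar>b n - a n\<bar> \<le> \<delta>) \<and> \<rho> > 0 \<and>
     (\<forall>a'. (\<forall>n. \<bar>a' n - b n\<bar> \<le> \<rho>) \<longrightarrow> thinly_approximated M K a')"
proof -
  have "limit_periodic a" "\<delta> / 4 > 0" using a \<delta> by (simp_all add: LP_plus_def)
  then obtain c where c: "periodic_seq c" "\<And>n. \<bar>a n - c n\<bar> \<le> \<delta> / 4"
    unfolding limit_periodic_def by blast
  obtain p where p: "p > 0" "\<And>n. c (n + p) = c n" using c(1) by (auto simp: periodic_seq_def)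
  have aM: "inverse M \<le> a n" "a n \<le> M" for n using a by (auto simp: LP_plus_def)
  have "inverse M < 1" using M by (simp add: inverse_less_1_iff)
  then have M': "inverse M < M" using M by linarith
  define r where "r = min (\<delta> / 4) ((M - inverse M) / 2)"
  have "r \<le> (M - inverse M) / 2" unfolding r_def by (rule min.cobounded2)
  then have "2 * r \<le> 2 * ((M - inverse M) / 2)" by (intro mult_left_mono) auto
  then have r2: "2 * r \<le> M - inverse M" by simp
  have r: "r > 0" "r \<le> \<delta> / 4" using \<delta> M' by (auto simp: r_def)
  \<comment> \<open>Clamping leaves a margin \<open>r\<close> on both sides, in which
    \<open>thin_approximation\<close> can perturb without leaving the interval from
    \<open>1 / M\<close> to \<open>M\<close>.\<close>
  define c' where "c' n = max (inverse M + r) (min (M - r) (c n))" for n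
  have c'a: "\<bar>c' n - a n\<bar> \<le> \<delta> / 2" for n
    using c(2)[of n] aM[of n] r r2 unfolding c'_def by linarith
  have "\<exists>b q \<eta> N s d. q > 0 \<and> q \<ge> K \<and> (\<forall>n. b (n + int q) = b n) \<and> (\<forall>n. inverse M \<le> b n \<and> b n \<le> M \<and> \<bar>b n - c' n\<bar> \<le> \<delta> / 2) \<and>
     \<eta> > 0 \<and> s > 0 \<and> N > 0 \<and> real N ^ K * s \<le> 1 / real (Suc K) \<and> pseudo_spectrum b \<eta> (2 * M) \<subseteq> (\<Union>i<N. {d i..d i + s})"
  proof (rule thin_approximation[OF M, where p="nat p" and r=r])
    show "c' (n + int (nat p)) = c' n" for n using p by (simp add: c'_def)
    show "c' n \<le> M - r" for n using r2 unfolding c'_def by linarith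
  qed (use p r \<delta> in \<open>auto simp: c'_def\<close>)
  then obtain b q \<eta> N s d where b: "q > 0" "q \<ge> K" "\<And>n. b (n + int q) = b n"
      "\<And>n. inverse M \<le> b n \<and> b n \<le> M \<and> \<bar>b n - c' n\<bar> \<le> \<delta> / 2"
    and \<eta>: "\<eta> > 0" "s > 0" "N > 0" "real N ^ K * s \<le> 1 / real (Suc K)" "pseudo_spectrum b \<eta> (2 * M) \<subseteq> (\<Union>i<N. {d i..d i + s})"
    by blast
  define C where "C = period_const M (2 * M) q"
  have C: "C \<ge> 0" using M by (simp add: C_def period_const_def)
  \<comment> \<open>The first bound keeps the covering valid in the ball, the second beats the
    growth of \<open>period_const\<close> in \<open>q\<close>; adding 1 to \<open>C\<close> avoids a
    division by 0.\<close>
  define \<rho> where "\<rho> = min (\<eta> / 4) (1 / (real (Suc K) * (C + 1)))"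
  have \<rho>: "\<rho> > 0" "4 * \<rho> \<le> \<eta>" using \<eta>(1) C by (auto simp: \<rho>_def)
  have "real (Suc K) * (\<rho> * C) \<le> 1"
  proof -
    have "\<rho> \<le> 1 / (real (Suc K) * (C + 1))" by (simp add: \<rho>_def)
    then have "\<rho> * (real (Suc K) * (C + 1)) \<le> 1" using C by (subst (asm) pos_le_divide_eq) auto
    moreover have "\<rho> * (real (Suc K) * C) \<le> \<rho> * (real (Suc K) * (C + 1))" using \<rho> by (intro mult_left_mono) auto
    ultimately show ?thesis by (simp add: mult_ac)
  qed
  then have "thinly_approximated M K a'" if "\<forall>n. \<bar>a' n - b n\<bar> \<le> \<rho>" for a'
    unfolding thinly_approximated_def using b \<eta> \<rho> that
    by (intro exI[of _ b] exI[of _ q] exI[of _ \<eta>] exI[of _ N] exI[of _ s] exI[of _ d] exI[of _ \<rho>]) (simp add: C_def)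
  moreover have "b \<in> LP_plus M"
  proof -
    have "periodic_seq b" unfolding periodic_seq_def using b(1,3) by (intro exI[of _ "int q"]) simp
    then have "limit_periodic b" unfolding limit_periodic_def by (auto intro!: exI[of _ b])
    then show ?thesis using b(4) by (simp add: LP_plus_def)
  qed
  moreover have "\<bar>b n - a n\<bar> \<le> \<delta>" for n
    using b(4)[of n] c'a[of n] by linarith
  ultimately show ?thesis using \<rho>(1) by blast
qed

lemma LP_plus_limit:
  assumes "\<And>k. b k \<in> LP_plus M" "\<And>k n. \<bar>a n - b k n\<bar> \<le> \<rho> k" "\<rho> \<longlonglongrightarrow> 0"
  shows "a \<in> LP_plus M"
proof -
  have lim: "(\<lambda>k. b k n) \<longlonglongrightarrow> a n" for n
  proof (rule LIM_zero_cancel)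
    show "(\<lambda>k. b k n - a n) \<longlonglongrightarrow> 0"
      by (rule Lim_null_comparison[OF _ assms(3)]) (use assms(2) in \<open>auto simp: abs_minus_commute\<close>)
  qed
  have "limit_periodic a"
    unfolding limit_periodic_def
  proof (intro allI impI)
    fix e :: real assume e: "e > 0"
    then have "\<forall>\<^sub>F k in sequentially. \<rho> k < e / 2" using assms(3) by (intro order_tendstoD) auto
    then obtain k where k: "\<rho> k < e / 2" by (auto simp: eventually_sequentially)
    have "limit_periodic (b k)" using assms(1)[of k] by (simp add: LP_plus_def)
    then obtain c where c: "periodic_seq c" "\<And>n. \<bar>b k n - c n\<bar> \<le> e / 2"
      using e unfolding limit_periodic_def by (meson half_gt_zero)
    have "\<bar>a n - c n\<bar> \<le> e" for n using c(2)[of n] assms(2)[of n k] k by linarith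
    then show "\<exists>c. periodic_seq c \<and> (\<forall>n. \<bar>a n - c n\<bar> \<le> e)" using c(1) by blast
  qed
  moreover have "inverse M \<le> a n" for n
    by (rule LIMSEQ_le_const[OF lim]) (use assms(1) in \<open>auto simp: LP_plus_def\<close>)
  moreover have "a n \<le> M" for n
    by (rule LIMSEQ_le_const2[OF lim]) (use assms(1) in \<open>auto simp: LP_plus_def\<close>)
  ultimately show ?thesis by (simp add: LP_plus_def)
qed

text \<open>A Baire argument carried out by hand: a pair in \<open>P n\<close> is a centre with a
  radius, \<open>Q\<close> makes the next ball lie inside the present one, and the limit belongs to
  all of them. The clause for \<open>n = 0\<close> keeps the whole construction near
  \<open>a\<close>.\<close>

lemma thinly_approximated_dense:
  assumes M: "M > 1"
  shows "sup_dense_in {a \<in> LP_plus M. \<forall>K. thinly_approximated M K a} (LP_plus M)"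
  unfolding sup_dense_in_def
proof (intro conjI ballI allI impI)
  fix a and \<epsilon> :: real assume a: "a \<in> LP_plus M" and \<epsilon>: "\<epsilon> > 0"
  define P where "P n x \<longleftrightarrow> fst x \<in> LP_plus M \<and> snd x > 0 \<and>
      (\<forall>a'. (\<forall>k. \<bar>a' k - fst x k\<bar> \<le> snd x) \<longrightarrow> thinly_approximated M n a') \<and>
      (n = 0 \<longrightarrow> snd x \<le> \<epsilon> / 2 \<and> (\<forall>k. \<bar>fst x k - a k\<bar> \<le> \<epsilon> / 2))" for n :: nat and x :: "(int \<Rightarrow> real) \<times> real"
  define Q where "Q n x y \<longleftrightarrow> snd y \<le> snd x / 2 \<and> (\<forall>k. \<bar>fst y k - fst x k\<bar> \<le> snd x / 2)"
    for n :: nat and x y :: "(int \<Rightarrow> real) \<times> real"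
  have "\<exists>x. P 0 x"
  proof -
    obtain b \<rho> where "b \<in> LP_plus M" "\<And>k. \<bar>b k - a k\<bar> \<le> \<epsilon> / 2" "\<rho> > 0"
      "\<And>a'. (\<forall>k. \<bar>a' k - b k\<bar> \<le> \<rho>) \<Longrightarrow> thinly_approximated M 0 a'"
      using thin_periodic_dense[OF M a, of "\<epsilon> / 2" 0] \<epsilon> by auto
    then have "P 0 (b, min \<rho> (\<epsilon> / 2))" using \<epsilon> by (auto simp: P_def)
    then show ?thesis by blast
  qed
  moreover have "\<exists>y. P (Suc n) y \<and> Q n x y" if "P n x" for n x
  proof -
    have x: "fst x \<in> LP_plus M" "snd x / 2 > 0" using that by (auto simp: P_def)
    obtain b \<rho> where "b \<in> LP_plus M" "\<And>k. \<bar>b k - fst x k\<bar> \<le> snd x / 2" "\<rho> > 0"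
      "\<And>a'. (\<forall>k. \<bar>a' k - b k\<bar> \<le> \<rho>) \<Longrightarrow> thinly_approximated M (Suc n) a'"
      using thin_periodic_dense[OF M x, of "Suc n"] by auto
    then have "P (Suc n) (b, min \<rho> (snd x / 2)) \<and> Q n x (b, min \<rho> (snd x / 2))" using x(2) by (auto simp: P_def Q_def)
    then show ?thesis by blast
  qed
  ultimately obtain f where f: "\<And>n. P n (f n)" "\<And>n. Q n (f n) (f (Suc n))"
    using dependent_nat_choice[of P Q] by blast
  define b \<rho> where "b n = fst (f n)" and "\<rho> n = snd (f n)" for n
  have b: "b n \<in> LP_plus M" "\<rho> n > 0" and thin: "\<And>a'. (\<forall>k. \<bar>a' k - b n k\<bar> \<le> \<rho> n) \<Longrightarrow> thinly_approximated M n a'" for n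
    using f(1)[of n] by (auto simp: P_def b_def \<rho>_def)
  have b0: "\<rho> 0 \<le> \<epsilon> / 2" "\<bar>b 0 k - a k\<bar> \<le> \<epsilon> / 2" for k
    using f(1)[of 0] by (auto simp: P_def b_def \<rho>_def)
  have step: "\<rho> (Suc n) \<le> \<rho> n / 2" "\<bar>b (Suc n) k - b n k\<bar> \<le> \<rho> n / 2" for n k
    using f(2)[of n] by (auto simp: Q_def b_def \<rho>_def)
  have "\<rho> n \<le> \<rho> 0 * (1 / 2) ^ n" for n
  proof (induction n)
    case (Suc n)
    then show ?case using step(1)[of n] by simp
  qed simp
  moreover have "(\<lambda>n. \<rho> 0 * (1 / 2) ^ n) \<longlonglongrightarrow> \<rho> 0 * 0" by (intro tendsto_mult_left LIMSEQ_power_zero) simp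
  ultimately have \<rho>0: "\<rho> \<longlonglongrightarrow> 0"
    using b(2) by (intro Lim_null_comparison[of \<rho> "\<lambda>n. \<rho> 0 * (1 / 2) ^ n"]) (auto simp: less_imp_le)
  \<comment> \<open>Since each radius is at most half of the previous one, a move by
    \<open>\<rho> n / 2\<close> is at most \<open>\<rho> n - \<rho> (Suc n)\<close>, and the moves
    telescope.\<close>
  have dist: "\<bar>b (n + j) k - b n k\<bar> \<le> \<rho> n - \<rho> (n + j)" for n j k
  proof (induction j)
    case (Suc j)
    then show ?case unfolding add_Suc_right using step(1)[of "n + j"] step(2)[of "n + j" k] by linarith
  qed simp
  have "Cauchy (\<lambda>n. b n k)" for k
  proof (rule metric_CauchyI)
    fix e :: real assume "e > 0"
    then have "\<forall>\<^sub>F n in sequentially. \<rho> n < e / 2" using \<rho>0 by (intro order_tendstoD) auto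
    then obtain n where n: "\<rho> n < e / 2" by (auto simp: eventually_sequentially)
    have "dist (b i k) (b j k) < e" if "i \<ge> n" "j \<ge> n" for i j
      using dist[of n "i - n" k] dist[of n "j - n" k] b(2)[of i] b(2)[of j] n that by (simp add: dist_real_def)
    then show "\<exists>n. \<forall>i\<ge>n. \<forall>j\<ge>n. dist (b i k) (b j k) < e" by blast
  qed
  then have "\<exists>l. (\<lambda>n. b n k) \<longlonglongrightarrow> l" for k by (simp add: Cauchy_convergent_iff convergent_def)
  then obtain l where l: "\<And>k. (\<lambda>n. b n k) \<longlonglongrightarrow> l k" by metis
  have close: "\<bar>l k - b n k\<bar> \<le> \<rho> n" for n k
  proof (rule LIMSEQ_le_const2)
    show "(\<lambda>j. \<bar>b j k - b n k\<bar>) \<longlonglongrightarrow> \<bar>l k - b n k\<bar>" by (intro tendsto_intros l)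
    have "\<bar>b j k - b n k\<bar> \<le> \<rho> n" if "j \<ge> n" for j
      using dist[of n "j - n" k] b(2)[of j] that by simp
    then show "\<exists>N. \<forall>j\<ge>N. \<bar>b j k - b n k\<bar> \<le> \<rho> n" by blast
  qed
  have "l \<in> LP_plus M" by (rule LP_plus_limit[OF b(1) close \<rho>0])
  moreover have "thinly_approximated M K l" for K using thin close by blast
  moreover have "\<bar>a k - l k\<bar> \<le> \<epsilon>" for k using close[of k 0] b0(1) b0(2)[of k] by linarith
  ultimately show "\<exists>b\<in>{a \<in> LP_plus M. \<forall>K. thinly_approximated M K a}. \<forall>n. \<bar>a n - b n\<bar> \<le> \<epsilon>" by blast
qed auto

section \<open>Measure zero and dimension zero from thin coverings\<close>

text \<open>For \<open>K >= 1\<close> the condition bounds the total length \<open>N * s\<close> by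
  \<open>1 / (K + 1)\<close> and the ratio \<open>ln N / ln (1 / s)\<close> by \<open>1 / K\<close>;
  it also forces \<open>s\<close> itself to tend to 0.\<close>

definition thinly_covered :: "real set \<Rightarrow> bool" where
  "thinly_covered S \<longleftrightarrow> (\<forall>K::nat. \<exists>N s c. 0 < s \<and> 0 < N \<and> real N ^ K * s \<le> 1 / real (Suc K) \<and> S \<subseteq> (\<Union>i<N. {c (i::nat)..c i + s}))"

lemma thinly_covered_null:
  assumes "thinly_covered S" "S \<in> sets borel"
  shows "emeasure lborel S = 0"
proof -
  have le: "emeasure lborel S \<le> ennreal (1 / real (Suc (Suc K)))" for K
  proof -
    obtain N s c where N: "0 < s" "0 < N" "real N ^ Suc K * s \<le> 1 / real (Suc (Suc K))" "S \<subseteq> (\<Union>i<N. {c (i::nat)..c i + s})"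
      using assms(1) unfolding thinly_covered_def by blast
    have "emeasure lborel S \<le> emeasure lborel (\<Union>i<N. {c i..c i + s})"
      by (rule emeasure_mono[OF N(4)]) auto
    also have "\<dots> \<le> (\<Sum>i<N. emeasure lborel {c i..c i + s})"
      by (rule emeasure_subadditive_finite) auto
    also have "\<dots> = ennreal (real N * s)"
      using N(1) by (simp add: ennreal_mult ennreal_of_nat_eq_real_of_nat)
    also have "\<dots> \<le> ennreal (1 / real (Suc (Suc K)))"
    proof (rule ennreal_leI)
      have "real N ^ 1 \<le> real N ^ Suc K" using N(2) by (intro power_increasing) auto
      then have "real N * s \<le> real N ^ Suc K * s" using N(1) by (intro mult_right_mono) auto
      then show "real N * s \<le> 1 / real (Suc (Suc K))" using N(3) by linarith
    qed
    finally show ?thesis .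
  qed
  show ?thesis
  proof (rule ccontr)
    assume "emeasure lborel S \<noteq> 0"
    then have pos: "0 < emeasure lborel S" by (simp add: zero_less_iff_neq_zero)
    have fin: "emeasure lborel S \<noteq> \<infinity>" using le[of 0] by (auto simp: top_unique)
    define m where "m = enn2real (emeasure lborel S)"
    have m: "emeasure lborel S = ennreal m" using fin by (simp add: m_def less_top)
    then have "m > 0" using pos by simp
    then obtain K where "1 / real (Suc K) < m" using nat_approx_posE by blast
    moreover have "1 / real (Suc (Suc K)) \<le> 1 / real (Suc K)" by (simp add: frac_le)
    moreover have "m \<le> 1 / real (Suc (Suc K))" using le[of K] m \<open>m > 0\<close> by simp
    ultimately show False by linarith
  qed
qed

lemma null_imp_interior_empty:
  fixes S :: "real set"
  assumes "emeasure lborel S = 0" "S \<in> sets borel"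
  shows "interior S = {}"
proof (rule ccontr)
  assume "interior S \<noteq> {}"
  then obtain x e where e: "e > 0" "ball x e \<subseteq> S" by (metis all_not_in_conv mem_interior)
  have "emeasure lborel (ball x e) \<le> emeasure lborel S" using e assms by (intro emeasure_mono) auto
  moreover have "ball x e = {x - e<..<x + e}" by (auto simp: dist_real_def)
  ultimately show False using assms e by simp
qed

text \<open>A lower limit only needs good scales arbitrarily close to 0. The covering for
  \<open>K\<close> provides one such scale \<open>s\<close>, at most \<open>1 / (K + 1)\<close>,
  where the quotient is at most \<open>1 / K\<close>.\<close>

lemma thinly_covered_lower_box_dim:
  assumes "thinly_covered S"
  shows "lower_box_dim S = 0"
proof -
  define f where "f \<epsilon> = ln (real (cover_number S \<epsilon>)) / ln (1 / \<epsilon>)" for \<epsilon>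
  \<comment> \<open>The case \<open>n = 0\<close> rests on the convention
    \<open>ln 0 = 0\<close>.\<close>
  have ln_nonneg: "0 \<le> ln (real n)" for n :: nat by (cases "n = 0") auto
  have "\<forall>\<^sub>F \<epsilon> in at_right 0. (0::ereal) \<le> ereal (f \<epsilon>)"
    unfolding eventually_at_right_field
  proof (intro exI[of _ 1] conjI allI impI)
    fix y :: real assume "0 < y" "y < 1"
    then have "ln (1 / y) > 0" by simp
    then show "(0::ereal) \<le> ereal (f y)" using ln_nonneg by (simp add: f_def)
  qed simp
  then have "0 \<le> Liminf (at_right 0) (\<lambda>\<epsilon>. ereal (f \<epsilon>))" by (rule Liminf_bounded)
  moreover have "\<not> 0 < Liminf (at_right 0) (\<lambda>\<epsilon>. ereal (f \<epsilon>))"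
  proof
    assume "0 < Liminf (at_right 0) (\<lambda>\<epsilon>. ereal (f \<epsilon>))"
    then obtain e where e: "0 < ereal e" "ereal e < Liminf (at_right 0) (\<lambda>\<epsilon>. ereal (f \<epsilon>))"
      using ereal_dense2 by blast
    then have "\<forall>\<^sub>F \<epsilon> in at_right 0. ereal e < ereal (f \<epsilon>)" by (intro less_LiminfD)
    then obtain d where d: "d > 0" "\<And>y. 0 < y \<Longrightarrow> y < d \<Longrightarrow> e < f y"
      by (auto simp: eventually_at_right_field)
    obtain K0 where K0: "1 / real (Suc K0) < min e (min d 1)" using nat_approx_posE[of "min e (min d 1)"] e(1) d(1) by auto
    define K where "K = Suc K0"
    have K: "K > 0" "1 / real K < e" "1 / real K < d" "1 / real K < 1" using K0 by (auto simp: K_def)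
    obtain N s c where N: "0 < s" "0 < N" "real N ^ K * s \<le> 1 / real (Suc K)" "S \<subseteq> (\<Union>i<N. {c (i::nat)..c i + s})"
      using assms unfolding thinly_covered_def by blast
    have le1: "1 / real (Suc K) \<le> 1 / real K" using K by (intro frac_le) auto
    have N1: "1 \<le> real N ^ K" using N(2) by (intro one_le_power) auto
    have "1 * s \<le> real N ^ K * s" using N1 N(1) by (intro mult_right_mono) auto
    then have s: "s < d" "s < 1" using N(3) le1 K by linarith+
    have cn: "cover_number S s \<le> N" unfolding cover_number_def by (rule Least_le) (use N(4) in blast)
    have "ln (real (cover_number S s)) \<le> ln (real N)"
      using cn N(2) by (cases "cover_number S s = 0") auto
    moreover have "real K * ln (real N) \<le> ln (1 / s)"
    proof -
      have "real N ^ K * s \<le> 1" using N(3) le1 K by linarith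
      then have "real N ^ K \<le> 1 / s" using N(1) by (simp add: pos_le_divide_eq)
      then have "ln (real N ^ K) \<le> ln (1 / s)" using N1 N(1,2) by (subst ln_le_cancel_iff) auto
      then show ?thesis using N(2) by (simp add: ln_realpow)
    qed
    moreover have L: "ln (1 / s) > 0" using s N(1) by simp
    ultimately have "real K * ln (real (cover_number S s)) \<le> ln (1 / s)"
      using K by (meson mult_left_mono of_nat_0_le_iff order_trans)
    then have "f s \<le> 1 / real K" using L K by (simp add: f_def field_simps)
    with d(2)[OF N(1) s(1)] K show False by linarith
  qed
  ultimately show ?thesis by (simp add: lower_box_dim_def f_def)
qed

section \<open>Transfer to the spectrum and the spectral measures of complex sequences\<close>

lemma jacobi_spectrum_eq:
  assumes a: "\<And>n. \<bar>a n\<bar> \<le> M"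
  shows "jacobi_spectrum a = self_adjoint.approx_spectrum (J a)"
proof -
  interpret self_adjoint "J a" by (rule J_self_adjoint[of a M, OF a])
  have seq: "bij_betw seq UNIV ell2"
    using type_definition.Rep_range[OF type_definition_l2] by (auto simp: bij_betw_def inj_on_def seq_inject)
  have "bij (\<lambda>u. J a u - E *\<^sub>R u) \<longleftrightarrow> bij_betw (\<lambda>u n. jacobi a u n - complex_of_real E * u n) ell2 ell2" for E
  proof -
    let ?f = "\<lambda>u n. jacobi a u n - complex_of_real E * u n" and ?g = "\<lambda>u. J a u - E *\<^sub>R u"
    have eq: "?f \<circ> seq = seq \<circ> ?g"
      by (auto simp: fun_eq_iff seq_J[of a M, OF a] scaleR_conv_of_real)
    have "bij_betw ?f ell2 ell2 \<longleftrightarrow> bij_betw (?f \<circ> seq) UNIV ell2"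
      by (rule bij_betw_comp_iff[OF seq])
    also have "\<dots> \<longleftrightarrow> bij_betw (seq \<circ> ?g) UNIV ell2" by (simp only: eq)
    also have "\<dots> \<longleftrightarrow> bij_betw ?g UNIV UNIV"
      by (rule bij_betw_comp_iff2[OF seq, symmetric]) auto
    finally show ?thesis ..
  qed
  then show ?thesis
    unfolding jacobi_spectrum_def by (intro set_eqI) (simp only: mem_Collect_eq approx_spectrum_iff_not_bij)
qed

text \<open>The imaginary part has to vanish. Multiplication by the imaginary unit,
  \<open>rot\<close>, commutes with \<open>J a\<close> and is antisymmetric for the real inner
  product, so \<open>inner (rot u) v\<close> equals its own negative.\<close>

lemma l2_inner_moment:
  assumes a: "\<And>n. \<bar>a n\<bar> \<le> M"
  shows "l2_inner (seq u) ((jacobi a ^^ k) (seq u)) = complex_of_real (inner u ((J a ^^ k) u))"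
proof -
  interpret self_adjoint "J a" by (rule J_self_adjoint[of a M, OF a])
  have pow: "(jacobi a ^^ k) (seq u) = seq ((J a ^^ k) u)" for u k
  proof (induction k)
    case (Suc k)
    have "jacobi a (seq w) = seq (J a w)" for w by (simp add: fun_eq_iff seq_J[of a M, OF a])
    then show ?case by (simp add: Suc)
  qed simp
  define rot where "rot v = of_seq (\<lambda>n. \<i> * seq v n)" for v
  have rot: "seq (rot v) n = \<i> * seq v n" for v n
    unfolding rot_def by (subst seq_of_seq) (auto intro: ell2_scale)
  have Jrot: "(J a ^^ k) (rot v) = rot ((J a ^^ k) v)" for v k
  proof (induction k)
    case (Suc k)
    have "J a (rot w) = rot (J a w)" for w
      by (rule l2_eqI) (simp add: seq_J[of a M, OF a] jacobi_def rot algebra_simps)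
    with Suc show ?case by simp
  qed simp
  have Jsym: "inner ((J a ^^ k) v) w = inner v ((J a ^^ k) w)" for v w
    using poly_op_symmetric[of "[:0,1:] ^ k" v w] by (simp only: poly_op_X_power)
  have rot_inner: "inner (rot v) w = - inner v (rot w)" for v w
  proof -
    have "inner (seq (rot v) n) (seq w n) = - inner (seq v n) (seq (rot w) n)" for n
      by (simp add: rot inner_complex_def)
    then show ?thesis by (simp add: inner_l2_def infsum_uminus)
  qed
  define v where "v = (J a ^^ k) u"
  have "inner (rot u) v = inner (rot v) u" unfolding v_def by (simp only: Jsym[symmetric] Jrot)
  also have "\<dots> = - inner (rot u) v" unfolding rot_inner[of v u] by (simp add: inner_commute)
  finally have rot0: "inner (rot u) v = 0" by simp
  have sum: "(\<lambda>n. cnj (seq u n) * seq v n) summable_on UNIV" by (rule ell2_inner_summable) auto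
  have re: "Re (l2_inner (seq u) (seq v)) = inner u v"
    unfolding l2_inner_def inner_l2_def infsum_Re[OF sum, symmetric] by (simp add: inner_complex_def)
  have im: "Im (l2_inner (seq u) (seq v)) = inner (rot u) v"
    unfolding l2_inner_def inner_l2_def infsum_Im[OF sum, symmetric] by (simp add: inner_complex_def rot)
  show ?thesis unfolding pow v_def[symmetric] using re im rot0 by (simp add: complex_eq_iff)
qed

theorem theorem1p6:
  fixes M :: real
  assumes "M > 1"
  shows "\<exists>D. sup_dense_in D (LP_plus M) \<and>
           (\<forall>a\<in>D. cantor_set (jacobi_spectrum a) \<and>
                   lower_box_dim (jacobi_spectrum a) = 0 \<and>
                   purely_singular_continuous_spectrum a)"
proof (rule exI[of _ "{a \<in> LP_plus M. \<forall>K. thinly_approximated M K a}"], rule conjI)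
  show "sup_dense_in {a \<in> LP_plus M. \<forall>K. thinly_approximated M K a} (LP_plus M)"
    by (rule thinly_approximated_dense[OF assms])
  show "\<forall>a\<in>{a \<in> LP_plus M. \<forall>K. thinly_approximated M K a}. cantor_set (jacobi_spectrum a) \<and>
      lower_box_dim (jacobi_spectrum a) = 0 \<and> purely_singular_continuous_spectrum a"
  proof
    fix a assume "a \<in> {a \<in> LP_plus M. \<forall>K. thinly_approximated M K a}"
    then have a: "\<And>n. inverse M \<le> a n" "\<And>n. a n \<le> M" and thin: "\<And>K. thinly_approximated M K a"
      by (auto simp: LP_plus_def)
    have aM: "\<bar>a n\<bar> \<le> M" for n
    proof -
      have "0 < inverse M" using assms by simp
      then show ?thesis using a(1,2)[of n] by linarith
    qed
    interpret self_adjoint "J a" by (rule J_self_adjoint[of a M, OF aM])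
    have no_ev: "u = 0" if "J a u = E *\<^sub>R u" for u E
    proof (rule gordon_no_eigenvector[OF assms aM _ that])
      fix k :: nat
      show "\<exists>b q. q \<ge> k \<and> (\<forall>n. b (n + int q) = b n) \<and> (\<forall>n. inverse M \<le> b n \<and> b n \<le> M) \<and>
        (\<exists>\<rho>. (\<forall>n. \<bar>a n - b n\<bar> \<le> \<rho>) \<and> real (Suc k) * (\<rho> * period_const M (2 * M) q) \<le> 1)"
        using thin[of k] unfolding thinly_approximated_def by blast
    qed
    have cov: "thinly_covered approx_spectrum"
      unfolding thinly_covered_def
    proof
      fix K :: nat
      obtain b q \<eta> N s c \<rho> where b: "\<And>n. inverse M \<le> b n \<and> b n \<le> M" and \<eta>: "0 < \<eta>" "0 < s" "0 < N" "real N ^ K * s \<le> 1 / real (Suc K)"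
        and ps: "pseudo_spectrum b \<eta> (2 * M) \<subseteq> (\<Union>i<N. {c (i::nat)..c i + s})" and \<rho>: "\<And>n. \<bar>a n - b n\<bar> \<le> \<rho>" "4 * \<rho> \<le> \<eta>"
        using thin[of K] unfolding thinly_approximated_def by blast
      have bM: "\<bar>b n\<bar> \<le> M" for n
      proof -
        have "0 < inverse M" using assms by simp
        then show ?thesis using b[of n] by linarith
      qed
      \<comment> \<open>Half of \<open>\<eta>\<close> pays for the approximate eigenvector of
        \<open>J a\<close>, the other half for replacing \<open>a\<close> by
        \<open>b\<close>.\<close>
      have "approx_spectrum \<subseteq> pseudo_spectrum b \<eta> (2 * M)"
      proof
        fix E assume E: "E \<in> approx_spectrum"
        have "\<bar>E\<bar> \<le> 2 * M" by (rule approx_spectrum_le[OF norm_J_le[OF aM] E])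
        moreover obtain u where u: "norm (J a u - E *\<^sub>R u) < (\<eta> / 2) * norm u"
          using E \<eta>(1) by (auto simp: approx_spectrum_def not_le dest!: spec[of _ "\<eta> / 2"])
        moreover have "u \<noteq> 0" using u by auto
        moreover have "norm (res b E u) \<le> \<eta> * norm u"
        proof -
          have "res b E u = (J a u - E *\<^sub>R u) - J (\<lambda>n. a n - b n) u"
            by (rule l2_eqI) (simp add: seq_res[of b M, OF bM] seq_J[of a M, OF aM] seq_J[of "\<lambda>n. a n - b n" \<rho>, OF \<rho>(1)]
                jacobi_def scaleR_conv_of_real algebra_simps)
          then have "norm (res b E u) \<le> norm (J a u - E *\<^sub>R u) + norm (J (\<lambda>n. a n - b n) u)"
            by (simp add: norm_triangle_ineq4)
          also have "\<dots> \<le> (\<eta> / 2) * norm u + (2 * \<rho>) * norm u"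
            using u norm_J_le[of "\<lambda>n. a n - b n" \<rho> u, OF \<rho>(1)] by simp
          also have "\<dots> \<le> (\<eta> / 2) * norm u + (\<eta> / 2) * norm u"
            using \<rho>(2) by (intro add_left_mono mult_right_mono) auto
          finally show ?thesis by simp
        qed
        ultimately show "E \<in> pseudo_spectrum b \<eta> (2 * M)" unfolding pseudo_spectrum_def by blast
      qed
      then show "\<exists>N s c. 0 < s \<and> 0 < N \<and> real N ^ K * s \<le> 1 / real (Suc K) \<and> approx_spectrum \<subseteq> (\<Union>i<N. {c (i::nat)..c i + s})"
        using ps \<eta> by blast
    qed
    have borel: "approx_spectrum \<in> sets borel" using closed_approx_spectrum by simp
    have null: "emeasure lborel approx_spectrum = 0" by (rule thinly_covered_null[OF cov borel])
    have "E islimpt approx_spectrum" if "E \<in> approx_spectrum" for E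
      by (rule approx_spectrum_islimpt) (use no_ev that in blast)+
    then have "cantor_set approx_spectrum"
      using compact_approx_spectrum null_imp_interior_empty[OF null borel] by (simp add: cantor_set_def)
    moreover have "purely_singular_continuous_spectrum a"
      unfolding purely_singular_continuous_spectrum_def
    proof
      fix \<psi> assume "\<psi> \<in> ell2"
      then have \<psi>: "seq (of_seq \<psi>) = \<psi>" by simp
      obtain \<mu> where sm: "spectral_measure (of_seq \<psi>) \<mu>" using spectral_measure_exists by blast
      have sets: "sets \<mu> = sets borel" and fin: "finite_measure \<mu>" using sm by (auto simp: spectral_measure_def)
      interpret \<mu>: finite_measure \<mu> by (rule fin)
      have "is_spectral_measure a \<psi> \<mu>"
        unfolding is_spectral_measure_def
      proof (intro conjI allI sets fin)
        fix k :: nat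
        have e: "poly ([:0,1:] ^ k) = (\<lambda>x::real. x ^ k)" by (simp add: fun_eq_iff)
        show "integrable \<mu> (\<lambda>x. x ^ k)" using spectral_measure_integrable[OF sm, of "[:0,1:] ^ k"] by (simp only: e)
        have "(LINT x|\<mu>. poly ([:0,1:] ^ k) x) = inner (of_seq \<psi>) (poly_op ([:0,1:] ^ k) (of_seq \<psi>))"
          using sm unfolding spectral_measure_def by blast
        then show "complex_of_real (LINT x|\<mu>. x ^ k) = l2_inner \<psi> ((jacobi a ^^ k) \<psi>)"
          using l2_inner_moment[of a M "of_seq \<psi>" k, OF aM] by (simp only: e \<psi> poly_op_X_power)
      qed
      moreover have "emeasure \<mu> {x} = 0" for x
        using atom_imp_eigenvector[OF sm, of x] no_ev by (auto simp: \<mu>.emeasure_eq_measure)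
      ultimately show "\<exists>\<mu>. is_spectral_measure a \<psi> \<mu> \<and>
          (\<exists>N\<in>sets borel. emeasure lborel N = 0 \<and> emeasure \<mu> (UNIV - N) = 0) \<and> (\<forall>x. emeasure \<mu> {x} = 0)"
        using borel null AE_approx_spectrum[OF sm] by blast
    qed
    ultimately show "cantor_set (jacobi_spectrum a) \<and> lower_box_dim (jacobi_spectrum a) = 0 \<and> purely_singular_continuous_spectrum a"
      using thinly_covered_lower_box_dim[OF cov] by (simp add: jacobi_spectrum_eq[of a M, OF aM])
  qed
qed

end
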